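(* Let $m$ be a locally summable weight on a simplicial complex $\Sigma$ and let $\circ\in\{+,-,H\}$. Consider Laplacians $\Delta^\circ$ (with associated closed form $Q^\circ$); if $\circ=H$, consider only Laplacians with $Q^H\subseteq Q^+_N+Q^-_N$. The following statements are equivalent: (i) $F^c\subseteq D(\Delta^\circ)$ for some (equivalently, for all) such Laplacians $\Delta^\circ$. (ii) $\mathcal H^\circ F^c\subseteq\ell^2$. (iii) $\varphi^\circ_\tau\in\ell^2$ for all $\tau\in\Sigma$, where $\varphi^\circ_\tau(\tau')=b^\circ(\tau,\tau')/m(\tau')$, $\tau'\in\Sigma$. (iv) $\ell^2\subseteq F^\circ$. These statements are in particular satisfied if $\Sigma$ is locally finite.
   Context: Simplicial complex: $V$ is a countable set and $\hat\Sigma$ is a collection of finite subsets of $V$ closed under taking subsets. $\dim\tau=|\tau|-1$, $\hat\Sigma_k=\{\tau\in\hat\Sigma:\dim\tau=k\}$. A weight is a function $m:\hat\Sigma\to(0,\infty)$. Put $\Sigma=\hat\Sigma$ if $\sum_{v\in\hat\Sigma_0}m(v)<\infty$, and $\Sigma=\hat\Sigma\setminus\{\varnothing\}$ otherwise; $\Sigma_k=\hat\Sigma_k\cap\Sigma$. The relation $\tau\prec\sigma$ (equivalently $\sigma\succ\tau$) means $\tau,\sigma\in\Sigma$, $\tau\subset\sigma$ and $|\sigma\setminus\tau|=1$. All sums are over elements of $\Sigma$. The weight is locally summable if $\sum_{\sigma\succ\tau}m(\sigma)<\infty$ for all $\tau\in\Sigma$. $\Sigma$ is locally finite if every $\tau\neq\varnothing$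 has only finitely many $\sigma\succ\tau$. Functions: $F=\mathbb{R}^{\Sigma}$; $F^c$ is the subspace of finitely supported functions; $F^1=\{\omega\in F:\sum_{\sigma\succ\tau}m(\sigma)|\omega(\sigma)|<\infty\text{ for all }\tau\in\Sigma\}$. Coboundary operator: a linear map $\delta:F\to F$ with $\delta\delta=0$ such that $\theta(\tau,\sigma):=\delta 1_\tau(\sigma)\in\{-1,0,1\}$, $\theta(\tau,\sigma)\neq0$ iff $\tau\prec\sigma$, and $\delta\omega(\sigma)=\sum_{\tau\prec\sigma}\omega(\tau)\theta(\tau,\sigma)$. Boundary operator: $\partial:F^1\to F$, $\partial\omega(\rho)=\frac1{m(\rho)}\sum_{\tau\succ\rho}m(\tau)\omega(\tau)\theta(\rho,\tau)$. Forms and Laplacians: $\|\omega\|^2=\sum_\Sigma m\omega^2$, $\ell^2=\ell^2(\Sigma,m)=\{\omega\in F:\|\omega\|<\infty\}$. Put $\mathcal Q^+(\omega)=\|\delta\omega\|^2$ for $\omega\in F$, and $\mathcal Q^-(\omega)=\|\partial\omega\|^2$, $\mathcal Q^H(\omega)=\|\delta\omega+\partial\omega\|^2$ for $\omega\in F^1$; $\mathcal D^\circ=\{\omega:\mathcal Q^\circ(\omega)<\infty\}$. $Q^\circ_N$ is the restriction of $\mathcal Q^\circ$ to $D(Q^\circ_N)=\mathcal D^\circ\cap\ell^2$, and $Q^\circ_D$ its restriction to the closure of $F^c$ in $D(Q_N^\circ)$ with respect to $(\mathcal Q^\circ(\cdot)+\|\cdot\|^2)^{1/2}$. For forms, $Q\subseteq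 Q'$ means $D(Q)\subseteq D(Q')$ and $Q=Q'$ on $D(Q)$; $D(Q^+_N+Q^-_N)=D(Q^+_N)\cap D(Q^-_N)$. A Laplacian $\Delta^\circ$ is the positive self-adjoint operator on $\ell^2$ associated to a closed form $Q^\circ$ with $Q^\circ_D\subseteq Q^\circ\subseteq Q^\circ_N$. Signed Schrödinger operators: for $\tau,\tau'\in\Sigma$ (an indicator is $0$ if the relation fails, in particular if $\tau\cup\tau'$ or $\tau\cap\tau'$ is not in $\Sigma$) $b^+(\tau,\tau')=m(\tau\cup\tau')1_{\tau,\tau'\prec\tau\cup\tau'}$, $b^-(\tau,\tau')=\frac{m(\tau)m(\tau')}{m(\tau\cap\tau')}1_{\tau\cap\tau'\prec\tau,\tau'}$, $b^H=|b^--b^+|$; $o^+(\tau,\tau')=-\theta(\tau,\tau\cup\tau')\theta(\tau',\tau\cup\tau')1_{\tau,\tau'\prec\tau\cup\tau'}$, $o^-(\tau,\tau')=-\theta(\tau\cap\tau',\tau)\theta(\tau\cap\tau',\tau')1_{\tau\cap\tau'\prec\tau,\tau'}$, $o^H(\tau,\tau')=o^-(\tau,\tau')\,\mathrm{sgn}(b^-(\tau,\tau')-b^+(\tau,\tau'))$, except that $o^H(\tau,\tau')=o^+(\tau,\tau')$ if $\tau,\tau'\in\Sigma_0$ and $\varnothing\notin\Sigma$; $c^+(\tau)=-\dim(\tau)\sum_{\sigma\succ\tau}m(\sigma)$, $c^-(\tau)=\sum_{\rho\prec\tau}\frac{m(\tau)}{m(\rho)}\big(m(\tau)-\sum_{\tau'\succ\rho,\tau'\neq\tau}m(\tau')\big)$,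 $c^H(\tau)=\sum_{\rho\prec\tau}\frac{m(\tau)^2}{m(\rho)}+\sum_{\sigma\succ\tau}m(\sigma)-\sum_{\tau'\in\Sigma}b^H(\tau,\tau')$. $F^\circ=\{\omega\in F:\sum_{\tau'}b^\circ(\tau,\tau')|\omega(\tau')|<\infty\text{ for all }\tau\in\Sigma\}$ and $\mathcal H^\circ:F^\circ\to F$ is $$\mathcal H^\circ\omega(\tau)=\frac1{m(\tau)}\sum_{\tau'\in\Sigma}b^\circ(\tau,\tau')\big(\omega(\tau)-o^\circ(\tau,\tau')\omega(\tau')\big)+\frac{c^\circ(\tau)}{m(\tau)}\omega(\tau).$$ *)

theory Defs
  imports "HOL-Analysis.Analysis"
begin

section \<open>Weighted simplicial complexes\<close>

definition abstract_simplicial_complex :: "'v set \<Rightarrow> 'v set set \<Rightarrow> bool" where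
  "abstract_simplicial_complex V Sh \<longleftrightarrow>
     countable V \<and> (\<forall>\<tau>\<in>Sh. finite \<tau> \<and> \<tau> \<subseteq> V) \<and> (\<forall>\<tau>\<in>Sh. \<forall>\<rho>. \<rho> \<subseteq> \<tau> \<longrightarrow> \<rho> \<in> Sh)"

definition dimension :: "'v set \<Rightarrow> int" where
  "dimension \<tau> = int (card \<tau>) - 1"

definition is_weight :: "'v set set \<Rightarrow> ('v set \<Rightarrow> real) \<Rightarrow> bool" where
  "is_weight Sh m \<longleftrightarrow> (\<forall>\<tau>\<in>Sh. 0 < m \<tau>)"

text \<open>The complex with or without the empty simplex, depending on the total vertex mass.
  In everything that follows, \<open>S\<close> stands for this set of simplices.\<close>

definition simplices :: "'v set set \<Rightarrow> ('v set \<Rightarrow> real) \<Rightarrow> 'v set set" where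
  "simplices Sh m =
     (if m summable_on {\<tau> \<in> Sh. dimension \<tau> = 0} then Sh else Sh - {{}})"

definition face :: "'v set set \<Rightarrow> 'v set \<Rightarrow> 'v set \<Rightarrow> bool" where
  "face S \<tau> \<sigma> \<longleftrightarrow> \<tau> \<in> S \<and> \<sigma> \<in> S \<and> \<tau> \<subset> \<sigma> \<and> card (\<sigma> - \<tau>) = 1"

definition locally_summable :: "'v set set \<Rightarrow> ('v set \<Rightarrow> real) \<Rightarrow> bool" where
  "locally_summable S m \<longleftrightarrow> (\<forall>\<tau>\<in>S. m summable_on {\<sigma>. face S \<tau> \<sigma>})"

definition locally_finite_complex :: "'v set set \<Rightarrow> bool" where
  "locally_finite_complex S \<longleftrightarrow> (\<forall>\<tau>\<in>S. \<tau> \<noteq> {} \<longrightarrow> finite {\<sigma>. face S \<tau> \<sigma>})"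


section \<open>Function spaces, coboundary and boundary\<close>

text \<open>Functions on \<open>S\<close> are represented by total functions vanishing off \<open>S\<close>, so that
  equality of functions on \<open>S\<close> is equality in HOL.\<close>

definition Fun_on :: "'v set set \<Rightarrow> ('v set \<Rightarrow> real) set" where
  "Fun_on S = {\<omega>. \<forall>\<tau>. \<tau> \<notin> S \<longrightarrow> \<omega> \<tau> = 0}"

definition Fun_fin :: "'v set set \<Rightarrow> ('v set \<Rightarrow> real) set" where
  "Fun_fin S = {\<omega> \<in> Fun_on S. finite {\<tau>. \<omega> \<tau> \<noteq> 0}}"

definition Fun_1 :: "'v set set \<Rightarrow> ('v set \<Rightarrow> real) \<Rightarrow> ('v set \<Rightarrow> real) set" where
  "Fun_1 S m =
     {\<omega> \<in> Fun_on S. \<forall>\<tau>\<in>S. (\<lambda>\<sigma>. m \<sigma> * \<bar>\<omega> \<sigma>\<bar>) summable_on {\<sigma>. face S \<tau> \<sigma>}}"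

definition incidence ::
  "(('v set \<Rightarrow> real) \<Rightarrow> ('v set \<Rightarrow> real)) \<Rightarrow> 'v set \<Rightarrow> 'v set \<Rightarrow> real" where
  "incidence \<delta> \<tau> \<sigma> = \<delta> (indicat_real {\<tau>}) \<sigma>"

definition coboundary_operator ::
  "'v set set \<Rightarrow> (('v set \<Rightarrow> real) \<Rightarrow> ('v set \<Rightarrow> real)) \<Rightarrow> bool" where
  "coboundary_operator S \<delta> \<longleftrightarrow>
     (\<forall>\<omega>\<in>Fun_on S. \<delta> \<omega> \<in> Fun_on S) \<and>
     (\<forall>\<omega>\<in>Fun_on S. \<forall>\<eta>\<in>Fun_on S. \<forall>a b.
        \<delta> (\<lambda>\<tau>. a * \<omega> \<tau> + b * \<eta> \<tau>) = (\<lambda>\<sigma>. a * \<delta> \<omega> \<sigma> + b * \<delta> \<eta> \<sigma>)) \<and>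
     (\<forall>\<omega>\<in>Fun_on S. \<delta> (\<delta> \<omega>) = (\<lambda>_. 0)) \<and>
     (\<forall>\<tau>\<in>S. \<forall>\<sigma>\<in>S. incidence \<delta> \<tau> \<sigma> \<in> {-1, 0, 1} \<and>
        (incidence \<delta> \<tau> \<sigma> \<noteq> 0 \<longleftrightarrow> face S \<tau> \<sigma>)) \<and>
     (\<forall>\<omega>\<in>Fun_on S. \<forall>\<sigma>\<in>S. \<delta> \<omega> \<sigma> = (\<Sum>\<tau> | face S \<tau> \<sigma>. \<omega> \<tau> * incidence \<delta> \<tau> \<sigma>))"

text \<open>For \<open>\<rho> \<notin> S\<close> the sum is empty, so the result vanishes off \<open>S\<close>.\<close>

definition boundary ::
  "'v set set \<Rightarrow> ('v set \<Rightarrow> real) \<Rightarrow> (('v set \<Rightarrow> real) \<Rightarrow> ('v set \<Rightarrow> real)) \<Rightarrow>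
   ('v set \<Rightarrow> real) \<Rightarrow> ('v set \<Rightarrow> real)" where
  "boundary S m \<delta> \<omega> \<rho> =
     1 / m \<rho> * (\<Sum>\<^sub>\<infinity>\<tau> | face S \<rho> \<tau>. m \<tau> * \<omega> \<tau> * incidence \<delta> \<rho> \<tau>)"

definition l2 :: "'v set set \<Rightarrow> ('v set \<Rightarrow> real) \<Rightarrow> ('v set \<Rightarrow> real) set" where
  "l2 S m = {\<omega> \<in> Fun_on S. (\<lambda>\<tau>. m \<tau> * (\<omega> \<tau>)\<^sup>2) summable_on S}"

definition l2_inner ::
  "'v set set \<Rightarrow> ('v set \<Rightarrow> real) \<Rightarrow> ('v set \<Rightarrow> real) \<Rightarrow> ('v set \<Rightarrow> real) \<Rightarrow> real" where
  "l2_inner S m \<omega> \<eta> = (\<Sum>\<^sub>\<infinity>\<tau>\<in>S. m \<tau> * \<omega> \<tau> * \<eta> \<tau>)"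

text \<open>Real-valued, hence meaningful only on \<open>l2 S m\<close>; finiteness of the norm is membership
  in \<open>l2 S m\<close>.\<close>

definition l2_normsq :: "'v set set \<Rightarrow> ('v set \<Rightarrow> real) \<Rightarrow> ('v set \<Rightarrow> real) \<Rightarrow> real" where
  "l2_normsq S m \<omega> = (\<Sum>\<^sub>\<infinity>\<tau>\<in>S. m \<tau> * (\<omega> \<tau>)\<^sup>2)"


section \<open>Quadratic forms and associated operators\<close>

text \<open>A form is a domain together with its values; values off the domain are irrelevant.\<close>

datatype 'v qform =
  QForm (form_dom: "('v set \<Rightarrow> real) set") (form_val: "('v set \<Rightarrow> real) \<Rightarrow> real")

definition form_le :: "'v qform \<Rightarrow> 'v qform \<Rightarrow> bool"  (infix "\<sqsubseteq>\<^sub>Q" 50) where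
  "Q \<sqsubseteq>\<^sub>Q Q' \<longleftrightarrow>
     form_dom Q \<subseteq> form_dom Q' \<and> (\<forall>\<omega>\<in>form_dom Q. form_val Q \<omega> = form_val Q' \<omega>)"

definition form_add :: "'v qform \<Rightarrow> 'v qform \<Rightarrow> 'v qform" where
  "form_add Q Q' =
     QForm (form_dom Q \<inter> form_dom Q') (\<lambda>\<omega>. form_val Q \<omega> + form_val Q' \<omega>)"

definition form_norm ::
  "'v set set \<Rightarrow> ('v set \<Rightarrow> real) \<Rightarrow> 'v qform \<Rightarrow> ('v set \<Rightarrow> real) \<Rightarrow> real" where
  "form_norm S m Q \<omega> = sqrt (form_val Q \<omega> + l2_normsq S m \<omega>)"

text \<open>The bilinear form of a quadratic form, by polarization.\<close>

definition form_bilinear :: "'v qform \<Rightarrow> ('v set \<Rightarrow> real) \<Rightarrow> ('v set \<Rightarrow> real) \<Rightarrow> real" where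
  "form_bilinear Q \<omega> \<eta> =
     (form_val Q (\<lambda>\<tau>. \<omega> \<tau> + \<eta> \<tau>) - form_val Q (\<lambda>\<tau>. \<omega> \<tau> - \<eta> \<tau>)) / 4"

definition positive_form :: "'v set set \<Rightarrow> ('v set \<Rightarrow> real) \<Rightarrow> 'v qform \<Rightarrow> bool" where
  "positive_form S m Q \<longleftrightarrow>
     form_dom Q \<subseteq> l2 S m \<and> (\<lambda>_. 0) \<in> form_dom Q \<and>
     (\<forall>\<omega>\<in>form_dom Q. \<forall>\<eta>\<in>form_dom Q. \<forall>a b. (\<lambda>\<tau>. a * \<omega> \<tau> + b * \<eta> \<tau>) \<in> form_dom Q) \<and>
     (\<forall>\<omega>\<in>form_dom Q. 0 \<le> form_val Q \<omega> \<and> form_bilinear Q \<omega> \<omega> = form_val Q \<omega>) \<and>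
     (\<forall>\<omega>\<in>form_dom Q. \<forall>\<eta>\<in>form_dom Q. form_bilinear Q \<omega> \<eta> = form_bilinear Q \<eta> \<omega>) \<and>
     (\<forall>\<omega>\<in>form_dom Q. \<forall>\<omega>'\<in>form_dom Q. \<forall>\<eta>\<in>form_dom Q. \<forall>a b.
        form_bilinear Q (\<lambda>\<tau>. a * \<omega> \<tau> + b * \<omega>' \<tau>) \<eta> =
        a * form_bilinear Q \<omega> \<eta> + b * form_bilinear Q \<omega>' \<eta>)"

text \<open>Closedness is completeness of the domain with respect to the form norm.\<close>

definition closed_form :: "'v set set \<Rightarrow> ('v set \<Rightarrow> real) \<Rightarrow> 'v qform \<Rightarrow> bool" where
  "closed_form S m Q \<longleftrightarrow> positive_form S m Q \<and>
     (\<forall>w :: nat \<Rightarrow> 'v set \<Rightarrow> real.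
        (\<forall>n. w n \<in> form_dom Q) \<and>
        (\<forall>e>0. \<exists>N. \<forall>i\<ge>N. \<forall>j\<ge>N. form_norm S m Q (\<lambda>\<tau>. w i \<tau> - w j \<tau>) < e) \<longrightarrow>
        (\<exists>\<omega>\<in>form_dom Q. (\<lambda>n. form_norm S m Q (\<lambda>\<tau>. w n \<tau> - \<omega> \<tau>)) \<longlonglongrightarrow> 0))"

text \<open>The operator associated to a form: \<open>\<omega>\<close> is in its domain, with image \<open>\<eta>\<close>, iff
  \<open>\<omega> \<in> D(Q)\<close> and \<open>Q(\<omega>,\<phi>) = \<langle>\<eta>,\<phi>\<rangle>\<close> for all \<open>\<phi> \<in> D(Q)\<close>. For a closed, positive and densely
  defined form this is the positive self-adjoint operator given by the first representation
  theorem, and \<open>\<eta>\<close> is unique. Unbounded operators are partial functions; their domain is \<open>dom\<close>.\<close>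

definition form_operator ::
  "'v set set \<Rightarrow> ('v set \<Rightarrow> real) \<Rightarrow> 'v qform \<Rightarrow> ('v set \<Rightarrow> real) \<rightharpoonup> ('v set \<Rightarrow> real)" where
  "form_operator S m Q \<omega> =
     (let represents = (\<lambda>\<eta>. \<eta> \<in> l2 S m \<and>
            (\<forall>\<phi>\<in>form_dom Q. form_bilinear Q \<omega> \<phi> = l2_inner S m \<eta> \<phi>))
      in if \<omega> \<in> form_dom Q \<and> (\<exists>\<eta>. represents \<eta>) then Some (THE \<eta>. represents \<eta>) else None)"


section \<open>Laplacians\<close>

text \<open>\<open>Up\<close>, \<open>Down\<close>, \<open>Hodge\<close> stand for the superscripts \<open>+\<close>, \<open>-\<close>, \<open>H\<close>.\<close>

datatype kind = Up | Down | Hodge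

text \<open>\<open>kind_map\<close> is the operator whose squared norm is the form of the given kind;
  \<open>kind_space\<close> is the space of functions on which it is defined.\<close>

fun kind_space :: "kind \<Rightarrow> 'v set set \<Rightarrow> ('v set \<Rightarrow> real) \<Rightarrow> ('v set \<Rightarrow> real) set" where
  "kind_space Up S m = Fun_on S"
| "kind_space Down S m = Fun_1 S m"
| "kind_space Hodge S m = Fun_1 S m"

fun kind_map ::
  "kind \<Rightarrow> 'v set set \<Rightarrow> ('v set \<Rightarrow> real) \<Rightarrow> (('v set \<Rightarrow> real) \<Rightarrow> ('v set \<Rightarrow> real)) \<Rightarrow>
   ('v set \<Rightarrow> real) \<Rightarrow> ('v set \<Rightarrow> real)" where
  "kind_map Up S m \<delta> \<omega> = \<delta> \<omega>"
| "kind_map Down S m \<delta> \<omega> = boundary S m \<delta> \<omega>"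
| "kind_map Hodge S m \<delta> \<omega> = (\<lambda>\<tau>. \<delta> \<omega> \<tau> + boundary S m \<delta> \<omega> \<tau>)"

definition energy_dom ::
  "kind \<Rightarrow> 'v set set \<Rightarrow> ('v set \<Rightarrow> real) \<Rightarrow> (('v set \<Rightarrow> real) \<Rightarrow> ('v set \<Rightarrow> real)) \<Rightarrow>
   ('v set \<Rightarrow> real) set" where
  "energy_dom k S m \<delta> = {\<omega> \<in> kind_space k S m. kind_map k S m \<delta> \<omega> \<in> l2 S m}"

definition energy ::
  "kind \<Rightarrow> 'v set set \<Rightarrow> ('v set \<Rightarrow> real) \<Rightarrow> (('v set \<Rightarrow> real) \<Rightarrow> ('v set \<Rightarrow> real)) \<Rightarrow>
   ('v set \<Rightarrow> real) \<Rightarrow> real" where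
  "energy k S m \<delta> \<omega> = l2_normsq S m (kind_map k S m \<delta> \<omega>)"

definition Neumann_form ::
  "kind \<Rightarrow> 'v set set \<Rightarrow> ('v set \<Rightarrow> real) \<Rightarrow> (('v set \<Rightarrow> real) \<Rightarrow> ('v set \<Rightarrow> real)) \<Rightarrow>
   'v qform" where
  "Neumann_form k S m \<delta> = QForm (energy_dom k S m \<delta> \<inter> l2 S m) (energy k S m \<delta>)"

definition Dirichlet_form ::
  "kind \<Rightarrow> 'v set set \<Rightarrow> ('v set \<Rightarrow> real) \<Rightarrow> (('v set \<Rightarrow> real) \<Rightarrow> ('v set \<Rightarrow> real)) \<Rightarrow>
   'v qform" where
  "Dirichlet_form k S m \<delta> =
     QForm {\<omega> \<in> form_dom (Neumann_form k S m \<delta>).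
              \<forall>e>0. \<exists>\<phi>\<in>Fun_fin S. form_norm S m (Neumann_form k S m \<delta>) (\<lambda>\<tau>. \<omega> \<tau> - \<phi> \<tau>) < e}
           (energy k S m \<delta>)"

definition is_Laplacian ::
  "kind \<Rightarrow> 'v set set \<Rightarrow> ('v set \<Rightarrow> real) \<Rightarrow> (('v set \<Rightarrow> real) \<Rightarrow> ('v set \<Rightarrow> real)) \<Rightarrow>
   'v qform \<Rightarrow> (('v set \<Rightarrow> real) \<rightharpoonup> ('v set \<Rightarrow> real)) \<Rightarrow> bool" where
  "is_Laplacian k S m \<delta> Q L \<longleftrightarrow>
     closed_form S m Q \<and> Dirichlet_form k S m \<delta> \<sqsubseteq>\<^sub>Q Q \<and> Q \<sqsubseteq>\<^sub>Q Neumann_form k S m \<delta> \<and>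
     L = form_operator S m Q"

definition admissible_Laplacian ::
  "kind \<Rightarrow> 'v set set \<Rightarrow> ('v set \<Rightarrow> real) \<Rightarrow> (('v set \<Rightarrow> real) \<Rightarrow> ('v set \<Rightarrow> real)) \<Rightarrow>
   (('v set \<Rightarrow> real) \<rightharpoonup> ('v set \<Rightarrow> real)) \<Rightarrow> bool" where
  "admissible_Laplacian k S m \<delta> L \<longleftrightarrow>
     (\<exists>Q. is_Laplacian k S m \<delta> Q L \<and>
        (k = Hodge \<longrightarrow> Q \<sqsubseteq>\<^sub>Q form_add (Neumann_form Up S m \<delta>) (Neumann_form Down S m \<delta>)))"


section \<open>Signed Schroedinger operators\<close>

text \<open>All coefficients vanish if one of the simplices is not in \<open>S\<close>, by definition of
  \<^const>\<open>face\<close>; in particular \<open>schroedinger\<close> maps into \<^const>\<open>Fun_on\<close> \<open>S\<close>.\<close>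

definition b_up :: "'v set set \<Rightarrow> ('v set \<Rightarrow> real) \<Rightarrow> 'v set \<Rightarrow> 'v set \<Rightarrow> real" where
  "b_up S m \<tau> \<tau>' =
     (if face S \<tau> (\<tau> \<union> \<tau>') \<and> face S \<tau>' (\<tau> \<union> \<tau>') then m (\<tau> \<union> \<tau>') else 0)"

definition b_down :: "'v set set \<Rightarrow> ('v set \<Rightarrow> real) \<Rightarrow> 'v set \<Rightarrow> 'v set \<Rightarrow> real" where
  "b_down S m \<tau> \<tau>' =
     (if face S (\<tau> \<inter> \<tau>') \<tau> \<and> face S (\<tau> \<inter> \<tau>') \<tau>' then m \<tau> * m \<tau>' / m (\<tau> \<inter> \<tau>') else 0)"

fun coef_b :: "kind \<Rightarrow> 'v set set \<Rightarrow> ('v set \<Rightarrow> real) \<Rightarrow> 'v set \<Rightarrow> 'v set \<Rightarrow> real" where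
  "coef_b Up S m \<tau> \<tau>' = b_up S m \<tau> \<tau>'"
| "coef_b Down S m \<tau> \<tau>' = b_down S m \<tau> \<tau>'"
| "coef_b Hodge S m \<tau> \<tau>' = \<bar>b_down S m \<tau> \<tau>' - b_up S m \<tau> \<tau>'\<bar>"

definition o_up ::
  "'v set set \<Rightarrow> (('v set \<Rightarrow> real) \<Rightarrow> ('v set \<Rightarrow> real)) \<Rightarrow> 'v set \<Rightarrow> 'v set \<Rightarrow> real" where
  "o_up S \<delta> \<tau> \<tau>' =
     (if face S \<tau> (\<tau> \<union> \<tau>') \<and> face S \<tau>' (\<tau> \<union> \<tau>')
      then - incidence \<delta> \<tau> (\<tau> \<union> \<tau>') * incidence \<delta> \<tau>' (\<tau> \<union> \<tau>') else 0)"

definition o_down ::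
  "'v set set \<Rightarrow> (('v set \<Rightarrow> real) \<Rightarrow> ('v set \<Rightarrow> real)) \<Rightarrow> 'v set \<Rightarrow> 'v set \<Rightarrow> real" where
  "o_down S \<delta> \<tau> \<tau>' =
     (if face S (\<tau> \<inter> \<tau>') \<tau> \<and> face S (\<tau> \<inter> \<tau>') \<tau>'
      then - incidence \<delta> (\<tau> \<inter> \<tau>') \<tau> * incidence \<delta> (\<tau> \<inter> \<tau>') \<tau>' else 0)"

fun coef_o ::
  "kind \<Rightarrow> 'v set set \<Rightarrow> ('v set \<Rightarrow> real) \<Rightarrow> (('v set \<Rightarrow> real) \<Rightarrow> ('v set \<Rightarrow> real)) \<Rightarrow>
   'v set \<Rightarrow> 'v set \<Rightarrow> real" where
  "coef_o Up S m \<delta> \<tau> \<tau>' = o_up S \<delta> \<tau> \<tau>'"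
| "coef_o Down S m \<delta> \<tau> \<tau>' = o_down S \<delta> \<tau> \<tau>'"
| "coef_o Hodge S m \<delta> \<tau> \<tau>' =
     (if \<tau> \<in> S \<and> \<tau>' \<in> S \<and> dimension \<tau> = 0 \<and> dimension \<tau>' = 0 \<and> {} \<notin> S
      then o_up S \<delta> \<tau> \<tau>'
      else o_down S \<delta> \<tau> \<tau>' * sgn (b_down S m \<tau> \<tau>' - b_up S m \<tau> \<tau>'))"

fun coef_c :: "kind \<Rightarrow> 'v set set \<Rightarrow> ('v set \<Rightarrow> real) \<Rightarrow> 'v set \<Rightarrow> real" where
  "coef_c Up S m \<tau> = - real_of_int (dimension \<tau>) * (\<Sum>\<^sub>\<infinity>\<sigma> | face S \<tau> \<sigma>. m \<sigma>)"
| "coef_c Down S m \<tau> =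
     (\<Sum>\<rho> | face S \<rho> \<tau>. m \<tau> / m \<rho> * (m \<tau> - (\<Sum>\<^sub>\<infinity>\<tau>' | face S \<rho> \<tau>' \<and> \<tau>' \<noteq> \<tau>. m \<tau>')))"
| "coef_c Hodge S m \<tau> =
     (\<Sum>\<rho> | face S \<rho> \<tau>. (m \<tau>)\<^sup>2 / m \<rho>) + (\<Sum>\<^sub>\<infinity>\<sigma> | face S \<tau> \<sigma>. m \<sigma>)
     - (\<Sum>\<^sub>\<infinity>\<tau>'\<in>S. coef_b Hodge S m \<tau> \<tau>')"

definition schroedinger_space ::
  "kind \<Rightarrow> 'v set set \<Rightarrow> ('v set \<Rightarrow> real) \<Rightarrow> ('v set \<Rightarrow> real) set" where
  "schroedinger_space k S m =
     {\<omega> \<in> Fun_on S. \<forall>\<tau>\<in>S. (\<lambda>\<tau>'. coef_b k S m \<tau> \<tau>' * \<bar>\<omega> \<tau>'\<bar>) summable_on S}"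

definition schroedinger ::
  "kind \<Rightarrow> 'v set set \<Rightarrow> ('v set \<Rightarrow> real) \<Rightarrow> (('v set \<Rightarrow> real) \<Rightarrow> ('v set \<Rightarrow> real)) \<Rightarrow>
   ('v set \<Rightarrow> real) \<Rightarrow> ('v set \<Rightarrow> real)" where
  "schroedinger k S m \<delta> \<omega> \<tau> =
     1 / m \<tau> * (\<Sum>\<^sub>\<infinity>\<tau>'\<in>S. coef_b k S m \<tau> \<tau>' * (\<omega> \<tau> - coef_o k S m \<delta> \<tau> \<tau>' * \<omega> \<tau>'))
     + coef_c k S m \<tau> / m \<tau> * \<omega> \<tau>"

definition phi :: "kind \<Rightarrow> 'v set set \<Rightarrow> ('v set \<Rightarrow> real) \<Rightarrow> 'v set \<Rightarrow> 'v set \<Rightarrow> real" where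
  "phi k S m \<tau> \<tau>' = coef_b k S m \<tau> \<tau>' / m \<tau>'"

end

theory Submission
  imports Defs
begin

text \<open>
  Off the diagonal, \<open>\<H> 1\<^sub>\<tau>\<close> equals \<open>\<plusminus> \<phi>\<^sub>\<tau>\<close>, whence (ii) iff (iii), and (iii) iff (iv) is the
  duality of \<open>\<ell>\<^sup>2\<close> with itself. For a form \<open>Q\<close> between \<open>Q\<^sub>D\<close> and \<open>Q\<^sub>N\<close>, expanding the coboundary or
  boundary of \<open>\<phi>\<close> gives \<open>Q(1\<^sub>\<tau>, \<phi>) = \<Sum>\<^sub>\<tau>\<^sub>' m(\<tau>') \<H> 1\<^sub>\<tau>(\<tau>') \<phi>(\<tau>')\<close> as soon as the right-hand side
  converges absolutely, which holds for \<open>\<phi>\<close> finitely supported and, under (iv), for all \<open>\<phi>\<close> in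
  \<open>\<ell>\<^sup>2\<close>. Testing with finitely supported \<open>\<phi>\<close> shows that \<open>1\<^sub>\<tau>\<close> in the domain of the Laplacian forces
  \<open>\<H> 1\<^sub>\<tau>\<close> into \<open>\<ell>\<^sup>2\<close>; conversely, if \<open>\<H> 1\<^sub>\<tau>\<close> is in \<open>\<ell>\<^sup>2\<close>, it represents \<open>Q(1\<^sub>\<tau>, \<cdot>)\<close>. In the Hodge case
  the form splits into the up and down parts; since \<open>b\<^sup>+ \<le> b\<^sup>H + b\<^sup>-\<close> and \<open>\<ell>\<^sup>2\<close> is always
  contained in the space \<open>F\<^sup>-\<close>, absolute convergence for \<open>H\<close> implies it for \<open>+\<close>. The Dirichlet form provides a
  Laplacian, so the quantifiers in (i) are not vacuous.
\<close>

section \<open>Weighted \<open>\<ell>\<^sup>2\<close> spaces\<close>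

text \<open>Two obstacles shape the argument. The two halves of Green's formula are not symmetric: a
  simplex has finitely many faces but possibly infinitely many cofaces. Regrouping over faces is
  therefore automatic on \<open>l2\<close>, while regrouping over cofaces needs absolute convergence
  as an input. For \<open>Hodge\<close>, square summability of \<delta>\<omega> + \<partial>\<omega>
  says nothing about the summands separately, so polarizing the Neumann form would leave cross
  terms. A form below the sum of the two Neumann forms has none, and \<delta>\<delta> = 0 makes the
  images of \<delta> and \<partial> orthogonal on finitely supported functions, which places the
  Dirichlet form below that sum. The coefficients fit because adding c to the total of b leaves
  exactly the energy of the indicator of \<tau> on the diagonal, and because \<delta>\<delta> = 0
  makes the up and down signs opposite wherever both are nonzero. The latter fails to apply only to
  two vertices whose common face, the empty simplex, has been removed; this is the exceptional
  clause in the sign for \<open>Hodge\<close>.\<close>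

text \<open>If the square sum of \<open>f\<close> diverges, take finite sets \<open>F k\<close> on which it exceeds \<open>4\<^sup>k\<close> and give
  each of them total mass \<open>2\<^sup>-\<^sup>k\<close> in the square sum of \<open>g\<close>; then the pairing of \<open>f\<close> and \<open>g\<close> exceeds
  \<open>2\<^sup>k\<^sup>/\<^sup>2\<close> for every \<open>k\<close>.\<close>

lemma summable_square_if_pairings_summable:
  fixes w f :: "'a \<Rightarrow> real"
  assumes w: "\<And>x. x \<in> A \<Longrightarrow> 0 \<le> w x" and f: "\<And>x. x \<in> A \<Longrightarrow> 0 \<le> f x"
    and pair: "\<And>g. (\<lambda>x. w x * (g x)\<^sup>2) summable_on A \<Longrightarrow> (\<lambda>x. w x * f x * \<bar>g x\<bar>) summable_on A"
  shows "(\<lambda>x. w x * (f x)\<^sup>2) summable_on A"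
proof (rule ccontr)
  define s where "s F = (\<Sum>x\<in>F. w x * (f x)\<^sup>2)" for F
  assume not_summable: "\<not> (\<lambda>x. w x * (f x)\<^sup>2) summable_on A"
  have "\<exists>F. finite F \<and> F \<subseteq> A \<and> s F > C" for C
  proof (rule ccontr)
    assume "\<not> ?thesis"
    then have "bdd_above (sum (\<lambda>x. w x * (f x)\<^sup>2) ` {F. F \<subseteq> A \<and> finite F})"
      by (intro bdd_aboveI2[of _ _ C]) (auto simp: s_def not_less)
    then have "(\<lambda>x. w x * (f x)\<^sup>2) summable_on A"
      by (intro nonneg_bdd_above_summable_on) (auto simp: w)
    with not_summable show False by blast
  qed
  then have "\<forall>k. \<exists>F. finite F \<and> F \<subseteq> A \<and> s F > 4 ^ k" by blast
  then obtain F where F: "\<And>k::nat. finite (F k)" "\<And>k. F k \<subseteq> A" "\<And>k. s (F k) > 4 ^ k"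
    by metis
  have s1: "1 \<le> s (F k)" for k
    using F(3)[of k] one_le_power[of "4::real" k] by linarith
  \<comment> \<open>Normalized so that \<open>a k * s (F k)\<close> is 2 to the power -k. The bound
    by (1/2)^k makes the series \<open>c x\<close> converge even if \<open>x\<close> lies in
    infinitely many of the sets.\<close>
  define a where "a k = (1/2) ^ k / s (F k)" for k
  have a: "0 < a k" "a k \<le> (1/2) ^ k" for k
    using s1[of k] by (auto simp: a_def divide_le_eq intro!: divide_pos_pos)
  define t where "t x k = (if x \<in> F k then a k else 0)" for x k
  define c where "c x = (\<Sum>k. t x k)" for x
  have t: "0 \<le> t x k" "t x k \<le> (1/2) ^ k" for x k
    using a[of k] by (auto simp: t_def intro: less_imp_le)
  have sm: "summable (t x)" for x
    by (rule summable_comparison_test[of _ "\<lambda>k. (1/2::real) ^ k"])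
       (use t in \<open>auto intro!: exI[of _ 0]\<close>)
  have c0: "0 \<le> c x" for x
    unfolding c_def using sm t(1) by (rule suminf_nonneg)
  have c_ge: "a k \<le> c x" if "x \<in> F k" for x k
    proof -
    have "t x k \<le> c x"
      using sum_le_suminf[OF sm, of "{k}" x] t(1)[of x] by (simp add: c_def)
    then show ?thesis using that by (simp add: t_def)
  qed
  \<comment> \<open>The sets \<open>F k\<close> may overlap. Adding under the square root makes the
    square of \<open>g\<close> additive in k, so its total mass is at most the geometric sum
    2.\<close>
  define g where "g x = f x * sqrt (c x)" for x
  have bound: "(\<Sum>x\<in>X. w x * (g x)\<^sup>2) \<le> 2" if X: "finite X" "X \<subseteq> A" for X
  proof -
    have "(\<Sum>x\<in>X. w x * (g x)\<^sup>2) = (\<Sum>x\<in>X. \<Sum>k. w x * (f x)\<^sup>2 * t x k)"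
      using c0 by (intro sum.cong) (auto simp: g_def power_mult_distrib c_def suminf_mult sm)
    also have "\<dots> = (\<Sum>k. \<Sum>x\<in>X. w x * (f x)\<^sup>2 * t x k)"
      by (intro suminf_sum[symmetric] summable_mult sm)
    also have "\<dots> \<le> (\<Sum>k. (1/2) ^ k)"
    proof (rule suminf_le)
      fix k
      have "(\<Sum>x\<in>X. w x * (f x)\<^sup>2 * t x k) = (\<Sum>x\<in>X \<inter> F k. w x * (f x)\<^sup>2 * a k)"
        by (subst sum.inter_restrict[OF X(1)]) (auto intro!: sum.cong simp: t_def)
      also have "\<dots> = s (X \<inter> F k) * a k"
        by (simp add: s_def sum_distrib_right)
      also have "\<dots> \<le> s (F k) * a k"
        using a[of k] X F[of k] w
        by (intro mult_right_mono) (auto simp: s_def intro!: sum_mono2)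
      also have "\<dots> = (1/2) ^ k"
        using s1[of k] by (simp add: a_def)
      finally show "(\<Sum>x\<in>X. w x * (f x)\<^sup>2 * t x k) \<le> (1/2) ^ k" .
    qed (auto intro!: summable_sum summable_mult sm)
    also have "\<dots> = 2" by (simp add: suminf_geometric)
    finally show ?thesis .
  qed
  have "(\<lambda>x. w x * (g x)\<^sup>2) summable_on A"
    using bound w by (intro nonneg_bdd_above_summable_on bdd_aboveI2[of _ _ 2]) auto
  then have sp: "(\<lambda>x. w x * f x * \<bar>g x\<bar>) summable_on A" by (rule pair)
  define B where "B = (\<Sum>\<^sub>\<infinity>x\<in>A. w x * f x * \<bar>g x\<bar>)"
  have le: "2 ^ k \<le> B\<^sup>2" for k
  proof -
    \<comment> \<open>The radicand on the right is \<open>a k\<close> times the square of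
      \<open>s (F k)\<close>, and \<open>s (F k)\<close> exceeds 4^k. On \<open>F k\<close> the
      function \<open>g\<close> is at least \<open>f\<close> times
      \<open>sqrt (a k)\<close>.\<close>
    have "sqrt (2 ^ k) \<le> sqrt ((1/2) ^ k * s (F k))"
      using F(3)[of k] by (auto simp: field_simps power_mult_distrib[symmetric])
    also have "\<dots> = s (F k) * sqrt (a k)"
      using s1[of k] by (auto simp: a_def real_sqrt_mult real_sqrt_divide field_simps)
    also have "\<dots> = (\<Sum>x\<in>F k. w x * f x * (f x * sqrt (a k)))"
      unfolding s_def sum_distrib_right
      by (intro sum.cong) (simp_all add: power2_eq_square mult_ac)
    also have "\<dots> \<le> (\<Sum>x\<in>F k. w x * f x * \<bar>g x\<bar>)"
      using F(2)[of k] w f c_ge c0 a(1)[of k]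
      by (intro sum_mono mult_left_mono) (auto simp: g_def abs_mult intro!: mult_mono)
    also have "\<dots> \<le> B"
      unfolding B_def using sp F w f by (intro finite_sum_le_infsum) auto
    finally show ?thesis
      by (metis real_sqrt_le_iff real_sqrt_abs abs_ge_self order_trans)
  qed
  obtain k :: nat where "B\<^sup>2 < 2 ^ k" using real_arch_pow[of 2 "B\<^sup>2"] by auto
  with le[of k] show False by simp
qed

text \<open>Disjointness makes the second projection injective on the dependent product, so the sum
  over the union becomes a double sum.\<close>

lemma has_sum_fibers:
  fixes g :: "'b \<Rightarrow> real"
  assumes "g summable_on (\<Union>x\<in>A. B x)" and "disjoint_family_on B A"
  shows "((\<lambda>x. infsum g (B x)) has_sum infsum g (\<Union>x\<in>A. B x)) A"
proof -
  have eq: "(\<Union>x\<in>A. B x) = snd ` Sigma A B" by force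
  have inj: "inj_on snd (Sigma A B)"
    using assms(2) by (intro inj_onI) (force simp: disjoint_family_on_def)
  have "(g has_sum infsum g (\<Union>x\<in>A. B x)) (snd ` Sigma A B)"
    using assms(1) eq by simp
  then have "((g \<circ> snd) has_sum infsum g (\<Union>x\<in>A. B x)) (Sigma A B)"
    by (simp add: has_sum_reindex[OF inj])
  then show ?thesis
    by (rule has_sum_SigmaD)
       (use assms(1) in \<open>auto intro!: has_sum_infsum intro: summable_on_subset_banach\<close>)
qed

section \<open>Linear structure, pairing and completeness of the weighted space\<close>

locale weighted_set =
  fixes S :: "'v set set" and m :: "'v set \<Rightarrow> real"
  assumes m_pos: "\<tau> \<in> S \<Longrightarrow> 0 < m \<tau>"
begin

abbreviation inner where "inner \<equiv> l2_inner S m"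
abbreviation normsq where "normsq \<equiv> l2_normsq S m"

lemma m_nonneg: "\<tau> \<in> S \<Longrightarrow> 0 \<le> m \<tau>"
  using m_pos by (simp add: less_imp_le)

lemma l2_Fun_on: "\<omega> \<in> l2 S m \<Longrightarrow> \<omega> \<in> Fun_on S"
  by (simp add: l2_def)

lemma Fun_on_outside: "\<omega> \<in> Fun_on S \<Longrightarrow> \<tau> \<notin> S \<Longrightarrow> \<omega> \<tau> = 0"
  by (simp add: Fun_on_def)

lemma l2_summable: "\<omega> \<in> l2 S m \<Longrightarrow> (\<lambda>\<tau>. m \<tau> * (\<omega> \<tau>)\<^sup>2) summable_on S"
  by (simp add: l2_def)

lemma l2_lincomb:
  assumes "\<omega> \<in> l2 S m" "\<eta> \<in> l2 S m"
  shows "(\<lambda>\<tau>. a * \<omega> \<tau> + b * \<eta> \<tau>) \<in> l2 S m"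
proof -
  have "(\<lambda>\<tau>. 2 * a\<^sup>2 * (m \<tau> * (\<omega> \<tau>)\<^sup>2) + 2 * b\<^sup>2 * (m \<tau> * (\<eta> \<tau>)\<^sup>2)) summable_on S"
    using assms by (intro summable_on_add summable_on_cmult_right l2_summable)
  moreover have "m \<tau> * (a * \<omega> \<tau> + b * \<eta> \<tau>)\<^sup>2
      \<le> 2 * a\<^sup>2 * (m \<tau> * (\<omega> \<tau>)\<^sup>2) + 2 * b\<^sup>2 * (m \<tau> * (\<eta> \<tau>)\<^sup>2)" if "\<tau> \<in> S" for \<tau>
  proof -
    have "(a * \<omega> \<tau> + b * \<eta> \<tau>)\<^sup>2 \<le> 2 * (a * \<omega> \<tau>)\<^sup>2 + 2 * (b * \<eta> \<tau>)\<^sup>2"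
      using sum_squares_bound[of "a * \<omega> \<tau>" "b * \<eta> \<tau>"] by (simp add: power2_sum)
    from mult_left_mono[OF this m_nonneg[OF that]] show ?thesis
      by (simp add: power_mult_distrib algebra_simps)
  qed
  ultimately have "(\<lambda>\<tau>. m \<tau> * (a * \<omega> \<tau> + b * \<eta> \<tau>)\<^sup>2) summable_on S"
    by (rule summable_on_comparison_test) (simp_all add: m_nonneg)
  then show ?thesis using assms by (simp add: l2_def Fun_on_def)
qed

lemma l2_zero [simp]: "(\<lambda>_. 0) \<in> l2 S m"
  by (simp add: l2_def Fun_on_def)

lemma l2_diff: "\<omega> \<in> l2 S m \<Longrightarrow> \<eta> \<in> l2 S m \<Longrightarrow> (\<lambda>\<tau>. \<omega> \<tau> - \<eta> \<tau>) \<in> l2 S m"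
  using l2_lincomb[of \<omega> \<eta> 1 "-1"] by simp

lemma l2_add: "\<omega> \<in> l2 S m \<Longrightarrow> \<eta> \<in> l2 S m \<Longrightarrow> (\<lambda>\<tau>. \<omega> \<tau> + \<eta> \<tau>) \<in> l2 S m"
  using l2_lincomb[of \<omega> \<eta> 1 1] by simp

lemma l2_abs_prod_summable:
  assumes "\<omega> \<in> l2 S m" "\<eta> \<in> l2 S m"
  shows "(\<lambda>\<tau>. m \<tau> * \<bar>\<omega> \<tau>\<bar> * \<bar>\<eta> \<tau>\<bar>) summable_on S"
proof -
  have "(\<lambda>\<tau>. m \<tau> * (\<omega> \<tau>)\<^sup>2 + m \<tau> * (\<eta> \<tau>)\<^sup>2) summable_on S"
    using assms by (intro summable_on_add l2_summable)
  moreover have "m \<tau> * \<bar>\<omega> \<tau>\<bar> * \<bar>\<eta> \<tau>\<bar> \<le> m \<tau> * (\<omega> \<tau>)\<^sup>2 + m \<tau> * (\<eta> \<tau>)\<^sup>2" if "\<tau> \<in> S" for \<tau>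
  proof -
    have "\<bar>\<omega> \<tau>\<bar> * \<bar>\<eta> \<tau>\<bar> \<le> (\<omega> \<tau>)\<^sup>2 + (\<eta> \<tau>)\<^sup>2"
      using sum_squares_bound[of "\<bar>\<omega> \<tau>\<bar>" "\<bar>\<eta> \<tau>\<bar>"] mult_nonneg_nonneg[of "\<bar>\<omega> \<tau>\<bar>" "\<bar>\<eta> \<tau>\<bar>"]
      by (simp only: power2_abs mult.assoc) linarith
    from mult_left_mono[OF this m_nonneg[OF that]] show ?thesis
      by (simp add: algebra_simps)
  qed
  ultimately show ?thesis
    by (rule summable_on_comparison_test) (simp_all add: m_nonneg)
qed

lemma l2_prod_summable:
  assumes "\<omega> \<in> l2 S m" "\<eta> \<in> l2 S m"
  shows "(\<lambda>\<tau>. m \<tau> * \<omega> \<tau> * \<eta> \<tau>) summable_on S"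
proof (rule abs_summable_summable)
  show "(\<lambda>\<tau>. norm (m \<tau> * \<omega> \<tau> * \<eta> \<tau>)) summable_on S"
    using l2_abs_prod_summable[OF assms]
    by (rule summable_on_cong[THEN iffD1, rotated]) (simp add: abs_mult m_nonneg)
qed

lemma inner_commute: "inner \<omega> \<eta> = inner \<eta> \<omega>"
  by (simp add: l2_inner_def mult_ac)

lemma inner_lincomb_left:
  assumes "\<omega> \<in> l2 S m" "\<eta> \<in> l2 S m" "\<phi> \<in> l2 S m"
  shows "inner (\<lambda>\<tau>. a * \<omega> \<tau> + b * \<eta> \<tau>) \<phi> = a * inner \<omega> \<phi> + b * inner \<eta> \<phi>"
proof -
  have "inner (\<lambda>\<tau>. a * \<omega> \<tau> + b * \<eta> \<tau>) \<phi>
      = (\<Sum>\<^sub>\<infinity>\<tau>\<in>S. a * (m \<tau> * \<omega> \<tau> * \<phi> \<tau>) + b * (m \<tau> * \<eta> \<tau> * \<phi> \<tau>))"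
    by (simp add: l2_inner_def algebra_simps)
  also have "\<dots> = a * inner \<omega> \<phi> + b * inner \<eta> \<phi>"
    unfolding l2_inner_def using assms
    by (subst infsum_add) (auto simp: infsum_cmult_right' intro!: summable_on_cmult_right l2_prod_summable)
  finally show ?thesis .
qed

lemma normsq_inner: "normsq \<omega> = inner \<omega> \<omega>"
  by (simp add: l2_normsq_def l2_inner_def power2_eq_square mult.assoc)

lemma normsq_nonneg [simp]: "0 \<le> normsq \<omega>"
  by (auto simp: l2_normsq_def m_nonneg intro!: infsum_nonneg)

lemma normsq_zero [simp]: "normsq (\<lambda>_. 0) = 0"
  by (simp add: l2_normsq_def)

lemma normsq_lincomb:
  assumes "\<omega> \<in> l2 S m" "\<eta> \<in> l2 S m"
  shows "normsq (\<lambda>\<tau>. a * \<omega> \<tau> + b * \<eta> \<tau>)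
    = a\<^sup>2 * normsq \<omega> + 2 * a * b * inner \<omega> \<eta> + b\<^sup>2 * normsq \<eta>"
proof -
  note l = l2_lincomb[OF assms, of a b]
  have "normsq (\<lambda>\<tau>. a * \<omega> \<tau> + b * \<eta> \<tau>)
      = a * inner (\<lambda>\<tau>. a * \<omega> \<tau> + b * \<eta> \<tau>) \<omega> + b * inner (\<lambda>\<tau>. a * \<omega> \<tau> + b * \<eta> \<tau>) \<eta>"
    unfolding normsq_inner by (subst inner_lincomb_left[OF assms l]) (simp add: inner_commute)
  then show ?thesis
    using assms
    by (simp add: inner_lincomb_left normsq_inner inner_commute[of \<eta> \<omega>] power2_eq_square algebra_simps)
qed

lemma normsq_minus_commute: "normsq (\<lambda>\<tau>. \<omega> \<tau> - \<eta> \<tau>) = normsq (\<lambda>\<tau>. \<eta> \<tau> - \<omega> \<tau>)"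
  by (simp add: l2_normsq_def power2_commute)

text \<open>The parallelogram identity with the norm of the difference dropped. It replaces the
  triangle inequality, so that squared norms can be used throughout.\<close>

lemma normsq_add_le:
  assumes "\<omega> \<in> l2 S m" "\<eta> \<in> l2 S m"
  shows "normsq (\<lambda>\<tau>. \<omega> \<tau> + \<eta> \<tau>) \<le> 2 * normsq \<omega> + 2 * normsq \<eta>"
  using normsq_lincomb[OF assms, of 1 1] normsq_lincomb[OF assms, of 1 "-1"]
    normsq_nonneg[of "\<lambda>\<tau>. 1 * \<omega> \<tau> + - 1 * \<eta> \<tau>"]
  by simp

lemma Cauchy_Schwarz:
  assumes "\<omega> \<in> l2 S m" "\<eta> \<in> l2 S m"
  shows "(inner \<omega> \<eta>)\<^sup>2 \<le> normsq \<omega> * normsq \<eta>"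
proof -
  have pos: "0 \<le> normsq \<omega> + 2 * t * inner \<omega> \<eta> + t\<^sup>2 * normsq \<eta>" for t
    using normsq_lincomb[OF assms, of 1 t] normsq_nonneg[of "\<lambda>\<tau>. 1 * \<omega> \<tau> + t * \<eta> \<tau>"] by simp
  show ?thesis
  proof (cases "normsq \<eta> = 0")
    case True
    have "inner \<omega> \<eta> = 0"
    proof (rule ccontr)
      assume "inner \<omega> \<eta> \<noteq> 0"
      then show False
        \<comment> \<open>Here the quadratic polynomial in t is affine, and this t gives it the
          value -1.\<close>
        using pos[of "- (normsq \<omega> + 1) / (2 * inner \<omega> \<eta>)"] True by (simp add: field_simps)
    qed
    then show ?thesis by simp
  next
    case False
    then have "0 < normsq \<eta>" using normsq_nonneg[of \<eta>] by linarith
    then show ?thesis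
      using pos[of "- inner \<omega> \<eta> / normsq \<eta>"] by (simp add: field_simps power2_eq_square)
  qed
qed

lemma finite_sum_le_normsq:
  assumes "\<omega> \<in> l2 S m" "finite X" "X \<subseteq> S"
  shows "(\<Sum>\<tau>\<in>X. m \<tau> * (\<omega> \<tau>)\<^sup>2) \<le> normsq \<omega>"
  unfolding l2_normsq_def using assms m_nonneg
  by (intro finite_sum_le_infsum l2_summable) auto

lemma pointwise_le_normsq:
  assumes "\<omega> \<in> l2 S m" "\<tau> \<in> S"
  shows "m \<tau> * (\<omega> \<tau>)\<^sup>2 \<le> normsq \<omega>"
  using finite_sum_le_normsq[OF assms(1), of "{\<tau>}"] assms(2) by simp

lemma normsq_bound:
  assumes "\<omega> \<in> Fun_on S" "\<And>X. finite X \<Longrightarrow> X \<subseteq> S \<Longrightarrow> (\<Sum>\<tau>\<in>X. m \<tau> * (\<omega> \<tau>)\<^sup>2) \<le> B"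
  shows "\<omega> \<in> l2 S m" "normsq \<omega> \<le> B"
proof -
  have s: "(\<lambda>\<tau>. m \<tau> * (\<omega> \<tau>)\<^sup>2) summable_on S"
    using assms(2) m_nonneg
    by (intro nonneg_bdd_above_summable_on bdd_aboveI2[of _ _ B]) auto
  show "\<omega> \<in> l2 S m" using s assms(1) by (simp add: l2_def)
  show "normsq \<omega> \<le> B" unfolding l2_normsq_def using s assms(2) by (rule infsum_le_finite_sums)
qed

text \<open>A Fatou argument: on a finite set the limit in the second index passes through the sum,
  and a bound uniform in finite sets is a bound on the norm. The limit is prescribed pointwise so
  that, for a sequence of images under an operator, it can be taken to be the image of the
  limit.\<close>

lemma l2_Cauchy_limit:
  assumes w: "\<And>n. w n \<in> l2 S m"
    and cauchy: "\<And>e. 0 < e \<Longrightarrow> \<exists>N. \<forall>i\<ge>N. \<forall>j\<ge>N. normsq (\<lambda>\<tau>. w i \<tau> - w j \<tau>) < e"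
    and lim: "\<And>\<tau>. \<tau> \<in> S \<Longrightarrow> (\<lambda>n. w n \<tau>) \<longlonglongrightarrow> \<omega> \<tau>"
    and \<omega>: "\<omega> \<in> Fun_on S"
  shows "\<omega> \<in> l2 S m" "(\<lambda>n. normsq (\<lambda>\<tau>. w n \<tau> - \<omega> \<tau>)) \<longlonglongrightarrow> 0"
proof -
  have key: "(\<lambda>\<tau>. w i \<tau> - \<omega> \<tau>) \<in> l2 S m \<and> normsq (\<lambda>\<tau>. w i \<tau> - \<omega> \<tau>) \<le> e"
    if N: "\<forall>i\<ge>N. \<forall>j\<ge>N. normsq (\<lambda>\<tau>. w i \<tau> - w j \<tau>) < e" and i: "i \<ge> N" for i N e
  proof -
    have "(\<Sum>\<tau>\<in>X. m \<tau> * (w i \<tau> - \<omega> \<tau>)\<^sup>2) \<le> e" if X: "finite X" "X \<subseteq> S" for X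
    proof (rule LIMSEQ_le_const2)
      show "(\<lambda>j. \<Sum>\<tau>\<in>X. m \<tau> * (w i \<tau> - w j \<tau>)\<^sup>2) \<longlonglongrightarrow> (\<Sum>\<tau>\<in>X. m \<tau> * (w i \<tau> - \<omega> \<tau>)\<^sup>2)"
        using X lim by (intro tendsto_intros) auto
      show "\<exists>N. \<forall>j\<ge>N. (\<Sum>\<tau>\<in>X. m \<tau> * (w i \<tau> - w j \<tau>)\<^sup>2) \<le> e"
        using N i finite_sum_le_normsq[OF l2_diff[OF w w] X] by (meson less_imp_le order_trans)
    qed
    moreover have "(\<lambda>\<tau>. w i \<tau> - \<omega> \<tau>) \<in> Fun_on S"
      using w[of i] \<omega> by (simp add: Fun_on_def l2_def)
    ultimately show ?thesis using normsq_bound by blast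
  qed
  obtain N where "\<forall>i\<ge>N. \<forall>j\<ge>N. normsq (\<lambda>\<tau>. w i \<tau> - w j \<tau>) < 1" using cauchy[of 1] by auto
  then have "(\<lambda>\<tau>. w N \<tau> - \<omega> \<tau>) \<in> l2 S m" using key by blast
  from l2_diff[OF w[of N] this] show "\<omega> \<in> l2 S m" by simp
  show "(\<lambda>n. normsq (\<lambda>\<tau>. w n \<tau> - \<omega> \<tau>)) \<longlonglongrightarrow> 0"
  proof (rule LIMSEQ_I)
    fix e :: real assume "0 < e"
    then obtain N where N: "\<forall>i\<ge>N. \<forall>j\<ge>N. normsq (\<lambda>\<tau>. w i \<tau> - w j \<tau>) < e / 2"
      using cauchy[of "e/2"] by auto
    have "normsq (\<lambda>\<tau>. w n \<tau> - \<omega> \<tau>) < e" if "n \<ge> N" for n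
      using key[OF N that] \<open>0 < e\<close> by linarith
    then show "\<exists>N. \<forall>n\<ge>N. norm (normsq (\<lambda>\<tau>. w n \<tau> - \<omega> \<tau>) - 0) < e" by auto
  qed
qed

lemma inner_tendsto:
  assumes "\<And>n. w n \<in> l2 S m" "\<omega> \<in> l2 S m" "\<eta> \<in> l2 S m"
    and "(\<lambda>n. normsq (\<lambda>\<tau>. w n \<tau> - \<omega> \<tau>)) \<longlonglongrightarrow> 0"
  shows "(\<lambda>n. inner (w n) \<eta>) \<longlonglongrightarrow> inner \<omega> \<eta>"
proof -
  have "(\<lambda>n. (inner (w n) \<eta> - inner \<omega> \<eta>)\<^sup>2) \<longlonglongrightarrow> 0"
  proof (rule tendsto_sandwich[of "\<lambda>_. 0"])
    show "\<forall>\<^sub>F n in sequentially. (inner (w n) \<eta> - inner \<omega> \<eta>)\<^sup>2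
        \<le> normsq (\<lambda>\<tau>. w n \<tau> - \<omega> \<tau>) * normsq \<eta>"
      using Cauchy_Schwarz[OF l2_diff[OF assms(1,2)] assms(3)]
        inner_lincomb_left[OF assms(1,2,3), of 1 _ "-1"] by simp
    show "(\<lambda>n. normsq (\<lambda>\<tau>. w n \<tau> - \<omega> \<tau>) * normsq \<eta>) \<longlonglongrightarrow> 0"
      using tendsto_mult_left_zero[OF assms(4)] by simp
  qed auto
  then have "(\<lambda>n. inner (w n) \<eta> - inner \<omega> \<eta>) \<longlonglongrightarrow> 0"
    by (simp add: power_tendsto_0_iff)
  then show ?thesis by (simp add: LIM_zero_iff)
qed

text \<open>Expanding the square of the difference leaves only a pairing with the fixed function
  \<omega>, whose convergence is already known.\<close>

lemma normsq_tendsto: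
  assumes w: "\<And>n. w n \<in> l2 S m" and \<omega>: "\<omega> \<in> l2 S m"
    and lim: "(\<lambda>n. normsq (\<lambda>\<tau>. w n \<tau> - \<omega> \<tau>)) \<longlonglongrightarrow> 0"
  shows "(\<lambda>n. normsq (w n)) \<longlonglongrightarrow> normsq \<omega>"
proof -
  have "normsq (w n) = normsq (\<lambda>\<tau>. w n \<tau> - \<omega> \<tau>) + 2 * inner (w n) \<omega> - normsq \<omega>" for n
    using normsq_lincomb[OF w \<omega>, of 1 n "-1"] by simp
  moreover have "(\<lambda>n. normsq (\<lambda>\<tau>. w n \<tau> - \<omega> \<tau>) + 2 * inner (w n) \<omega> - normsq \<omega>)
      \<longlonglongrightarrow> 0 + 2 * inner \<omega> \<omega> - normsq \<omega>"
    using inner_tendsto[OF w \<omega> \<omega> lim] lim by (intro tendsto_intros)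
  ultimately show ?thesis by (simp add: normsq_inner)
qed

end

section \<open>Closed operators on \<open>\<ell>\<^sup>2\<close>\<close>

text \<open>An operator whose point values are continuous functionals on \<open>\<ell>\<^sup>2\<close>. Its maximal
  restriction to \<open>\<ell>\<^sup>2\<close> is automatically closed.\<close>

locale l2_operator = weighted_set S m
  for S :: "'v set set" and m :: "'v set \<Rightarrow> real" +
  fixes T :: "('v set \<Rightarrow> real) \<Rightarrow> ('v set \<Rightarrow> real)"
  assumes T_Fun_on: "\<omega> \<in> l2 S m \<Longrightarrow> T \<omega> \<in> Fun_on S"
    and T_riesz: "\<sigma> \<in> S \<Longrightarrow> \<exists>g\<in>l2 S m. \<forall>\<omega>\<in>l2 S m. T \<omega> \<sigma> = l2_inner S m \<omega> g"
begin

text \<open>Linearity is not assumed of \<open>T\<close>: it is inherited from the representing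
  functions at the points of \<open>S\<close>, and off \<open>S\<close> both sides vanish.\<close>

lemma T_lincomb:
  assumes "\<omega> \<in> l2 S m" "\<eta> \<in> l2 S m"
  shows "T (\<lambda>\<tau>. a * \<omega> \<tau> + b * \<eta> \<tau>) = (\<lambda>\<tau>. a * T \<omega> \<tau> + b * T \<eta> \<tau>)"
proof
  fix \<sigma>
  show "T (\<lambda>\<tau>. a * \<omega> \<tau> + b * \<eta> \<tau>) \<sigma> = a * T \<omega> \<sigma> + b * T \<eta> \<sigma>"
  proof (cases "\<sigma> \<in> S")
    case True
    then show ?thesis
      using T_riesz[OF True] assms by (auto simp: l2_lincomb inner_lincomb_left)
  next
    case False
    then show ?thesis
      using T_Fun_on[OF l2_lincomb[OF assms]] T_Fun_on assms by (simp add: Fun_on_outside)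
  qed
qed

lemma T_diff:
  assumes "\<omega> \<in> l2 S m" "\<eta> \<in> l2 S m"
  shows "T (\<lambda>\<tau>. \<omega> \<tau> - \<eta> \<tau>) = (\<lambda>\<tau>. T \<omega> \<tau> - T \<eta> \<tau>)"
  using T_lincomb[OF assms, of 1 "-1"] by simp

lemma T_add:
  assumes "\<omega> \<in> l2 S m" "\<eta> \<in> l2 S m"
  shows "T (\<lambda>\<tau>. \<omega> \<tau> + \<eta> \<tau>) = (\<lambda>\<tau>. T \<omega> \<tau> + T \<eta> \<tau>)"
  using T_lincomb[OF assms, of 1 1] by simp

lemma T_zero: "T (\<lambda>_. 0) = (\<lambda>_. 0)"
  using T_lincomb[OF l2_zero l2_zero, of 0 0] by simp

lemma T_pointwise_tendsto:
  assumes "\<And>n. w n \<in> l2 S m" "\<omega> \<in> l2 S m"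
    and "(\<lambda>n. normsq (\<lambda>\<tau>. w n \<tau> - \<omega> \<tau>)) \<longlonglongrightarrow> 0" "\<sigma> \<in> S"
  shows "(\<lambda>n. T (w n) \<sigma>) \<longlonglongrightarrow> T \<omega> \<sigma>"
  using T_riesz[OF assms(4)] inner_tendsto[OF assms(1,2) _ assms(3)] assms(1,2) by auto

definition max_dom where "max_dom = {\<omega> \<in> l2 S m. T \<omega> \<in> l2 S m}"

text \<open>Informative only on \<open>max_dom\<close>: a divergent \<open>infsum\<close> is 0 by
  convention, hence the membership conditions in the lemmas below.\<close>

definition graph_normsq where "graph_normsq \<omega> = normsq (T \<omega>) + normsq \<omega>"

lemma max_dom_lincomb:
  "\<omega> \<in> max_dom \<Longrightarrow> \<eta> \<in> max_dom \<Longrightarrow> (\<lambda>\<tau>. a * \<omega> \<tau> + b * \<eta> \<tau>) \<in> max_dom"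
  by (simp add: max_dom_def T_lincomb l2_lincomb)

lemma max_dom_diff: "\<omega> \<in> max_dom \<Longrightarrow> \<eta> \<in> max_dom \<Longrightarrow> (\<lambda>\<tau>. \<omega> \<tau> - \<eta> \<tau>) \<in> max_dom"
  using max_dom_lincomb[of \<omega> \<eta> 1 "-1"] by simp

lemma graph_normsq_nonneg: "0 \<le> graph_normsq \<omega>"
  by (simp add: graph_normsq_def)

lemma graph_normsq_add_le:
  assumes "\<omega> \<in> max_dom" "\<eta> \<in> max_dom"
  shows "graph_normsq (\<lambda>\<tau>. \<omega> \<tau> + \<eta> \<tau>) \<le> 2 * graph_normsq \<omega> + 2 * graph_normsq \<eta>"
  using assms normsq_add_le[of \<omega> \<eta>] normsq_add_le[of "T \<omega>" "T \<eta>"]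
  by (simp add: max_dom_def graph_normsq_def T_add)

lemma graph_normsq_scale:
  assumes "\<omega> \<in> max_dom"
  shows "graph_normsq (\<lambda>\<tau>. a * \<omega> \<tau>) = a\<^sup>2 * graph_normsq \<omega>"
proof -
  have "T (\<lambda>\<tau>. a * \<omega> \<tau>) = (\<lambda>\<tau>. a * T \<omega> \<tau>)"
    using T_lincomb[of \<omega> \<omega> a 0] assms by (simp add: max_dom_def)
  then show ?thesis
    using assms normsq_lincomb[of \<omega> \<omega> a 0] normsq_lincomb[of "T \<omega>" "T \<omega>" a 0]
    by (simp add: max_dom_def graph_normsq_def algebra_simps)
qed

lemma graph_normsq_minus_commute:
  assumes "\<omega> \<in> max_dom" "\<eta> \<in> max_dom"
  shows "graph_normsq (\<lambda>\<tau>. \<omega> \<tau> - \<eta> \<tau>) = graph_normsq (\<lambda>\<tau>. \<eta> \<tau> - \<omega> \<tau>)"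
  using assms normsq_minus_commute[of \<omega> \<eta>] normsq_minus_commute[of "T \<omega>" "T \<eta>"]
  by (simp add: graph_normsq_def max_dom_def T_diff)

definition T_form where "T_form D = QForm D (\<lambda>\<omega>. normsq (T \<omega>))"

lemma T_form_simps [simp]:
  "form_dom (T_form D) = D" "form_val (T_form D) \<omega> = normsq (T \<omega>)"
  by (simp_all add: T_form_def)

lemma form_norm_T_form: "form_norm S m (T_form D) \<omega> = sqrt (graph_normsq \<omega>)"
  by (simp add: form_norm_def graph_normsq_def)

lemma form_bilinear_T_form:
  assumes "\<omega> \<in> max_dom" "\<eta> \<in> max_dom"
  shows "form_bilinear (T_form D) \<omega> \<eta> = inner (T \<omega>) (T \<eta>)"
  using assms normsq_lincomb[of "T \<omega>" "T \<eta>" 1 1] normsq_lincomb[of "T \<omega>" "T \<eta>" 1 "-1"]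
  by (simp add: form_bilinear_def max_dom_def T_add T_diff)

text \<open>This is closedness of \<open>T\<close> on its maximal domain. Norm convergence of
  \<open>w n\<close> forces \<open>T (w n)\<close> to converge to \<open>T \<omega>\<close> at every
  point, so the Cauchy sequence of images can have no other limit.\<close>

lemma graph_complete:
  assumes w: "\<And>n. w n \<in> max_dom"
    and cauchy: "\<And>e. 0 < e \<Longrightarrow> \<exists>N. \<forall>i\<ge>N. \<forall>j\<ge>N. graph_normsq (\<lambda>\<tau>. w i \<tau> - w j \<tau>) < e"
  obtains \<omega> where "\<omega> \<in> max_dom" "(\<lambda>n. graph_normsq (\<lambda>\<tau>. w n \<tau> - \<omega> \<tau>)) \<longlonglongrightarrow> 0"
proof -
  have wl: "w n \<in> l2 S m" and Twl: "T (w n) \<in> l2 S m" for n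
    using w[of n] by (auto simp: max_dom_def)
  have le: "normsq (\<lambda>\<tau>. w i \<tau> - w j \<tau>) \<le> graph_normsq (\<lambda>\<tau>. w i \<tau> - w j \<tau>)"
    "normsq (\<lambda>\<tau>. T (w i) \<tau> - T (w j) \<tau>) \<le> graph_normsq (\<lambda>\<tau>. w i \<tau> - w j \<tau>)" for i j
    by (simp_all add: graph_normsq_def T_diff wl)
  have c1: "\<exists>N. \<forall>i\<ge>N. \<forall>j\<ge>N. normsq (\<lambda>\<tau>. w i \<tau> - w j \<tau>) < e" if "0 < e" for e
    using cauchy[OF that] le(1) by (meson le_less_trans)
  have c2: "\<exists>N. \<forall>i\<ge>N. \<forall>j\<ge>N. normsq (\<lambda>\<tau>. T (w i) \<tau> - T (w j) \<tau>) < e" if "0 < e" for e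
    using cauchy[OF that] le(2) by (meson le_less_trans)
  have "convergent (\<lambda>n. w n \<tau>)" if \<tau>: "\<tau> \<in> S" for \<tau>
  proof (rule Cauchy_convergent, rule metric_CauchyI)
    fix e :: real assume "0 < e"
    then have "0 < m \<tau> * e\<^sup>2" using m_pos[OF \<tau>] by simp
    \<comment> \<open>The norm dominates m(\<tau>) times the squared value at \<tau>, so the
      threshold is scaled by m(\<tau>).\<close>
    then obtain N where N: "\<forall>i\<ge>N. \<forall>j\<ge>N. normsq (\<lambda>\<tau>. w i \<tau> - w j \<tau>) < m \<tau> * e\<^sup>2" using c1 by blast
    have "dist (w i \<tau>) (w j \<tau>) < e" if "i \<ge> N" "j \<ge> N" for i j
    proof -
      have "m \<tau> * (w i \<tau> - w j \<tau>)\<^sup>2 < m \<tau> * e\<^sup>2"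
        using N that pointwise_le_normsq[OF l2_diff[OF wl wl] \<tau>] by (meson le_less_trans)
      then have "(w i \<tau> - w j \<tau>)\<^sup>2 < e\<^sup>2" using m_pos[OF \<tau>] by simp
      then show ?thesis
        using \<open>0 < e\<close> power2_less_imp_less[of "\<bar>w i \<tau> - w j \<tau>\<bar>" e] by (simp add: dist_real_def)
    qed
    then show "\<exists>M. \<forall>i\<ge>M. \<forall>j\<ge>M. dist (w i \<tau>) (w j \<tau>) < e" by blast
  qed
  then have lim: "\<tau> \<in> S \<Longrightarrow> (\<lambda>n. w n \<tau>) \<longlonglongrightarrow> lim (\<lambda>n. w n \<tau>)" for \<tau>
    by (simp add: convergent_LIMSEQ_iff)
  define \<omega> where "\<omega> \<tau> = (if \<tau> \<in> S then lim (\<lambda>n. w n \<tau>) else 0)" for \<tau>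
  have wS: "\<omega> \<in> Fun_on S" and wlim: "\<tau> \<in> S \<Longrightarrow> (\<lambda>n. w n \<tau>) \<longlonglongrightarrow> \<omega> \<tau>" for \<tau>
    using lim by (simp_all add: \<omega>_def Fun_on_def)
  note L = l2_Cauchy_limit[where w = w, OF wl c1 wlim wS]
  note LT = l2_Cauchy_limit[where w = "\<lambda>n. T (w n)", OF Twl c2
      T_pointwise_tendsto[OF wl L] T_Fun_on[OF L(1)]]
  show thesis
  proof
    show "\<omega> \<in> max_dom" using L(1) LT(1) by (simp add: max_dom_def)
    show "(\<lambda>n. graph_normsq (\<lambda>\<tau>. w n \<tau> - \<omega> \<tau>)) \<longlonglongrightarrow> 0"
      using tendsto_add[OF LT(2) L(2)] by (simp add: graph_normsq_def T_diff wl L(1))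
  qed
qed

text \<open>Since the maximal domain is complete, a restriction of the form is closed as soon as its
  domain is a sequentially closed subspace.\<close>

lemma closed_T_form:
  assumes D: "D \<subseteq> max_dom" "(\<lambda>_. 0) \<in> D"
    and lincomb: "\<And>\<omega> \<eta> a b. \<omega> \<in> D \<Longrightarrow> \<eta> \<in> D \<Longrightarrow> (\<lambda>\<tau>. a * \<omega> \<tau> + b * \<eta> \<tau>) \<in> D"
    and closed: "\<And>w \<omega>. (\<And>n. w n \<in> D) \<Longrightarrow> \<omega> \<in> max_dom \<Longrightarrow>
      (\<lambda>n. graph_normsq (\<lambda>\<tau>. w n \<tau> - \<omega> \<tau>)) \<longlonglongrightarrow> 0 \<Longrightarrow> \<omega> \<in> D"
  shows "closed_form S m (T_form D)"
  unfolding closed_form_def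
proof (intro conjI allI impI)
  have l: "\<omega> \<in> l2 S m" "T \<omega> \<in> l2 S m" "\<omega> \<in> max_dom" if "\<omega> \<in> D" for \<omega>
    using that D by (auto simp: max_dom_def)
  show "positive_form S m (T_form D)"
    unfolding positive_form_def
    using D lincomb l
    by (auto simp: form_bilinear_T_form max_dom_lincomb T_lincomb inner_lincomb_left normsq_inner[symmetric])
      (simp add: inner_commute)
  fix w :: "nat \<Rightarrow> 'v set \<Rightarrow> real"
  assume *: "(\<forall>n. w n \<in> form_dom (T_form D)) \<and>
    (\<forall>e>0. \<exists>N. \<forall>i\<ge>N. \<forall>j\<ge>N. form_norm S m (T_form D) (\<lambda>\<tau>. w i \<tau> - w j \<tau>) < e)"
  then have w: "\<And>n. w n \<in> D" by simp
  have "\<exists>N. \<forall>i\<ge>N. \<forall>j\<ge>N. graph_normsq (\<lambda>\<tau>. w i \<tau> - w j \<tau>) < e" if "0 < e" for e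
  proof -
    have "0 < sqrt e" using that by simp
    then have "\<exists>N. \<forall>i\<ge>N. \<forall>j\<ge>N. form_norm S m (T_form D) (\<lambda>\<tau>. w i \<tau> - w j \<tau>) < sqrt e"
      using * by blast
    then show ?thesis by (simp add: form_norm_T_form)
  qed
  then obtain \<omega> where \<omega>: "\<omega> \<in> max_dom" "(\<lambda>n. graph_normsq (\<lambda>\<tau>. w n \<tau> - \<omega> \<tau>)) \<longlonglongrightarrow> 0"
    using graph_complete[of w] l(3)[OF w] by blast
  have "(\<lambda>n. form_norm S m (T_form D) (\<lambda>\<tau>. w n \<tau> - \<omega> \<tau>)) \<longlonglongrightarrow> 0"
    using tendsto_real_sqrt[OF \<omega>(2)] by (simp add: form_norm_T_form)
  then show "\<exists>\<omega>\<in>form_dom (T_form D). (\<lambda>n. form_norm S m (T_form D) (\<lambda>\<tau>. w n \<tau> - \<omega> \<tau>)) \<longlonglongrightarrow> 0"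
    using closed[OF w \<omega>] by auto
qed

text \<open>The square root matches \<open>form_norm\<close>, so that the domain of
  \<open>Dirichlet_form\<close> is literally an instance. The next two lemmas translate to and from
  the squared norm.\<close>

definition graph_closure where
  "graph_closure D = {\<omega> \<in> max_dom. \<forall>e>0. \<exists>\<phi>\<in>D. sqrt (graph_normsq (\<lambda>\<tau>. \<omega> \<tau> - \<phi> \<tau>)) < e}"

lemma graph_closure_approx:
  assumes "\<omega> \<in> graph_closure D" "0 < e"
  obtains \<phi> where "\<phi> \<in> D" "graph_normsq (\<lambda>\<tau>. \<omega> \<tau> - \<phi> \<tau>) < e"
proof -
  have "0 < sqrt e" using assms(2) by simp
  then obtain \<phi> where "\<phi> \<in> D" "sqrt (graph_normsq (\<lambda>\<tau>. \<omega> \<tau> - \<phi> \<tau>)) < sqrt e"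
    using assms(1) unfolding graph_closure_def by blast
  then show thesis using that by simp
qed

lemma graph_closureI:
  assumes "\<omega> \<in> max_dom" "\<And>e. 0 < e \<Longrightarrow> \<exists>\<phi>\<in>D. graph_normsq (\<lambda>\<tau>. \<omega> \<tau> - \<phi> \<tau>) < e"
  shows "\<omega> \<in> graph_closure D"
  unfolding graph_closure_def
proof (intro CollectI conjI allI impI assms(1))
  fix e :: real assume "0 < e"
  then obtain \<phi> where "\<phi> \<in> D" "graph_normsq (\<lambda>\<tau>. \<omega> \<tau> - \<phi> \<tau>) < e\<^sup>2"
    using assms(2)[of "e\<^sup>2"] by auto
  then show "\<exists>\<phi>\<in>D. sqrt (graph_normsq (\<lambda>\<tau>. \<omega> \<tau> - \<phi> \<tau>)) < e"
    using \<open>0 < e\<close> by (metis real_sqrt_less_iff real_sqrt_abs abs_of_pos)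
qed

lemma graph_closure_superset: "D \<subseteq> max_dom \<Longrightarrow> D \<subseteq> graph_closure D"
  by (auto intro!: graph_closureI bexI simp: graph_normsq_def T_zero)

lemma graph_closure_seq:
  assumes "\<omega> \<in> graph_closure D" "D \<subseteq> max_dom"
  obtains w where "\<And>n. w n \<in> D" "(\<lambda>n. graph_normsq (\<lambda>\<tau>. w n \<tau> - \<omega> \<tau>)) \<longlonglongrightarrow> 0"
proof -
  have "\<exists>\<phi>\<in>D. graph_normsq (\<lambda>\<tau>. \<omega> \<tau> - \<phi> \<tau>) < inverse (real (Suc n))" for n
    using graph_closure_approx[OF assms(1), of "inverse (real (Suc n))"] by auto
  then obtain w where w: "\<And>n. w n \<in> D"
    "\<And>n. graph_normsq (\<lambda>\<tau>. \<omega> \<tau> - w n \<tau>) < inverse (real (Suc n))" by metis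
  have "\<omega> \<in> max_dom" using assms(1) by (simp add: graph_closure_def)
  with assms(2) have
    "graph_normsq (\<lambda>\<tau>. w n \<tau> - \<omega> \<tau>) < inverse (real (Suc n))" for n
    using graph_normsq_minus_commute[of \<omega> "w n"] w(1,2)[of n] by (simp add: subset_iff)
  then have "(\<lambda>n. graph_normsq (\<lambda>\<tau>. w n \<tau> - \<omega> \<tau>)) \<longlonglongrightarrow> 0"
    by (intro tendsto_sandwich[OF _ _ tendsto_const LIMSEQ_inverse_real_of_nat] always_eventually)
       (auto simp: graph_normsq_nonneg intro: less_imp_le)
  with w(1) show thesis by (rule that)
qed

lemma closed_graph_closure:
  assumes D: "D \<subseteq> max_dom" "(\<lambda>_. 0) \<in> D"
    and lincomb: "\<And>\<omega> \<eta> a b. \<omega> \<in> D \<Longrightarrow> \<eta> \<in> D \<Longrightarrow> (\<lambda>\<tau>. a * \<omega> \<tau> + b * \<eta> \<tau>) \<in> D"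
  shows "closed_form S m (T_form (graph_closure D))"
proof (rule closed_T_form)
  show "graph_closure D \<subseteq> max_dom" by (auto simp: graph_closure_def)
  show "(\<lambda>_. 0) \<in> graph_closure D" using graph_closure_superset D by blast
next
  fix \<omega> \<eta> and a b :: real
  assume cl: "\<omega> \<in> graph_closure D" "\<eta> \<in> graph_closure D"
  then have dom: "\<omega> \<in> max_dom" "\<eta> \<in> max_dom" by (auto simp: graph_closure_def)
  show "(\<lambda>\<tau>. a * \<omega> \<tau> + b * \<eta> \<tau>) \<in> graph_closure D"
  proof (rule graph_closureI)
    show "(\<lambda>\<tau>. a * \<omega> \<tau> + b * \<eta> \<tau>) \<in> max_dom" using dom by (rule max_dom_lincomb)
    fix e :: real assume "0 < e"
    \<comment> \<open>The first two terms come from \<open>graph_normsq_add_le\<close> and scaling.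
      The 1 keeps \<open>C\<close> positive when a = b = 0 and makes the final estimate
      strict.\<close>
    define C where "C = 2 * a\<^sup>2 + 2 * b\<^sup>2 + 1"
    have C: "0 < C" by (simp add: C_def add_nonneg_pos)
    with \<open>0 < e\<close> have "0 < e / C" by simp
    with cl obtain \<phi> \<psi> where
      \<phi>: "\<phi> \<in> D" "graph_normsq (\<lambda>\<tau>. \<omega> \<tau> - \<phi> \<tau>) < e / C" and
      \<psi>: "\<psi> \<in> D" "graph_normsq (\<lambda>\<tau>. \<eta> \<tau> - \<psi> \<tau>) < e / C"
      by (metis graph_closure_approx)
    have d: "(\<lambda>\<tau>. \<omega> \<tau> - \<phi> \<tau>) \<in> max_dom" "(\<lambda>\<tau>. \<eta> \<tau> - \<psi> \<tau>) \<in> max_dom"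
      using dom \<phi>(1) \<psi>(1) D(1) by (auto intro!: max_dom_diff)
    then have d': "(\<lambda>\<tau>. a * (\<omega> \<tau> - \<phi> \<tau>)) \<in> max_dom" "(\<lambda>\<tau>. b * (\<eta> \<tau> - \<psi> \<tau>)) \<in> max_dom"
      using max_dom_lincomb[OF d(1,1), of a 0] max_dom_lincomb[OF d(2,2), of b 0] by simp_all
    have "graph_normsq (\<lambda>\<tau>. a * \<omega> \<tau> + b * \<eta> \<tau> - (a * \<phi> \<tau> + b * \<psi> \<tau>))
        = graph_normsq (\<lambda>\<tau>. a * (\<omega> \<tau> - \<phi> \<tau>) + b * (\<eta> \<tau> - \<psi> \<tau>))"
      by (simp add: algebra_simps)
    also have "\<dots> \<le> 2 * a\<^sup>2 * graph_normsq (\<lambda>\<tau>. \<omega> \<tau> - \<phi> \<tau>) + 2 * b\<^sup>2 * graph_normsq (\<lambda>\<tau>. \<eta> \<tau> - \<psi> \<tau>)"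
      using graph_normsq_add_le[OF d'] by (simp add: graph_normsq_scale d)
    also have "\<dots> \<le> 2 * a\<^sup>2 * (e / C) + 2 * b\<^sup>2 * (e / C)"
      using \<phi>(2) \<psi>(2) by (intro add_mono mult_left_mono) auto
    also have "\<dots> = (C - 1) * (e / C)"
      by (simp only: C_def add_diff_cancel_right' distrib_right)
    also have "\<dots> < C * (e / C)" using \<open>0 < e / C\<close> by (intro mult_strict_right_mono) auto
    also have "\<dots> = e" using C by simp
    finally show "\<exists>\<phi>\<in>D. graph_normsq (\<lambda>\<tau>. a * \<omega> \<tau> + b * \<eta> \<tau> - \<phi> \<tau>) < e"
      using lincomb[OF \<phi>(1) \<psi>(1), of a b] by (rule bexI)
  qed
next
  fix w :: "nat \<Rightarrow> 'v set \<Rightarrow> real" and \<omega>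
  assume w: "\<And>n. w n \<in> graph_closure D" and \<omega>: "\<omega> \<in> max_dom"
    and lim: "(\<lambda>n. graph_normsq (\<lambda>\<tau>. w n \<tau> - \<omega> \<tau>)) \<longlonglongrightarrow> 0"
  have w': "w n \<in> max_dom" for n using w[of n] by (simp add: graph_closure_def)
  show "\<omega> \<in> graph_closure D"
  proof (rule graph_closureI[OF \<omega>])
    fix e :: real assume "0 < e"
    \<comment> \<open>Two errors below e/4, each doubled by
      \<open>graph_normsq_add_le\<close>.\<close>
    then have "0 < e / 4" by simp
    from order_tendstoD(2)[OF lim this] obtain n where n: "graph_normsq (\<lambda>\<tau>. w n \<tau> - \<omega> \<tau>) < e / 4"
      by (auto simp: eventually_sequentially)
    from graph_closure_approx[OF w[of n] \<open>0 < e / 4\<close>] obtain \<phi> where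
      \<phi>: "\<phi> \<in> D" "graph_normsq (\<lambda>\<tau>. w n \<tau> - \<phi> \<tau>) < e / 4" by blast
    have d: "(\<lambda>\<tau>. w n \<tau> - \<omega> \<tau>) \<in> max_dom" "(\<lambda>\<tau>. w n \<tau> - \<phi> \<tau>) \<in> max_dom"
      using \<omega> w' \<phi>(1) D(1) by (auto intro!: max_dom_diff)
    have d': "(\<lambda>\<tau>. (-1) * (w n \<tau> - \<omega> \<tau>)) \<in> max_dom"
      using max_dom_lincomb[OF d(1,1), of "-1" 0] by simp
    have "graph_normsq (\<lambda>\<tau>. \<omega> \<tau> - \<phi> \<tau>)
        = graph_normsq (\<lambda>\<tau>. (-1) * (w n \<tau> - \<omega> \<tau>) + (w n \<tau> - \<phi> \<tau>))"
      by simp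
    also have "\<dots> \<le> 2 * graph_normsq (\<lambda>\<tau>. w n \<tau> - \<omega> \<tau>) + 2 * graph_normsq (\<lambda>\<tau>. w n \<tau> - \<phi> \<tau>)"
      using graph_normsq_add_le[OF d' d(2)] graph_normsq_scale[OF d(1), of "-1"] by simp
    also have "\<dots> < e" using n \<phi>(2) by simp
    finally show "\<exists>\<phi>\<in>D. graph_normsq (\<lambda>\<tau>. \<omega> \<tau> - \<phi> \<tau>) < e" using \<phi>(1) by blast
  qed
qed

end

section \<open>Coboundary, boundary and the Dirichlet forms\<close>

text \<open>Closure under subsets is required for nonempty subsets only, which covers both cases of
  \<open>simplices\<close>: with and without the empty simplex.\<close>

locale weighted_complex = weighted_set S m
  for S :: "'v set set" and m :: "'v set \<Rightarrow> real" +
  fixes \<delta> :: "('v set \<Rightarrow> real) \<Rightarrow> ('v set \<Rightarrow> real)"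
  assumes finite_simplex: "\<tau> \<in> S \<Longrightarrow> finite \<tau>"
    and nonempty_subsimplex: "\<sigma> \<in> S \<Longrightarrow> \<tau> \<subseteq> \<sigma> \<Longrightarrow> \<tau> \<noteq> {} \<Longrightarrow> \<tau> \<in> S"
    and locally_summable: "locally_summable S m"
    and coboundary: "coboundary_operator S \<delta>"
begin

abbreviation bd where "bd \<equiv> boundary S m \<delta>"
abbreviation \<theta> where "\<theta> \<equiv> incidence \<delta>"
abbreviation ind where "ind \<tau> \<equiv> indicat_real {\<tau>}"

lemma coboundary_Fun_on: "\<omega> \<in> Fun_on S \<Longrightarrow> \<delta> \<omega> \<in> Fun_on S"
  using coboundary by (simp add: coboundary_operator_def)

lemma coboundary_coboundary: "\<omega> \<in> Fun_on S \<Longrightarrow> \<delta> (\<delta> \<omega>) = (\<lambda>_. 0)"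
  using coboundary by (simp add: coboundary_operator_def)

lemma coboundary_eq:
  "\<omega> \<in> Fun_on S \<Longrightarrow> \<sigma> \<in> S \<Longrightarrow> \<delta> \<omega> \<sigma> = (\<Sum>\<tau> | face S \<tau> \<sigma>. \<omega> \<tau> * \<theta> \<tau> \<sigma>)"
  using coboundary by (simp add: coboundary_operator_def)

lemma face_in: "face S \<tau> \<sigma> \<Longrightarrow> \<tau> \<in> S" "face S \<tau> \<sigma> \<Longrightarrow> \<sigma> \<in> S"
  by (simp_all add: face_def)

lemma incidence_nonface: "\<tau> \<in> S \<Longrightarrow> \<sigma> \<in> S \<Longrightarrow> \<not> face S \<tau> \<sigma> \<Longrightarrow> \<theta> \<tau> \<sigma> = 0"
  using coboundary by (auto simp: coboundary_operator_def)

lemma incidence_cases: "face S \<tau> \<sigma> \<Longrightarrow> \<theta> \<tau> \<sigma> = 1 \<or> \<theta> \<tau> \<sigma> = - 1"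
proof -
  assume f: "face S \<tau> \<sigma>"
  have "\<theta> \<tau> \<sigma> \<in> {-1, 0, 1} \<and> (\<theta> \<tau> \<sigma> \<noteq> 0 \<longleftrightarrow> face S \<tau> \<sigma>)"
    using coboundary face_in[OF f] unfolding coboundary_operator_def by blast
  with f show ?thesis by auto
qed

lemma incidence_square: "face S \<tau> \<sigma> \<Longrightarrow> \<theta> \<tau> \<sigma> * \<theta> \<tau> \<sigma> = 1"
  using incidence_cases[of \<tau> \<sigma>] by auto

lemma incidence_power2: "face S \<tau> \<sigma> \<Longrightarrow> (\<theta> \<tau> \<sigma>)\<^sup>2 = 1"
  by (simp add: power2_eq_square incidence_square)

lemma abs_incidence: "face S \<tau> \<sigma> \<Longrightarrow> \<bar>\<theta> \<tau> \<sigma>\<bar> = 1"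
  using incidence_cases[of \<tau> \<sigma>] by auto

lemma faceE:
  assumes "face S \<tau> \<sigma>"
  obtains x where "\<sigma> = insert x \<tau>" "x \<notin> \<tau>"
proof -
  from assms obtain x where "\<sigma> - \<tau> = {x}" by (auto simp: face_def card_1_singleton_iff)
  moreover have "\<tau> \<subseteq> \<sigma>" using assms by (auto simp: face_def)
  ultimately show thesis by (intro that[of x]) auto
qed

lemma face_insertI: "\<tau> \<in> S \<Longrightarrow> insert x \<tau> \<in> S \<Longrightarrow> x \<notin> \<tau> \<Longrightarrow> face S \<tau> (insert x \<tau>)"
  by (auto simp: face_def insert_Diff_if)

lemma finite_faces: "finite {\<rho>. face S \<rho> \<tau>}"
proof (cases "\<tau> \<in> S")
  case True
  then have "finite (Pow \<tau>)" by (simp add: finite_simplex)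
  then show ?thesis by (rule rev_finite_subset) (auto simp: face_def)
qed (auto simp: face_def)

lemma cofaces_summable: "m summable_on {\<sigma>. face S \<tau> \<sigma>}"
proof (cases "\<tau> \<in> S")
  case True
  then show ?thesis using locally_summable by (simp add: locally_summable_def)
qed (simp add: face_def)

section \<open>Finitely supported functions\<close>

lemma Fun_fin_subset_l2: "Fun_fin S \<subseteq> l2 S m"
  by (auto simp: Fun_fin_def l2_def
      intro!: finite_nonzero_values_imp_summable_on elim!: rev_finite_subset)

lemma Fun_fin_lincomb:
  assumes "\<omega> \<in> Fun_fin S" "\<eta> \<in> Fun_fin S"
  shows "(\<lambda>\<tau>. a * \<omega> \<tau> + b * \<eta> \<tau>) \<in> Fun_fin S"
proof -
  have "finite ({\<tau>. \<omega> \<tau> \<noteq> 0} \<union> {\<tau>. \<eta> \<tau> \<noteq> 0})" using assms by (simp add: Fun_fin_def)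
  then have "finite {\<tau>. a * \<omega> \<tau> + b * \<eta> \<tau> \<noteq> 0}" by (rule rev_finite_subset) auto
  then show ?thesis using assms by (simp add: Fun_fin_def Fun_on_def)
qed

lemma Fun_fin_zero [simp]: "(\<lambda>_. 0) \<in> Fun_fin S"
  by (simp add: Fun_fin_def Fun_on_def)

lemma ind_Fun_fin: "\<tau> \<in> S \<Longrightarrow> ind \<tau> \<in> Fun_fin S"
  by (auto simp: Fun_fin_def Fun_on_def indicator_def)

lemma ind_Fun_on: "\<tau> \<in> S \<Longrightarrow> ind \<tau> \<in> Fun_on S"
  by (auto simp: Fun_on_def indicator_def)

text \<open>Reduces statements about finitely supported functions to indicators. The combination
  case supplies \<open>P\<close> alone; where membership in \<open>Fun_fin S\<close> is wanted
  there, it is made part of \<open>P\<close>.\<close>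

lemma Fun_fin_induct [consumes 1, case_names zero lincomb ind]:
  assumes \<omega>: "\<omega> \<in> Fun_fin S"
    and zero: "P (\<lambda>_. 0)"
    and lincomb: "\<And>\<omega> \<eta> a b. P \<omega> \<Longrightarrow> P \<eta> \<Longrightarrow> P (\<lambda>\<tau>. a * \<omega> \<tau> + b * \<eta> \<tau>)"
    and ind: "\<And>\<tau>. \<tau> \<in> S \<Longrightarrow> P (ind \<tau>)"
  shows "P \<omega>"
proof -
  have "\<And>\<omega>. \<omega> \<in> Fun_on S \<Longrightarrow> {\<tau>. \<omega> \<tau> \<noteq> 0} \<subseteq> A \<Longrightarrow> P \<omega>" if "finite A" for A
    using that
  proof (induction A)
    case empty
    then have "\<omega> = (\<lambda>_. 0)" by auto
    then show ?case using zero by simp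
  next
    case (insert \<tau> A)
    define \<eta> where "\<eta> \<sigma> = (if \<sigma> = \<tau> then 0 else \<omega> \<sigma>)" for \<sigma>
    have "P \<eta>" using insert.prems by (intro insert.IH) (auto simp: \<eta>_def Fun_on_def)
    show ?case
    proof (cases "\<tau> \<in> S")
      case True
      have "\<omega> = (\<lambda>\<sigma>. \<omega> \<tau> * ind \<tau> \<sigma> + 1 * \<eta> \<sigma>)" by (auto simp: \<eta>_def indicator_def)
      then show ?thesis using lincomb[OF ind[OF True] \<open>P \<eta>\<close>, of "\<omega> \<tau>" 1] by simp
    next
      case False
      then have "\<eta> = \<omega>" using insert.prems by (auto simp: \<eta>_def Fun_on_def)
      then show ?thesis using \<open>P \<eta>\<close> by simp
    qed
  qed
  then show ?thesis using \<omega> unfolding Fun_fin_def by blast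
qed

text \<open>By |\<omega>| \<le> 1 + \<omega>^2, with local summability accounting for the constant
  1. The boundary is thus defined on all of \<open>l2\<close>, and the domain condition in the
  Neumann forms reduces to square summability of the image.\<close>

lemma l2_subset_Fun_1: "l2 S m \<subseteq> Fun_1 S m"
proof
  fix \<omega> assume \<omega>: "\<omega> \<in> l2 S m"
  have "(\<lambda>\<sigma>. m \<sigma> * \<bar>\<omega> \<sigma>\<bar>) summable_on {\<sigma>. face S \<tau> \<sigma>}" for \<tau>
  proof (rule summable_on_comparison_test)
    show "(\<lambda>\<sigma>. m \<sigma> + m \<sigma> * (\<omega> \<sigma>)\<^sup>2) summable_on {\<sigma>. face S \<tau> \<sigma>}"
      by (intro summable_on_add cofaces_summable summable_on_subset_banach[OF l2_summable[OF \<omega>]])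
         (auto simp: face_in)
    fix \<sigma> assume "\<sigma> \<in> {\<sigma>. face S \<tau> \<sigma>}"
    then have "0 \<le> m \<sigma>" by (auto simp: face_in m_nonneg)
    moreover have "\<bar>\<omega> \<sigma>\<bar> \<le> 1 + (\<omega> \<sigma>)\<^sup>2"
      using sum_squares_bound[of "\<bar>\<omega> \<sigma>\<bar>" 1] by simp
    ultimately show "m \<sigma> * \<bar>\<omega> \<sigma>\<bar> \<le> m \<sigma> + m \<sigma> * (\<omega> \<sigma>)\<^sup>2"
      using mult_left_mono[of "\<bar>\<omega> \<sigma>\<bar>" "1 + (\<omega> \<sigma>)\<^sup>2" "m \<sigma>"] by (simp add: algebra_simps)
    show "0 \<le> m \<sigma> * \<bar>\<omega> \<sigma>\<bar>" using \<open>0 \<le> m \<sigma>\<close> by simp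
  qed
  then show "\<omega> \<in> Fun_1 S m" using \<omega> by (simp add: Fun_1_def l2_def)
qed

lemma coboundary_riesz:
  assumes \<sigma>: "\<sigma> \<in> S"
  shows "\<exists>g\<in>l2 S m. \<forall>\<omega>\<in>l2 S m. \<delta> \<omega> \<sigma> = inner \<omega> g"
proof (intro bexI ballI)
  define g where "g \<tau> = (if face S \<tau> \<sigma> then \<theta> \<tau> \<sigma> / m \<tau> else 0)" for \<tau>
  have "finite {\<tau>. g \<tau> \<noteq> 0}"
    using finite_faces[of \<sigma>] by (rule rev_finite_subset) (auto simp: g_def)
  then have "g \<in> Fun_fin S" by (auto simp: Fun_fin_def Fun_on_def g_def face_in)
  then show "g \<in> l2 S m" using Fun_fin_subset_l2 by blast
  fix \<omega> assume \<omega>: "\<omega> \<in> l2 S m"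
  have "inner \<omega> g = (\<Sum>\<^sub>\<infinity>\<tau> | face S \<tau> \<sigma>. m \<tau> * \<omega> \<tau> * g \<tau>)"
    unfolding l2_inner_def by (rule infsum_cong_neutral) (auto simp: g_def face_in)
  also have "\<dots> = (\<Sum>\<tau> | face S \<tau> \<sigma>. \<omega> \<tau> * \<theta> \<tau> \<sigma>)"
    using finite_faces[of \<sigma>]
    by (auto intro!: sum.cong simp: g_def) (metis face_in(1) m_pos less_irrefl)
  finally show "\<delta> \<omega> \<sigma> = inner \<omega> g" using \<omega> \<sigma> by (simp add: coboundary_eq l2_Fun_on)
qed

text \<open>The representing function is \<theta>(\<rho>, .)/m(\<rho>) on the cofaces of \<rho>. Its
  squared norm is their total mass divided by m(\<rho>)^2, which is finite by local
  summability.\<close>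

lemma boundary_riesz:
  assumes \<rho>: "\<rho> \<in> S"
  shows "\<exists>g\<in>l2 S m. \<forall>\<omega>\<in>l2 S m. bd \<omega> \<rho> = inner \<omega> g"
proof (intro bexI ballI)
  define g where "g \<tau> = (if face S \<rho> \<tau> then \<theta> \<rho> \<tau> / m \<rho> else 0)" for \<tau>
  have "(\<lambda>\<tau>. m \<tau> * (g \<tau>)\<^sup>2) summable_on S \<longleftrightarrow>
      (\<lambda>\<tau>. 1 / (m \<rho>)\<^sup>2 * m \<tau>) summable_on {\<tau>. face S \<rho> \<tau>}"
    by (rule summable_on_cong_neutral)
       (auto simp: g_def face_in power_divide incidence_power2)
  then have "(\<lambda>\<tau>. m \<tau> * (g \<tau>)\<^sup>2) summable_on S"
    by (simp only: summable_on_cmult_right[OF cofaces_summable])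
  then show "g \<in> l2 S m" by (auto simp: l2_def Fun_on_def g_def face_in)
  fix \<omega> assume \<omega>: "\<omega> \<in> l2 S m"
  have "inner \<omega> g = (\<Sum>\<^sub>\<infinity>\<tau> | face S \<rho> \<tau>. 1 / m \<rho> * (m \<tau> * \<omega> \<tau> * \<theta> \<rho> \<tau>))"
    unfolding l2_inner_def by (rule infsum_cong_neutral) (auto simp: g_def face_in)
  then show "bd \<omega> \<rho> = inner \<omega> g" by (simp only: boundary_def infsum_cmult_right')
qed

lemma boundary_Fun_on: "bd \<omega> \<in> Fun_on S"
  by (simp add: Fun_on_def boundary_def face_def)

text \<open>With the kind as a parameter, closedness is obtained for all three operators at once.
  For \<open>Hodge\<close> the maximal domain constrains only the sum \<delta>\<omega> +
  \<partial>\<omega>.\<close>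

sublocale K: l2_operator S m "kind_map k S m \<delta>" for k
proof
  fix \<omega> assume "\<omega> \<in> l2 S m"
  then have "\<delta> \<omega> \<in> Fun_on S" by (simp add: coboundary_Fun_on l2_Fun_on)
  with boundary_Fun_on[of \<omega>] show "kind_map k S m \<delta> \<omega> \<in> Fun_on S"
    by (cases k) (simp_all add: Fun_on_def)
next
  fix \<sigma> assume "\<sigma> \<in> S"
  note riesz = coboundary_riesz[OF this] boundary_riesz[OF this]
  show "\<exists>g\<in>l2 S m. \<forall>\<omega>\<in>l2 S m. kind_map k S m \<delta> \<omega> \<sigma> = inner \<omega> g"
  proof (cases k)
    case Hodge
    from riesz obtain g h where g: "g \<in> l2 S m" "\<forall>\<omega>\<in>l2 S m. \<delta> \<omega> \<sigma> = inner \<omega> g"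
      and h: "h \<in> l2 S m" "\<forall>\<omega>\<in>l2 S m. bd \<omega> \<sigma> = inner \<omega> h" by blast
    have "inner \<omega> (\<lambda>\<tau>. g \<tau> + h \<tau>) = inner \<omega> g + inner \<omega> h" if "\<omega> \<in> l2 S m" for \<omega>
      using inner_lincomb_left[OF g(1) h(1) that, of 1 1] by (simp add: inner_commute)
    then show ?thesis
      using g h Hodge by (intro bexI[of _ "\<lambda>\<tau>. g \<tau> + h \<tau>"]) (auto intro: l2_add)
  qed (use riesz in simp_all)
qed

lemma l2_subset_kind_space: "l2 S m \<subseteq> kind_space k S m"
  using l2_subset_Fun_1 by (cases k) (auto simp: l2_Fun_on)

lemma Neumann_form_eq: "Neumann_form k S m \<delta> = K.T_form k (K.max_dom k)"
proof -
  have "energy_dom k S m \<delta> \<inter> l2 S m = K.max_dom k"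
    using l2_subset_kind_space by (auto simp: energy_dom_def K.max_dom_def)
  moreover have "energy k S m \<delta> = (\<lambda>\<omega>. normsq (kind_map k S m \<delta> \<omega>))"
    by (simp add: fun_eq_iff energy_def)
  ultimately show ?thesis by (simp add: Neumann_form_def K.T_form_def)
qed

lemma Dirichlet_form_eq: "Dirichlet_form k S m \<delta> = K.T_form k (K.graph_closure k (Fun_fin S))"
proof -
  have "energy k S m \<delta> = (\<lambda>\<omega>. normsq (kind_map k S m \<delta> \<omega>))"
    by (simp add: fun_eq_iff energy_def)
  then show ?thesis
    unfolding Dirichlet_form_def Neumann_form_eq K.form_norm_T_form K.graph_closure_def
    by (simp add: K.T_form_def)
qed

section \<open>Indicators under \<delta> and \<partial>\<close>

lemma coboundary_ind:
  assumes "\<tau> \<in> S"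
  shows "\<delta> (ind \<tau>) \<sigma> = (if face S \<tau> \<sigma> then \<theta> \<tau> \<sigma> else 0)"
proof (cases "\<sigma> \<in> S")
  case True
  then show ?thesis using incidence_nonface[OF assms] by (simp add: incidence_def)
next
  case False
  then show ?thesis
    using coboundary_Fun_on[OF ind_Fun_on[OF assms]] by (auto simp: Fun_on_def face_def)
qed

lemma boundary_ind: "bd (ind \<tau>) \<rho> = (if face S \<rho> \<tau> then m \<tau> * \<theta> \<rho> \<tau> / m \<rho> else 0)"
proof -
  have "(\<Sum>\<^sub>\<infinity>\<tau>' | face S \<rho> \<tau>'. m \<tau>' * ind \<tau> \<tau>' * \<theta> \<rho> \<tau>')
      = (\<Sum>\<^sub>\<infinity>\<tau>' \<in> {\<tau>} \<inter> {\<tau>'. face S \<rho> \<tau>'}. m \<tau>' * \<theta> \<rho> \<tau>')"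
    by (rule infsum_cong_neutral) (auto simp: indicator_def)
  then show ?thesis by (simp add: boundary_def Int_insert_left)
qed

text \<open>The squared norm is the total mass of the cofaces of \<tau>, so this is local
  summability again. It is what admits indicators to the form domains.\<close>

lemma coboundary_ind_l2:
  assumes "\<tau> \<in> S"
  shows "\<delta> (ind \<tau>) \<in> l2 S m"
proof -
  have "(\<lambda>\<sigma>. m \<sigma> * (\<delta> (ind \<tau>) \<sigma>)\<^sup>2) summable_on S \<longleftrightarrow> m summable_on {\<sigma>. face S \<tau> \<sigma>}"
    by (rule summable_on_cong_neutral)
       (auto simp: coboundary_ind[OF assms] face_in incidence_power2)
  then show ?thesis
    using coboundary_Fun_on[OF ind_Fun_on[OF assms]] by (simp add: l2_def cofaces_summable)
qed

lemma boundary_ind_l2: "bd (ind \<tau>) \<in> l2 S m"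
proof -
  have "finite {\<rho>. bd (ind \<tau>) \<rho> \<noteq> 0}"
    using finite_faces[of \<tau>] by (rule rev_finite_subset) (auto simp: boundary_ind split: if_splits)
  then have "bd (ind \<tau>) \<in> Fun_fin S" using boundary_Fun_on by (simp add: Fun_fin_def)
  then show ?thesis using Fun_fin_subset_l2 by blast
qed

lemma Fun_fin_max_dom: "Fun_fin S \<subseteq> K.max_dom k"
proof
  fix \<omega> assume "\<omega> \<in> Fun_fin S"
  then show "\<omega> \<in> K.max_dom k"
  proof (induction rule: Fun_fin_induct)
    case zero
    then show ?case by (simp add: K.max_dom_def K.T_zero)
  next
    case (lincomb \<omega> \<eta> a b)
    then show ?case by (rule K.max_dom_lincomb)
  next
    case (ind \<tau>)
    then show ?case
      using coboundary_ind_l2[OF ind] boundary_ind_l2[of \<tau>] ind_Fun_fin[OF ind] Fun_fin_subset_l2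
      unfolding K.max_dom_def by (cases k) (auto intro: l2_add)
  qed
qed

lemma Fun_fin_maps_l2:
  assumes "\<omega> \<in> Fun_fin S"
  shows "\<delta> \<omega> \<in> l2 S m" "bd \<omega> \<in> l2 S m"
proof -
  have "kind_map k S m \<delta> \<omega> \<in> l2 S m" for k
    using Fun_fin_max_dom assms unfolding K.max_dom_def by blast
  from this[of Up] this[of Down] show "\<delta> \<omega> \<in> l2 S m" "bd \<omega> \<in> l2 S m" by simp_all
qed

lemma inner_coboundary_ind:
  assumes "\<tau> \<in> S"
  shows "inner (\<delta> (ind \<tau>)) \<psi> = (\<Sum>\<^sub>\<infinity>\<sigma> | face S \<tau> \<sigma>. m \<sigma> * \<theta> \<tau> \<sigma> * \<psi> \<sigma>)"
  unfolding l2_inner_def coboundary_ind[OF assms]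
  by (rule infsum_cong_neutral) (auto simp: face_in)

lemma inner_boundary_ind: "inner (bd (ind \<tau>)) \<psi> = (\<Sum>\<rho> | face S \<rho> \<tau>. m \<tau> * \<theta> \<rho> \<tau> * \<psi> \<rho>)"
proof -
  have "inner (bd (ind \<tau>)) \<psi> = (\<Sum>\<^sub>\<infinity>\<rho> | face S \<rho> \<tau>. m \<tau> * \<theta> \<rho> \<tau> * \<psi> \<rho>)"
    unfolding l2_inner_def boundary_ind
    by (rule infsum_cong_neutral) (auto simp: face_in dest!: face_in(1) m_pos)
  then show ?thesis by (simp add: finite_faces)
qed

text \<open>Against the boundary of an indicator, the pairing is a finite sum equal to m(\<tau>)
  times \<delta>\<delta>\<omega>(\<tau>), hence 0. Square summability of \<delta>\<omega> makes the
  pairing linear in the other argument.\<close>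

lemma coboundary_boundary_orthogonal:
  assumes \<omega>: "\<omega> \<in> Fun_on S" "\<delta> \<omega> \<in> l2 S m" and \<psi>: "\<psi> \<in> Fun_fin S"
  shows "inner (\<delta> \<omega>) (bd \<psi>) = 0"
proof -
  have "\<psi> \<in> Fun_fin S \<and> inner (bd \<psi>) (\<delta> \<omega>) = 0"
    using \<psi>
  proof (induction rule: Fun_fin_induct)
    case zero
    have "bd (\<lambda>_. 0) = (\<lambda>_. 0)" using K.T_zero[of Down] by simp
    then show ?case by (simp add: l2_inner_def)
  next
    case (lincomb \<phi> \<eta> a b)
    then have "\<phi> \<in> l2 S m" "\<eta> \<in> l2 S m" using Fun_fin_subset_l2 by blast+
    with lincomb show ?case
      using K.T_lincomb[of \<phi> \<eta> Down a b]
      by (simp add: inner_lincomb_left Fun_fin_maps_l2 Fun_fin_lincomb \<omega>(2))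
  next
    case (ind \<tau>)
    have "inner (bd (ind \<tau>)) (\<delta> \<omega>) = m \<tau> * (\<Sum>\<rho> | face S \<rho> \<tau>. \<delta> \<omega> \<rho> * \<theta> \<rho> \<tau>)"
      by (simp add: inner_boundary_ind sum_distrib_left mult_ac)
    also have "\<dots> = m \<tau> * \<delta> (\<delta> \<omega>) \<tau>" by (simp add: coboundary_eq[OF l2_Fun_on[OF \<omega>(2)] ind])
    also have "\<dots> = 0" by (simp add: coboundary_coboundary[OF \<omega>(1)])
    finally show ?case using ind_Fun_fin[OF ind] by blast
  qed
  then show ?thesis by (simp add: inner_commute)
qed

lemma normsq_Hodge_Fun_fin:
  assumes "\<phi> \<in> Fun_fin S"
  shows "normsq (kind_map Hodge S m \<delta> \<phi>) = normsq (\<delta> \<phi>) + normsq (bd \<phi>)"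
  using normsq_lincomb[of "\<delta> \<phi>" "bd \<phi>" 1 1] coboundary_boundary_orthogonal[OF _ _ assms, of \<phi>] assms
  by (simp add: Fun_fin_maps_l2 Fun_fin_def)

text \<open>On finitely supported functions the two parts of \<open>\<delta> + \<partial>\<close> are orthogonal, so convergence
  in the Hodge form norm entails convergence in each of the two partial form norms.\<close>

lemma Dirichlet_Hodge_le:
  "Dirichlet_form Hodge S m \<delta> \<sqsubseteq>\<^sub>Q form_add (Neumann_form Up S m \<delta>) (Neumann_form Down S m \<delta>)"
proof -
  have "\<omega> \<in> K.max_dom Up \<inter> K.max_dom Down \<and>
      normsq (kind_map Hodge S m \<delta> \<omega>) = normsq (\<delta> \<omega>) + normsq (bd \<omega>)"
    if cl: "\<omega> \<in> K.graph_closure Hodge (Fun_fin S)" for \<omega>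
  proof -
    obtain w where w: "\<And>n. w n \<in> Fun_fin S"
      and lim: "(\<lambda>n. K.graph_normsq Hodge (\<lambda>\<tau>. w n \<tau> - \<omega> \<tau>)) \<longlonglongrightarrow> 0"
      using K.graph_closure_seq[OF cl Fun_fin_max_dom] by blast
    have wl: "w n \<in> l2 S m" for n using w Fun_fin_subset_l2 by blast
    have \<omega>: "\<omega> \<in> K.max_dom Hodge" using cl by (simp only: K.graph_closure_def) blast
    then have \<omega>l: "\<omega> \<in> l2 S m" "kind_map Hodge S m \<delta> \<omega> \<in> l2 S m"
      by (simp_all only: K.max_dom_def) blast+
    \<comment> \<open>Proved for every kind: \<open>Up\<close> and \<open>Down\<close> give the two
      partial norms, and \<open>Hodge\<close> the limit with which their sum is identified.\<close>
    have part: "kind_map k S m \<delta> \<omega> \<in> l2 S m \<and>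
        (\<lambda>n. normsq (kind_map k S m \<delta> (w n))) \<longlonglongrightarrow> normsq (kind_map k S m \<delta> \<omega>)" for k
    proof -
      have Tw: "kind_map k S m \<delta> (w n) \<in> l2 S m" for n
        using w[of n] Fun_fin_max_dom unfolding K.max_dom_def by blast
      have l2lim: "(\<lambda>n. normsq (\<lambda>\<tau>. w n \<tau> - \<omega> \<tau>)) \<longlonglongrightarrow> 0"
        by (rule tendsto_sandwich[OF _ _ tendsto_const lim])
           (auto simp: K.graph_normsq_def intro!: always_eventually)
      have cauchy: "\<exists>N. \<forall>i\<ge>N. \<forall>j\<ge>N.
          normsq (\<lambda>\<tau>. kind_map k S m \<delta> (w i) \<tau> - kind_map k S m \<delta> (w j) \<tau>) < e"
        if "0 < e" for e
      proof -
        from that have "0 < e / 4" by simp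
        from order_tendstoD(2)[OF lim this] obtain N where
          N: "\<And>n. n \<ge> N \<Longrightarrow> K.graph_normsq Hodge (\<lambda>\<tau>. w n \<tau> - \<omega> \<tau>) < e / 4"
          by (auto simp: eventually_sequentially)
        have "normsq (\<lambda>\<tau>. kind_map k S m \<delta> (w i) \<tau> - kind_map k S m \<delta> (w j) \<tau>) < e"
          if "i \<ge> N" "j \<ge> N" for i j
        proof -
          define \<phi> where "\<phi> = (\<lambda>\<tau>. w i \<tau> - w j \<tau>)"
          have \<phi>: "\<phi> \<in> Fun_fin S"
            using Fun_fin_lincomb[OF w[of i] w[of j], of 1 "-1"] by (simp add: \<phi>_def)
          have "normsq (\<lambda>\<tau>. kind_map k S m \<delta> (w i) \<tau> - kind_map k S m \<delta> (w j) \<tau>)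
              = normsq (kind_map k S m \<delta> \<phi>)"
            by (simp add: \<phi>_def K.T_diff[OF wl wl])
          \<comment> \<open>Pythagoras is available because \<phi> is a difference of approximants
            and so has finite support.\<close>
          also have "\<dots> \<le> normsq (kind_map Hodge S m \<delta> \<phi>)"
            using normsq_Hodge_Fun_fin[OF \<phi>] by (cases k) auto
          also have "\<dots> \<le> K.graph_normsq Hodge \<phi>"
            unfolding K.graph_normsq_def by simp
          also have "\<dots> = K.graph_normsq Hodge (\<lambda>\<tau>. (w i \<tau> - \<omega> \<tau>) + (\<omega> \<tau> - w j \<tau>))"
            by (simp add: \<phi>_def)
          also have "\<dots> \<le> 2 * K.graph_normsq Hodge (\<lambda>\<tau>. w i \<tau> - \<omega> \<tau>)
              + 2 * K.graph_normsq Hodge (\<lambda>\<tau>. \<omega> \<tau> - w j \<tau>)"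
            using w Fun_fin_max_dom \<omega> by (intro K.graph_normsq_add_le K.max_dom_diff) blast+
          also have "K.graph_normsq Hodge (\<lambda>\<tau>. \<omega> \<tau> - w j \<tau>)
              = K.graph_normsq Hodge (\<lambda>\<tau>. w j \<tau> - \<omega> \<tau>)"
            using w Fun_fin_max_dom \<omega> by (intro K.graph_normsq_minus_commute) blast+
          also have "2 * K.graph_normsq Hodge (\<lambda>\<tau>. w i \<tau> - \<omega> \<tau>)
              + 2 * K.graph_normsq Hodge (\<lambda>\<tau>. w j \<tau> - \<omega> \<tau>) < e"
            using N[OF that(1)] N[OF that(2)] by linarith
          finally show ?thesis .
        qed
        then show ?thesis by blast
      qed
      note L = l2_Cauchy_limit[OF Tw cauchy
          K.T_pointwise_tendsto[OF wl \<omega>l(1) l2lim] K.T_Fun_on[OF \<omega>l(1)]]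
      from L normsq_tendsto[OF Tw L] show ?thesis by blast
    qed
    have "(\<lambda>n. normsq (kind_map Hodge S m \<delta> (w n))) \<longlonglongrightarrow> normsq (\<delta> \<omega>) + normsq (bd \<omega>)"
      unfolding normsq_Hodge_Fun_fin[OF w] using part[of Up] part[of Down]
      by (intro tendsto_add) simp_all
    then have "normsq (kind_map Hodge S m \<delta> \<omega>) = normsq (\<delta> \<omega>) + normsq (bd \<omega>)"
      using part[of Hodge] LIMSEQ_unique by blast
    then show ?thesis
      using part[of Up] part[of Down] \<omega>l(1) unfolding K.max_dom_def by blast
  qed
  then show ?thesis
    unfolding form_le_def form_add_def Dirichlet_form_eq Neumann_form_eq K.T_form_simps qform.sel
    by auto
qed

lemma admissible_Laplacian_exists: "\<exists>L. admissible_Laplacian k S m \<delta> L"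
proof -
  let ?Q = "Dirichlet_form k S m \<delta>"
  have "closed_form S m ?Q"
    unfolding Dirichlet_form_eq
    by (rule K.closed_graph_closure[OF Fun_fin_max_dom Fun_fin_zero Fun_fin_lincomb])
  moreover have "?Q \<sqsubseteq>\<^sub>Q Neumann_form k S m \<delta>"
    unfolding form_le_def Dirichlet_form_eq Neumann_form_eq K.T_form_simps K.graph_closure_def
    by blast
  moreover have "?Q \<sqsubseteq>\<^sub>Q ?Q" by (simp add: form_le_def)
  ultimately show ?thesis
    unfolding admissible_Laplacian_def is_Laplacian_def using Dirichlet_Hodge_le by blast
qed


section \<open>Adjacent simplices\<close>

lemma face_irrefl: "\<not> face S \<tau> \<tau>"
  by (simp add: face_def)

lemma faces_union:
  assumes "face S \<tau> \<sigma>" "face S \<tau>' \<sigma>" "\<tau>' \<noteq> \<tau>"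
  shows "\<tau> \<union> \<tau>' = \<sigma>"
proof -
  obtain x where x: "\<sigma> = insert x \<tau>" "x \<notin> \<tau>" using assms(1) by (rule faceE)
  obtain y where y: "\<sigma> = insert y \<tau>'" "y \<notin> \<tau>'" using assms(2) by (rule faceE)
  have "x \<noteq> y" using x y assms(3) by (metis insert_ident)
  then show ?thesis using x y by blast
qed

lemma cofaces_inter:
  assumes "face S \<rho> \<tau>" "face S \<rho> \<tau>'" "\<tau>' \<noteq> \<tau>"
  shows "\<tau> \<inter> \<tau>' = \<rho>"
proof -
  obtain x where x: "\<tau> = insert x \<rho>" "x \<notin> \<rho>" using assms(1) by (rule faceE)
  obtain y where y: "\<tau>' = insert y \<rho>" "y \<notin> \<rho>" using assms(2) by (rule faceE)
  show ?thesis using x y assms(3) by auto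
qed

text \<open>Removing the vertex outside \<tau> gives back \<tau>; removing a vertex of \<tau> gives
  every other face. Such a face still contains the outer vertex, so it is nonempty and lies in
  \<open>S\<close> even if the empty simplex does not.\<close>

lemma other_faces_eq:
  assumes "face S \<tau> \<sigma>"
  shows "{\<tau>'. face S \<tau>' \<sigma> \<and> \<tau>' \<noteq> \<tau>} = (\<lambda>x. \<sigma> - {x}) ` \<tau>"
proof -
  obtain y where y: "\<sigma> = insert y \<tau>" "y \<notin> \<tau>" using assms by (rule faceE)
  show ?thesis
  proof (intro equalityI subsetI)
    fix \<tau>' assume "\<tau>' \<in> {\<tau>'. face S \<tau>' \<sigma> \<and> \<tau>' \<noteq> \<tau>}"
    then obtain x where x: "\<sigma> = insert x \<tau>'" "x \<notin> \<tau>'" "\<tau>' \<noteq> \<tau>" by (auto elim: faceE)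
    have "x \<noteq> y" using x y by (metis insert_ident)
    with x y show "\<tau>' \<in> (\<lambda>x. \<sigma> - {x}) ` \<tau>" by (intro image_eqI[of _ _ x]) auto
  next
    fix \<tau>' assume "\<tau>' \<in> (\<lambda>x. \<sigma> - {x}) ` \<tau>"
    then obtain x where x: "x \<in> \<tau>" "\<tau>' = \<sigma> - {x}" by blast
    then have "insert x \<tau>' = \<sigma>" "y \<in> \<tau>'" using y by auto
    moreover have "\<tau>' \<in> S"
      using nonempty_subsimplex[OF face_in(2)[OF assms], of \<tau>'] x \<open>y \<in> \<tau>'\<close> by auto
    ultimately show "\<tau>' \<in> {\<tau>'. face S \<tau>' \<sigma> \<and> \<tau>' \<noteq> \<tau>}"
      using face_insertI[of \<tau>' x] face_in(2)[OF assms] x y by auto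
  qed
qed

lemma card_other_faces:
  assumes "face S \<tau> \<sigma>"
  shows "card {\<tau>'. face S \<tau>' \<sigma> \<and> \<tau>' \<noteq> \<tau>} = card \<tau>"
proof -
  have "\<tau> \<subseteq> \<sigma>" using assms by (auto simp: face_def)
  then have "inj_on (\<lambda>x. \<sigma> - {x}) \<tau>" by (intro inj_onI) blast
  then show ?thesis by (simp add: other_faces_eq[OF assms] card_image)
qed

section \<open>Neighbours through a common coface or a common face, and sums over them\<close>

definition up_adj where
  "up_adj \<tau> = {\<tau>'. face S \<tau> (\<tau> \<union> \<tau>') \<and> face S \<tau>' (\<tau> \<union> \<tau>')}"

definition down_adj where
  "down_adj \<tau> = {\<tau>'. face S (\<tau> \<inter> \<tau>') \<tau> \<and> face S (\<tau> \<inter> \<tau>') \<tau>'}"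

text \<open>Two distinct faces of \<sigma> have union \<sigma>, so each neighbour determines the
  coface through which it is reached. This yields the disjoint fibres used for regrouping.\<close>

lemma up_adj_eq: "up_adj \<tau> = (\<Union>\<sigma>\<in>{\<sigma>. face S \<tau> \<sigma>}. {\<tau>'. face S \<tau>' \<sigma> \<and> \<tau>' \<noteq> \<tau>})"
proof (intro equalityI subsetI)
  fix \<tau>' assume "\<tau>' \<in> up_adj \<tau>"
  then have "face S \<tau> (\<tau> \<union> \<tau>')" "face S \<tau>' (\<tau> \<union> \<tau>')" "\<tau>' \<noteq> \<tau>"
    using face_irrefl[of \<tau>] by (auto simp only: up_adj_def mem_Collect_eq Un_absorb)
  then show "\<tau>' \<in> (\<Union>\<sigma>\<in>{\<sigma>. face S \<tau> \<sigma>}. {\<tau>'. face S \<tau>' \<sigma> \<and> \<tau>' \<noteq> \<tau>})" by blast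
next
  fix \<tau>' assume "\<tau>' \<in> (\<Union>\<sigma>\<in>{\<sigma>. face S \<tau> \<sigma>}. {\<tau>'. face S \<tau>' \<sigma> \<and> \<tau>' \<noteq> \<tau>})"
  then obtain \<sigma> where \<sigma>: "face S \<tau> \<sigma>" "face S \<tau>' \<sigma>" "\<tau>' \<noteq> \<tau>" by blast
  then show "\<tau>' \<in> up_adj \<tau>" by (simp add: up_adj_def faces_union[OF \<sigma>])
qed

lemma down_adj_eq: "down_adj \<tau> = (\<Union>\<rho>\<in>{\<rho>. face S \<rho> \<tau>}. {\<tau>'. face S \<rho> \<tau>' \<and> \<tau>' \<noteq> \<tau>})"
proof (intro equalityI subsetI)
  fix \<tau>' assume "\<tau>' \<in> down_adj \<tau>"
  then have "face S (\<tau> \<inter> \<tau>') \<tau>" "face S (\<tau> \<inter> \<tau>') \<tau>'" "\<tau>' \<noteq> \<tau>"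
    using face_irrefl[of \<tau>] by (auto simp only: down_adj_def mem_Collect_eq Int_absorb)
  then show "\<tau>' \<in> (\<Union>\<rho>\<in>{\<rho>. face S \<rho> \<tau>}. {\<tau>'. face S \<rho> \<tau>' \<and> \<tau>' \<noteq> \<tau>})" by blast
next
  fix \<tau>' assume "\<tau>' \<in> (\<Union>\<rho>\<in>{\<rho>. face S \<rho> \<tau>}. {\<tau>'. face S \<rho> \<tau>' \<and> \<tau>' \<noteq> \<tau>})"
  then obtain \<rho> where \<rho>: "face S \<rho> \<tau>" "face S \<rho> \<tau>'" "\<tau>' \<noteq> \<tau>" by blast
  then show "\<tau>' \<in> down_adj \<tau>" by (simp add: down_adj_def cofaces_inter[OF \<rho>])
qed

lemma disjoint_other_faces:
  "disjoint_family_on (\<lambda>\<sigma>. {\<tau>'. face S \<tau>' \<sigma> \<and> \<tau>' \<noteq> \<tau>}) {\<sigma>. face S \<tau> \<sigma>}"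
  unfolding disjoint_family_on_def using faces_union by blast

lemma disjoint_other_cofaces:
  "disjoint_family_on (\<lambda>\<rho>. {\<tau>'. face S \<rho> \<tau>' \<and> \<tau>' \<noteq> \<tau>}) {\<rho>. face S \<rho> \<tau>}"
  unfolding disjoint_family_on_def using cofaces_inter by blast

lemma adj_subset: "up_adj \<tau> \<subseteq> S" "down_adj \<tau> \<subseteq> S"
  by (auto simp: up_adj_def down_adj_def face_in)

text \<open>The fibres are finite but there may be infinitely many of them, so summability of
  \<open>g\<close> has to be supplied.\<close>

lemma has_sum_up_adj:
  fixes g :: "'v set \<Rightarrow> real"
  assumes "g summable_on S" and "\<And>\<tau>'. \<tau>' \<notin> up_adj \<tau> \<Longrightarrow> g \<tau>' = 0"
  shows "((\<lambda>\<sigma>. \<Sum>\<tau>' | face S \<tau>' \<sigma> \<and> \<tau>' \<noteq> \<tau>. g \<tau>') has_sum infsum g S) {\<sigma>. face S \<tau> \<sigma>}"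
proof -
  have "g summable_on up_adj \<tau>"
    using assms(1) adj_subset(1) by (rule summable_on_subset_banach)
  moreover have "infsum g (up_adj \<tau>) = infsum g S"
    using adj_subset(1)[of \<tau>] assms(2) by (intro infsum_cong_neutral) auto
  ultimately have "((\<lambda>\<sigma>. infsum g {\<tau>'. face S \<tau>' \<sigma> \<and> \<tau>' \<noteq> \<tau>}) has_sum infsum g S) {\<sigma>. face S \<tau> \<sigma>}"
    using has_sum_fibers[OF _ disjoint_other_faces, of g \<tau>] by (simp add: up_adj_eq)
  moreover have "finite {\<tau>'. face S \<tau>' \<sigma> \<and> \<tau>' \<noteq> \<tau>}" for \<sigma>
    using finite_faces[of \<sigma>] by (rule rev_finite_subset) auto
  ultimately show ?thesis by simp
qed

text \<open>The opposite situation: finitely many fibres, each possibly infinite. Convergence on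
  every fibre suffices, and summability over \<open>S\<close> is a conclusion.\<close>

lemma has_sum_down_adj:
  fixes g :: "'v set \<Rightarrow> real"
  assumes "\<And>\<rho>. face S \<rho> \<tau> \<Longrightarrow> g summable_on {\<tau>'. face S \<rho> \<tau>' \<and> \<tau>' \<noteq> \<tau>}"
    and "\<And>\<tau>'. \<tau>' \<notin> down_adj \<tau> \<Longrightarrow> g \<tau>' = 0"
  shows "(g has_sum (\<Sum>\<rho> | face S \<rho> \<tau>. \<Sum>\<^sub>\<infinity>\<tau>' | face S \<rho> \<tau>' \<and> \<tau>' \<noteq> \<tau>. g \<tau>')) S"
proof -
  have "(g has_sum (\<Sum>\<rho> | face S \<rho> \<tau>. \<Sum>\<^sub>\<infinity>\<tau>' | face S \<rho> \<tau>' \<and> \<tau>' \<noteq> \<tau>. g \<tau>')) (down_adj \<tau>)"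
    unfolding down_adj_eq using disjoint_other_cofaces[of \<tau>] assms(1)
    by (intro sum_has_sum finite_faces) (auto simp: disjoint_family_on_def)
  then show ?thesis
    using adj_subset(2)[of \<tau>] assms(2)
    by (subst has_sum_cong_neutral[of "down_adj \<tau>" S g g]) auto
qed

section \<open>The coefficients b\<close>

lemma b_up_eq: "b_up S m \<tau> \<tau>' = (if \<tau>' \<in> up_adj \<tau> then m (\<tau> \<union> \<tau>') else 0)"
  by (simp add: b_up_def up_adj_def)

lemma b_down_eq: "b_down S m \<tau> \<tau>' = (if \<tau>' \<in> down_adj \<tau> then m \<tau> * m \<tau>' / m (\<tau> \<inter> \<tau>') else 0)"
  by (simp add: b_down_def down_adj_def)

lemma up_adj_sym: "\<tau>' \<in> up_adj \<tau> \<longleftrightarrow> \<tau> \<in> up_adj \<tau>'"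
  by (auto simp: up_adj_def Un_commute)

lemma down_adj_sym: "\<tau>' \<in> down_adj \<tau> \<longleftrightarrow> \<tau> \<in> down_adj \<tau>'"
  by (auto simp: down_adj_def Int_commute)

lemma not_adj_self: "\<tau> \<notin> up_adj \<tau>" "\<tau> \<notin> down_adj \<tau>"
  by (simp_all add: up_adj_def down_adj_def face_irrefl)

lemma b_up_nonneg: "0 \<le> b_up S m \<tau> \<tau>'"
  by (auto simp: b_up_def face_in m_nonneg)

lemma b_down_nonneg: "0 \<le> b_down S m \<tau> \<tau>'"
  by (auto simp: b_down_def face_in m_nonneg)

lemma coef_b_nonneg: "0 \<le> coef_b k S m \<tau> \<tau>'"
  by (cases k) (simp_all add: b_up_nonneg b_down_nonneg)

lemma b_up_commute: "b_up S m \<tau> \<tau>' = b_up S m \<tau>' \<tau>"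
  by (simp add: b_up_eq up_adj_sym[of \<tau>'] Un_commute)

lemma b_down_commute: "b_down S m \<tau> \<tau>' = b_down S m \<tau>' \<tau>"
  by (simp add: b_down_eq down_adj_sym[of \<tau>'] Int_commute mult.commute)

lemma coef_b_commute: "coef_b k S m \<tau> \<tau>' = coef_b k S m \<tau>' \<tau>"
  by (cases k) (simp_all add: b_up_commute[of \<tau>] b_down_commute[of \<tau>])

lemma coef_b_self: "coef_b k S m \<tau> \<tau> = 0"
  by (cases k) (simp_all add: b_up_eq b_down_eq not_adj_self)

lemma coef_b_outside: "\<tau>' \<notin> S \<Longrightarrow> coef_b k S m \<tau> \<tau>' = 0"
  using adj_subset[of \<tau>] by (cases k) (auto simp: b_up_eq b_down_eq)

text \<open>Each coface \<sigma> contributes m(\<sigma>) once for every other face, and these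
  correspond to the vertices of \<tau>. The factor is dim(\<tau>) + 1, one more than what the
  coefficient c subtracts.\<close>

lemma b_up_has_sum:
  assumes "\<tau> \<in> S"
  shows "(b_up S m \<tau> has_sum real (card \<tau>) * (\<Sum>\<^sub>\<infinity>\<sigma> | face S \<tau> \<sigma>. m \<sigma>)) S"
proof -
  have fin: "finite {\<tau>'. face S \<tau>' \<sigma> \<and> \<tau>' \<noteq> \<tau>}" for \<sigma>
    using finite_faces[of \<sigma>] by (rule rev_finite_subset) auto
  have b_eq: "b_up S m \<tau> \<tau>' = m \<sigma>" if "face S \<tau> \<sigma>" "face S \<tau>' \<sigma>" "\<tau>' \<noteq> \<tau>" for \<tau>' \<sigma>
    using that by (simp add: b_up_def faces_union[OF that])
  have fiber: "(\<Sum>\<tau>' | face S \<tau>' \<sigma> \<and> \<tau>' \<noteq> \<tau>. b_up S m \<tau> \<tau>') = real (card \<tau>) * m \<sigma>"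
    if "face S \<tau> \<sigma>" for \<sigma>
  proof -
    have "(\<Sum>\<tau>' | face S \<tau>' \<sigma> \<and> \<tau>' \<noteq> \<tau>. b_up S m \<tau> \<tau>') = (\<Sum>\<tau>' | face S \<tau>' \<sigma> \<and> \<tau>' \<noteq> \<tau>. m \<sigma>)"
      using b_eq[OF that] by (intro sum.cong) simp_all
    then show ?thesis by (simp add: card_other_faces that)
  qed
  have "b_up S m \<tau> summable_on up_adj \<tau>"
    unfolding up_adj_eq
  proof (rule summable_on_UnionI[OF _ _ b_up_nonneg disjoint_other_faces])
    show "(b_up S m \<tau> has_sum real (card \<tau>) * m \<sigma>) {\<tau>'. face S \<tau>' \<sigma> \<and> \<tau>' \<noteq> \<tau>}"
      if "\<sigma> \<in> {\<sigma>. face S \<tau> \<sigma>}" for \<sigma>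
      using that by (intro has_sum_finiteI fin) (simp add: fiber)
  qed (intro summable_on_cmult_right cofaces_summable)
  then have s: "b_up S m \<tau> summable_on S"
    by (rule summable_on_cong_neutral[THEN iffD1, rotated 3]) (use adj_subset in \<open>auto simp: b_up_eq\<close>)
  have "((\<lambda>\<sigma>. \<Sum>\<tau>' | face S \<tau>' \<sigma> \<and> \<tau>' \<noteq> \<tau>. b_up S m \<tau> \<tau>') has_sum infsum (b_up S m \<tau>) S)
      {\<sigma>. face S \<tau> \<sigma>}"
    by (rule has_sum_up_adj[OF s]) (simp add: b_up_eq)
  then have "((\<lambda>\<sigma>. real (card \<tau>) * m \<sigma>) has_sum infsum (b_up S m \<tau>) S) {\<sigma>. face S \<tau> \<sigma>}"
    by (rule has_sum_cong[THEN iffD1, rotated]) (simp add: fiber)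
  then have "infsum (b_up S m \<tau>) S = real (card \<tau>) * (\<Sum>\<^sub>\<infinity>\<sigma> | face S \<tau> \<sigma>. m \<sigma>)"
    by (metis infsumI infsum_cmult_right')
  then show ?thesis using has_sum_infsum[OF s] by simp
qed

lemma other_cofaces_summable:
  assumes "\<omega> \<in> l2 S m"
  shows "(\<lambda>\<tau>'. m \<tau>' * \<omega> \<tau>') summable_on {\<tau>'. face S \<rho> \<tau>'}"
    "(\<lambda>\<tau>'. m \<tau>' * \<omega> \<tau>') summable_on {\<tau>'. face S \<rho> \<tau>' \<and> \<tau>' \<noteq> \<tau>}"
proof -
  have "(\<lambda>\<tau>'. norm (m \<tau>' * \<omega> \<tau>')) summable_on {\<tau>'. face S \<rho> \<tau>'}"
  proof (cases "\<rho> \<in> S")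
    case True
    then have "(\<lambda>\<tau>'. m \<tau>' * \<bar>\<omega> \<tau>'\<bar>) summable_on {\<tau>'. face S \<rho> \<tau>'}"
      using assms l2_subset_Fun_1 by (auto simp: Fun_1_def)
    then show ?thesis
      by (rule summable_on_cong[THEN iffD1, rotated]) (auto simp: abs_mult face_in m_nonneg)
  qed (simp add: face_def)
  then show *: "(\<lambda>\<tau>'. m \<tau>' * \<omega> \<tau>') summable_on {\<tau>'. face S \<rho> \<tau>'}"
    by (rule abs_summable_summable)
  show "(\<lambda>\<tau>'. m \<tau>' * \<omega> \<tau>') summable_on {\<tau>'. face S \<rho> \<tau>' \<and> \<tau>' \<noteq> \<tau>}"
    by (rule summable_on_subset_banach[OF *]) auto
qed

lemma b_down_other_coface:
  "face S \<rho> \<tau> \<Longrightarrow> face S \<rho> \<tau>' \<Longrightarrow> \<tau>' \<noteq> \<tau> \<Longrightarrow> b_down S m \<tau> \<tau>' = m \<tau> / m \<rho> * m \<tau>'"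
  by (simp add: b_down_def cofaces_inter)

lemma b_down_has_sum:
  "(b_down S m \<tau> has_sum
     (\<Sum>\<rho> | face S \<rho> \<tau>. m \<tau> / m \<rho> * (\<Sum>\<^sub>\<infinity>\<tau>' | face S \<rho> \<tau>' \<and> \<tau>' \<noteq> \<tau>. m \<tau>'))) S"
proof -
  have eq: "(\<Sum>\<^sub>\<infinity>\<tau>' | face S \<rho> \<tau>' \<and> \<tau>' \<noteq> \<tau>. b_down S m \<tau> \<tau>')
      = m \<tau> / m \<rho> * (\<Sum>\<^sub>\<infinity>\<tau>' | face S \<rho> \<tau>' \<and> \<tau>' \<noteq> \<tau>. m \<tau>')" if "face S \<rho> \<tau>" for \<rho>
    unfolding infsum_cmult_right'[symmetric]
    by (rule infsum_cong) (simp add: b_down_other_coface[OF that])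
  have s: "b_down S m \<tau> summable_on {\<tau>'. face S \<rho> \<tau>' \<and> \<tau>' \<noteq> \<tau>}" if "face S \<rho> \<tau>" for \<rho>
  proof -
    have "(\<lambda>\<tau>'. m \<tau> / m \<rho> * m \<tau>') summable_on {\<tau>'. face S \<rho> \<tau>' \<and> \<tau>' \<noteq> \<tau>}"
      by (intro summable_on_cmult_right summable_on_subset_banach[OF cofaces_summable[of \<rho>]]) auto
    then show ?thesis
      by (rule summable_on_cong[THEN iffD1, rotated]) (simp add: b_down_other_coface[OF that])
  qed
  have "(b_down S m \<tau> has_sum (\<Sum>\<rho> | face S \<rho> \<tau>. \<Sum>\<^sub>\<infinity>\<tau>' | face S \<rho> \<tau>' \<and> \<tau>' \<noteq> \<tau>. b_down S m \<tau> \<tau>')) S"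
    by (rule has_sum_down_adj[OF s]) (simp_all add: b_down_eq)
  moreover have "(\<Sum>\<rho> | face S \<rho> \<tau>. \<Sum>\<^sub>\<infinity>\<tau>' | face S \<rho> \<tau>' \<and> \<tau>' \<noteq> \<tau>. b_down S m \<tau> \<tau>')
      = (\<Sum>\<rho> | face S \<rho> \<tau>. m \<tau> / m \<rho> * (\<Sum>\<^sub>\<infinity>\<tau>' | face S \<rho> \<tau>' \<and> \<tau>' \<noteq> \<tau>. m \<tau>'))"
    by (rule sum.cong) (simp_all only: eq mem_Collect_eq)
  ultimately show ?thesis by simp
qed

text \<open>On each of the finitely many fibres the coefficient is a constant times m, and
  \<open>l2\<close> functions are summable against m over cofaces.\<close>

lemma b_down_l2_summable:
  assumes "\<omega> \<in> l2 S m"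
  shows "(\<lambda>\<tau>'. b_down S m \<tau> \<tau>' * \<omega> \<tau>') summable_on S"
proof -
  have "(\<lambda>\<tau>'. b_down S m \<tau> \<tau>' * \<omega> \<tau>') summable_on {\<tau>'. face S \<rho> \<tau>' \<and> \<tau>' \<noteq> \<tau>}"
    if "face S \<rho> \<tau>" for \<rho>
    using summable_on_cmult_right[OF other_cofaces_summable(2)[OF assms, of \<rho> \<tau>], of "m \<tau> / m \<rho>"]
    by (rule summable_on_cong[THEN iffD1, rotated]) (simp add: b_down_other_coface[OF that])
  from has_sum_down_adj[OF this] show ?thesis
    by (auto simp: b_down_eq intro: has_sum_imp_summable)
qed

lemma coef_b_summable:
  assumes "\<tau> \<in> S"
  shows "coef_b k S m \<tau> summable_on S"
proof -
  have s: "b_up S m \<tau> summable_on S" "b_down S m \<tau> summable_on S"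
    using b_up_has_sum[OF assms] b_down_has_sum by (blast intro: has_sum_imp_summable)+
  show ?thesis
  proof (cases k)
    case Hodge
    have "coef_b Hodge S m \<tau> summable_on S"
    proof (rule summable_on_comparison_test[OF summable_on_add[OF s]])
      show "coef_b Hodge S m \<tau> \<tau>' \<le> b_up S m \<tau> \<tau>' + b_down S m \<tau> \<tau>'" for \<tau>'
        using b_up_nonneg[of \<tau> \<tau>'] b_down_nonneg[of \<tau> \<tau>'] by simp
    qed (rule coef_b_nonneg)
    then show ?thesis unfolding Hodge .
  next
    case Up
    have "coef_b Up S m \<tau> = b_up S m \<tau>" by (simp add: fun_eq_iff)
    then show ?thesis using s Up by simp
  next
    case Down
    have "coef_b Down S m \<tau> = b_down S m \<tau>" by (simp add: fun_eq_iff)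
    then show ?thesis using s Down by simp
  qed
qed

section \<open>The signs o\<close>

lemma o_up_eq:
  "\<tau>' \<in> up_adj \<tau> \<Longrightarrow> o_up S \<delta> \<tau> \<tau>' = - \<theta> \<tau> (\<tau> \<union> \<tau>') * \<theta> \<tau>' (\<tau> \<union> \<tau>')"
  by (simp add: o_up_def up_adj_def)

lemma o_down_eq:
  "\<tau>' \<in> down_adj \<tau> \<Longrightarrow> o_down S \<delta> \<tau> \<tau>' = - \<theta> (\<tau> \<inter> \<tau>') \<tau> * \<theta> (\<tau> \<inter> \<tau>') \<tau>'"
  by (simp add: o_down_def down_adj_def)

lemma abs_o_up: "\<tau>' \<in> up_adj \<tau> \<Longrightarrow> \<bar>o_up S \<delta> \<tau> \<tau>'\<bar> = 1"
  by (simp add: o_up_def up_adj_def abs_mult abs_incidence)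

lemma abs_o_down: "\<tau>' \<in> down_adj \<tau> \<Longrightarrow> \<bar>o_down S \<delta> \<tau> \<tau>'\<bar> = 1"
  by (simp add: o_down_def down_adj_def abs_mult abs_incidence)

text \<open>\<open>\<tau>\<close> and \<open>\<tau>'\<close> are the only simplices between \<open>\<tau> \<inter> \<tau>'\<close> and \<open>\<tau> \<union> \<tau>'\<close>, so \<open>\<delta>\<delta> = 0\<close>
  says that their two contributions cancel.\<close>

lemma o_up_o_down_opposite:
  assumes up: "\<tau>' \<in> up_adj \<tau>" and down: "\<tau>' \<in> down_adj \<tau>"
  shows "o_up S \<delta> \<tau> \<tau>' = - o_down S \<delta> \<tau> \<tau>'"
proof -
  let ?\<rho> = "\<tau> \<inter> \<tau>'" and ?\<sigma> = "\<tau> \<union> \<tau>'"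
  have f: "face S \<tau> ?\<sigma>" "face S \<tau>' ?\<sigma>" "face S ?\<rho> \<tau>" "face S ?\<rho> \<tau>'" "\<tau> \<noteq> \<tau>'"
    using up down not_adj_self[of \<tau>] by (auto simp: up_adj_def down_adj_def)
  have between: "{\<xi>. face S ?\<rho> \<xi> \<and> face S \<xi> ?\<sigma>} = {\<tau>, \<tau>'}"
  proof (intro equalityI subsetI)
    fix \<xi> assume "\<xi> \<in> {\<xi>. face S ?\<rho> \<xi> \<and> face S \<xi> ?\<sigma>}"
    then have \<xi>: "face S ?\<rho> \<xi>" "\<xi> \<subseteq> ?\<sigma>" by (auto simp only: face_def)
    from \<xi>(1) obtain z where z: "\<xi> = insert z ?\<rho>" "z \<notin> ?\<rho>" by (rule faceE)
    obtain x where x: "\<tau> = insert x ?\<rho>" using f(3) by (rule faceE)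
    obtain y where y: "\<tau>' = insert y ?\<rho>" using f(4) by (rule faceE)
    have "z \<in> ?\<sigma>" using z(1) \<xi>(2) by auto
    then have "z = x \<or> z = y" using z(2) x y by (metis Un_iff insert_iff)
    then show "\<xi> \<in> {\<tau>, \<tau>'}" using z(1) x y by (metis insert_iff)
  qed (use f in auto)
  have "0 = \<delta> (\<delta> (ind ?\<rho>)) ?\<sigma>"
    by (simp add: coboundary_coboundary ind_Fun_on face_in(1)[OF f(3)])
  also have "\<dots> = (\<Sum>\<xi> | face S \<xi> ?\<sigma>. \<delta> (ind ?\<rho>) \<xi> * \<theta> \<xi> ?\<sigma>)"
    by (intro coboundary_eq coboundary_Fun_on ind_Fun_on face_in(1)[OF f(3)] face_in(2)[OF f(1)])
  also have "\<dots> = (\<Sum>\<xi> | face S ?\<rho> \<xi> \<and> face S \<xi> ?\<sigma>. \<theta> ?\<rho> \<xi> * \<theta> \<xi> ?\<sigma>)"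
    using finite_faces[of ?\<sigma>]
    by (intro sum.mono_neutral_cong_right) (auto simp: coboundary_ind face_in(1)[OF f(3)])
  also have "\<dots> = \<theta> ?\<rho> \<tau> * \<theta> \<tau> ?\<sigma> + \<theta> ?\<rho> \<tau>' * \<theta> \<tau>' ?\<sigma>"
    unfolding between using f(5) by simp
  finally have "\<theta> ?\<rho> \<tau> * \<theta> \<tau> ?\<sigma> + \<theta> ?\<rho> \<tau>' * \<theta> \<tau>' ?\<sigma> = 0" by simp
  then have "\<theta> \<tau> ?\<sigma> * \<theta> \<tau>' ?\<sigma> = - (\<theta> ?\<rho> \<tau> * \<theta> ?\<rho> \<tau>')"
    using incidence_cases[OF f(1)] incidence_cases[OF f(2)] incidence_cases[OF f(3)]
      incidence_cases[OF f(4)]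
    by (elim disjE) simp_all
  then show ?thesis by (simp only: o_up_eq[OF up] o_down_eq[OF down])
qed

lemma up_adj_imp_down_adj:
  assumes "\<tau>' \<in> up_adj \<tau>" "\<tau> \<inter> \<tau>' \<in> S"
  shows "\<tau>' \<in> down_adj \<tau>"
proof -
  let ?\<sigma> = "\<tau> \<union> \<tau>'"
  have f: "face S \<tau> ?\<sigma>" "face S \<tau>' ?\<sigma>" "\<tau> \<noteq> \<tau>'"
    using assms not_adj_self[of \<tau>] by (auto simp: up_adj_def)
  obtain x where x: "?\<sigma> = insert x \<tau>" "x \<notin> \<tau>" using f(1) by (rule faceE)
  obtain y where y: "?\<sigma> = insert y \<tau>'" "y \<notin> \<tau>'" using f(2) by (rule faceE)
  have "x \<in> \<tau>'" "y \<in> \<tau>" using x y by blast+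
  then have "\<tau> = insert y (\<tau> \<inter> \<tau>')" "\<tau>' = insert x (\<tau> \<inter> \<tau>')" using x y by auto
  then show ?thesis
    using face_insertI[OF assms(2), of y] face_insertI[OF assms(2), of x] x y face_in(1)[OF f(1)]
      face_in(1)[OF f(2)]
    by (auto simp: down_adj_def)
qed

text \<open>The only intersection that can leave \<open>S\<close> is the empty simplex, and then
  both simplices are vertices. This is precisely the exceptional case of \<open>coef_o\<close> for
  \<open>Hodge\<close>.\<close>

lemma excluded_intersection:
  assumes "\<tau>' \<in> up_adj \<tau>" "\<tau> \<inter> \<tau>' \<notin> S"
  shows "{} \<notin> S" "dimension \<tau> = 0" "dimension \<tau>' = 0"
proof -
  let ?\<sigma> = "\<tau> \<union> \<tau>'"
  have f: "face S \<tau> ?\<sigma>" "face S \<tau>' ?\<sigma>" "\<tau> \<noteq> \<tau>'"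
    using assms not_adj_self[of \<tau>] by (auto simp: up_adj_def)
  have "\<tau> \<inter> \<tau>' = {}"
    using nonempty_subsimplex[OF face_in(1)[OF f(1)], of "\<tau> \<inter> \<tau>'"] assms(2) by blast
  then show E: "{} \<notin> S" using assms(2) by simp
  obtain x where x: "?\<sigma> = insert x \<tau>" "x \<notin> \<tau>" using f(1) by (rule faceE)
  obtain y where y: "?\<sigma> = insert y \<tau>'" "y \<notin> \<tau>'" using f(2) by (rule faceE)
  have "\<tau> = {y}" "\<tau>' = {x}" using x y \<open>\<tau> \<inter> \<tau>' = {}\<close> by blast+
  then show "dimension \<tau> = 0" "dimension \<tau>' = 0" by (simp_all add: dimension_def)
qed

text \<open>Since |d| sgn d = d, the left side is \<open>b_down - b_up\<close> times
  \<open>o_down\<close>, and \<open>o_up = - o_down\<close> wherever \<open>b_up\<close> is nonzero.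
  In the exceptional case \<open>b_down\<close> is 0 and only the up part remains.\<close>

lemma Hodge_b_o:
  assumes "\<tau> \<in> S" "\<tau>' \<in> S"
  shows "coef_b Hodge S m \<tau> \<tau>' * coef_o Hodge S m \<delta> \<tau> \<tau>'
    = b_up S m \<tau> \<tau>' * o_up S \<delta> \<tau> \<tau>' + b_down S m \<tau> \<tau>' * o_down S \<delta> \<tau> \<tau>'"
proof (cases "dimension \<tau> = 0 \<and> dimension \<tau>' = 0 \<and> {} \<notin> S")
  case True
  \<comment> \<open>The intersection is either empty, hence outside \<open>S\<close>, or \<tau>
    itself, which is not a proper face of \<tau>.\<close>
  then obtain x where "\<tau> = {x}" by (auto simp: dimension_def card_1_singleton_iff)
  then have "\<tau>' \<notin> down_adj \<tau>"
    using True by (cases "x \<in> \<tau>'") (auto simp: down_adj_def face_irrefl dest: face_in)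
  then have "b_down S m \<tau> \<tau>' = 0" by (simp add: b_down_eq)
  then show ?thesis using True assms b_up_nonneg[of \<tau> \<tau>'] by simp
next
  case False
  then have "coef_b Hodge S m \<tau> \<tau>' * coef_o Hodge S m \<delta> \<tau> \<tau>'
      = (b_down S m \<tau> \<tau>' - b_up S m \<tau> \<tau>') * o_down S \<delta> \<tau> \<tau>'"
    by (auto simp: sgn_if)
  moreover have "b_up S m \<tau> \<tau>' * o_up S \<delta> \<tau> \<tau>' = - b_up S m \<tau> \<tau>' * o_down S \<delta> \<tau> \<tau>'"
  proof (cases "\<tau>' \<in> up_adj \<tau>")
    case True
    then have "\<tau>' \<in> down_adj \<tau>"
      using False up_adj_imp_down_adj excluded_intersection by blast
    then show ?thesis using o_up_o_down_opposite[OF True] by simp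
  qed (simp add: b_up_eq)
  ultimately show ?thesis by (simp add: algebra_simps)
qed

lemma abs_b_o:
  assumes "\<tau> \<in> S" "\<tau>' \<in> S"
  shows "\<bar>coef_b k S m \<tau> \<tau>' * coef_o k S m \<delta> \<tau> \<tau>'\<bar> = coef_b k S m \<tau> \<tau>'"
proof (cases k)
  case Up
  then show ?thesis using b_up_nonneg[of \<tau> \<tau>'] abs_o_up[of \<tau>' \<tau>] by (auto simp: abs_mult b_up_eq)
next
  case Down
  then show ?thesis
    using b_down_nonneg[of \<tau> \<tau>'] abs_o_down[of \<tau>' \<tau>] by (auto simp: abs_mult b_down_eq)
next
  case Hodge
  show ?thesis
  proof (cases "\<tau>' \<in> down_adj \<tau>")
    case True
    have "b_up S m \<tau> \<tau>' * o_up S \<delta> \<tau> \<tau>' = - b_up S m \<tau> \<tau>' * o_down S \<delta> \<tau> \<tau>'"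
      using o_up_o_down_opposite[OF _ True] by (cases "\<tau>' \<in> up_adj \<tau>") (simp_all add: b_up_eq)
    then have "coef_b Hodge S m \<tau> \<tau>' * coef_o Hodge S m \<delta> \<tau> \<tau>'
        = (b_down S m \<tau> \<tau>' - b_up S m \<tau> \<tau>') * o_down S \<delta> \<tau> \<tau>'"
      unfolding Hodge_b_o[OF assms] by (simp add: algebra_simps)
    then show ?thesis using Hodge abs_o_down[OF True] by (simp only: abs_mult coef_b.simps) simp
  next
    case False
    then show ?thesis
      using Hodge abs_o_up[of \<tau>' \<tau>] unfolding Hodge Hodge_b_o[OF assms]
      by (auto simp: abs_mult b_up_eq b_down_eq)
  qed
qed


section \<open>Schroedinger operators and Green's formula\<close>

text \<open>Entries of the Schroedinger operator multiplied by m(\<tau>). As b vanishes on the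
  diagonal, the sign term contributes nothing there and all factors of \<omega>(\<tau>) are
  collected in one entry.\<close>

definition schroedinger_matrix where
  "schroedinger_matrix k \<tau> \<tau>' =
     (if \<tau>' = \<tau> then (\<Sum>\<^sub>\<infinity>\<tau>'\<in>S. coef_b k S m \<tau> \<tau>') + coef_c k S m \<tau>
      else - (coef_b k S m \<tau> \<tau>' * coef_o k S m \<delta> \<tau> \<tau>'))"

lemma abs_schroedinger_matrix:
  "\<tau> \<in> S \<Longrightarrow> \<tau>' \<in> S \<Longrightarrow> \<tau>' \<noteq> \<tau> \<Longrightarrow> \<bar>schroedinger_matrix k \<tau> \<tau>'\<bar> = coef_b k S m \<tau> \<tau>'"
  by (simp add: schroedinger_matrix_def abs_b_o)

lemma coef_b_fun: "coef_b Up S m \<tau> = b_up S m \<tau>" "coef_b Down S m \<tau> = b_down S m \<tau>"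
  by (simp_all add: fun_eq_iff)

text \<open>The multiple dim(\<tau>) + 1 from b and -dim(\<tau>) from c leave one copy of the coface
  mass, which is the squared norm of \<delta> applied to the indicator.\<close>

lemma schroedinger_matrix_diag_Up:
  assumes "\<tau> \<in> S"
  shows "schroedinger_matrix Up \<tau> \<tau> = (\<Sum>\<^sub>\<infinity>\<sigma> | face S \<tau> \<sigma>. m \<sigma>)"
  using infsumI[OF b_up_has_sum[OF assms]]
  by (simp add: schroedinger_matrix_def coef_b_fun dimension_def algebra_simps)

lemma schroedinger_matrix_diag_Down:
  "schroedinger_matrix Down \<tau> \<tau> = (\<Sum>\<rho> | face S \<rho> \<tau>. (m \<tau>)\<^sup>2 / m \<rho>)"
  using infsumI[OF b_down_has_sum[of \<tau>]]
  by (simp add: schroedinger_matrix_def coef_b_fun flip: sum.distrib)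
     (simp add: power2_eq_square algebra_simps diff_divide_distrib)

text \<open>On the diagonal, c for \<open>Hodge\<close> is the sum of the two other diagonal entries
  minus the total of b; off the diagonal this is \<open>Hodge_b_o\<close>. Green's formula can then
  be proved for the two parts separately.\<close>

lemma schroedinger_matrix_Hodge:
  assumes "\<tau> \<in> S" "\<tau>' \<in> S"
  shows "schroedinger_matrix Hodge \<tau> \<tau>' = schroedinger_matrix Up \<tau> \<tau>' + schroedinger_matrix Down \<tau> \<tau>'"
proof (cases "\<tau>' = \<tau>")
  case True
  show ?thesis
    unfolding True schroedinger_matrix_diag_Up[OF assms(1)] schroedinger_matrix_diag_Down
    by (simp add: schroedinger_matrix_def)
next
  case False
  then show ?thesis
    unfolding schroedinger_matrix_def using Hodge_b_o[OF assms] by simp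
qed

lemma Fun_fin_prod_summable: "\<omega> \<in> Fun_fin S \<Longrightarrow> (\<lambda>\<tau>. f \<tau> * \<omega> \<tau>) summable_on A"
  for f :: "'v set \<Rightarrow> real"
  unfolding Fun_fin_def
  by (intro finite_nonzero_values_imp_summable_on) (auto elim: rev_finite_subset)

lemma schroedinger_Fun_fin:
  assumes \<tau>: "\<tau> \<in> S" and \<omega>: "\<omega> \<in> Fun_fin S"
  shows "schroedinger k S m \<delta> \<omega> \<tau> = 1 / m \<tau> * (\<Sum>\<^sub>\<infinity>\<tau>'\<in>S. schroedinger_matrix k \<tau> \<tau>' * \<omega> \<tau>')"
proof -
  let ?b = "coef_b k S m \<tau>" and ?o = "coef_o k S m \<delta> \<tau>"
  have s: "(\<lambda>\<tau>'. - (?b \<tau>' * ?o \<tau>') * \<omega> \<tau>') summable_on S" using \<omega> by (rule Fun_fin_prod_summable)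
  have "(\<Sum>\<^sub>\<infinity>\<tau>'\<in>S. ?b \<tau>' * (\<omega> \<tau> - ?o \<tau>' * \<omega> \<tau>'))
      = (\<Sum>\<^sub>\<infinity>\<tau>'\<in>S. ?b \<tau>' * \<omega> \<tau> + - (?b \<tau>' * ?o \<tau>') * \<omega> \<tau>')"
    by (simp add: algebra_simps)
  also have "\<dots> = infsum ?b S * \<omega> \<tau> + (\<Sum>\<^sub>\<infinity>\<tau>'\<in>S. - (?b \<tau>' * ?o \<tau>') * \<omega> \<tau>')"
    using coef_b_summable[OF \<tau>, of k] s
    by (subst infsum_add) (auto simp: infsum_cmult_left' intro: summable_on_cmult_left)
  finally have 1: "(\<Sum>\<^sub>\<infinity>\<tau>'\<in>S. ?b \<tau>' * (\<omega> \<tau> - ?o \<tau>' * \<omega> \<tau>'))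
      = infsum ?b S * \<omega> \<tau> + (\<Sum>\<^sub>\<infinity>\<tau>'\<in>S. - (?b \<tau>' * ?o \<tau>') * \<omega> \<tau>')" .
  \<comment> \<open>The diagonal term is rewritten as a function supported at \<tau>, so that both
    parts become one sum over \<open>S\<close>.\<close>
  have "((\<lambda>\<tau>'. (if \<tau>' = \<tau> then (infsum ?b S + coef_c k S m \<tau>) * \<omega> \<tau> else 0) + - (?b \<tau>' * ?o \<tau>') * \<omega> \<tau>')
      has_sum (infsum ?b S + coef_c k S m \<tau>) * \<omega> \<tau> + (\<Sum>\<^sub>\<infinity>\<tau>'\<in>S. - (?b \<tau>' * ?o \<tau>') * \<omega> \<tau>')) S"
    using \<tau> s by (intro has_sum_add has_sum_infsum has_sum_finite_neutralI[of "{\<tau>}"]) auto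
  moreover have "(if \<tau>' = \<tau> then (infsum ?b S + coef_c k S m \<tau>) * \<omega> \<tau> else 0) + - (?b \<tau>' * ?o \<tau>') * \<omega> \<tau>'
      = schroedinger_matrix k \<tau> \<tau>' * \<omega> \<tau>'" for \<tau>'
    by (simp add: schroedinger_matrix_def coef_b_self)
  ultimately have 2: "(\<Sum>\<^sub>\<infinity>\<tau>'\<in>S. schroedinger_matrix k \<tau> \<tau>' * \<omega> \<tau>')
      = (infsum ?b S + coef_c k S m \<tau>) * \<omega> \<tau> + (\<Sum>\<^sub>\<infinity>\<tau>'\<in>S. - (?b \<tau>' * ?o \<tau>') * \<omega> \<tau>')"
    by (simp add: infsumI)
  show ?thesis unfolding schroedinger_def 1 2 by (simp only: distrib_left distrib_right) simp
qed

lemma schroedinger_outside: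
  assumes "\<tau> \<notin> S"
  shows "schroedinger k S m \<delta> \<omega> \<tau> = 0"
proof -
  have b: "coef_b k S m \<tau> \<tau>' = 0" for \<tau>'
    using coef_b_outside[OF assms] by (simp add: coef_b_commute[of _ \<tau>])
  then have "infsum (coef_b k S m \<tau>) S = 0" by (intro infsum_0)
  moreover have e: "{\<sigma>. face S \<tau> \<sigma>} = {}" "{\<sigma>. face S \<sigma> \<tau>} = {}" using assms by (simp_all add: face_def)
  ultimately have "coef_c k S m \<tau> = 0"
    by (cases k) (simp_all only: coef_c.simps e infsum_empty sum.empty mult_zero_right add_0 diff_self)
  with b show ?thesis by (simp add: schroedinger_def)
qed

text \<open>One value does not affect summability. This disposes of the diagonal entry and of the
  signs when a row or column is compared with \<open>phi\<close>.\<close>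

lemma l2_cong_off_point:
  assumes "f \<in> Fun_on S" "g \<in> Fun_on S" "\<And>\<sigma>. \<sigma> \<in> S \<Longrightarrow> \<sigma> \<noteq> \<tau> \<Longrightarrow> \<bar>f \<sigma>\<bar> = \<bar>g \<sigma>\<bar>"
  shows "f \<in> l2 S m \<longleftrightarrow> g \<in> l2 S m"
proof -
  have eq: "h summable_on S \<longleftrightarrow> h summable_on S - {\<tau>}" for h :: "'v set \<Rightarrow> real"
    by (metis Diff_empty Diff_insert0 insert_Diff summable_on_insert_iff)
  have "m \<sigma> * (f \<sigma>)\<^sup>2 = m \<sigma> * (g \<sigma>)\<^sup>2" if "\<sigma> \<in> S - {\<tau>}" for \<sigma>
    using assms(3)[of \<sigma>] that by (metis DiffE power2_abs singletonI)
  then have "(\<lambda>\<sigma>. m \<sigma> * (f \<sigma>)\<^sup>2) summable_on S \<longleftrightarrow> (\<lambda>\<sigma>. m \<sigma> * (g \<sigma>)\<^sup>2) summable_on S"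
    unfolding eq by (rule summable_on_cong)
  then show ?thesis using assms by (simp add: l2_def)
qed

lemma phi_Fun_on: "phi k S m \<tau> \<in> Fun_on S"
  by (simp add: Fun_on_def phi_def coef_b_outside)

lemma abs_phi: "\<tau>' \<in> S \<Longrightarrow> \<bar>phi k S m \<tau> \<tau>'\<bar> = coef_b k S m \<tau> \<tau>' / m \<tau>'"
  by (simp add: phi_def coef_b_nonneg m_nonneg)

lemma schroedinger_ind_l2_iff:
  assumes \<tau>: "\<tau> \<in> S"
  shows "schroedinger k S m \<delta> (ind \<tau>) \<in> l2 S m \<longleftrightarrow> phi k S m \<tau> \<in> l2 S m"
proof (rule l2_cong_off_point[OF _ phi_Fun_on])
  show "schroedinger k S m \<delta> (ind \<tau>) \<in> Fun_on S" by (simp add: Fun_on_def schroedinger_outside)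
  fix \<sigma> assume \<sigma>: "\<sigma> \<in> S" "\<sigma> \<noteq> \<tau>"
  have "(\<Sum>\<^sub>\<infinity>\<tau>'\<in>S. schroedinger_matrix k \<sigma> \<tau>' * ind \<tau> \<tau>') = (\<Sum>\<^sub>\<infinity>\<tau>'\<in>{\<tau>}. schroedinger_matrix k \<sigma> \<tau>')"
    using \<tau> by (intro infsum_cong_neutral) (auto simp: indicator_def)
  then have "\<bar>schroedinger k S m \<delta> (ind \<tau>) \<sigma>\<bar> = coef_b k S m \<sigma> \<tau> / m \<sigma>"
    using \<sigma> \<tau> by (simp add: schroedinger_Fun_fin ind_Fun_fin abs_mult abs_schroedinger_matrix m_nonneg)
  then show "\<bar>schroedinger k S m \<delta> (ind \<tau>) \<sigma>\<bar> = \<bar>phi k S m \<tau> \<sigma>\<bar>"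
    using \<sigma>(1) by (simp add: abs_phi coef_b_commute[of k \<sigma>])
qed

lemma schroedinger_image_iff:
  "schroedinger k S m \<delta> ` Fun_fin S \<subseteq> l2 S m \<longleftrightarrow> (\<forall>\<tau>\<in>S. phi k S m \<tau> \<in> l2 S m)"
proof
  assume "schroedinger k S m \<delta> ` Fun_fin S \<subseteq> l2 S m"
  then show "\<forall>\<tau>\<in>S. phi k S m \<tau> \<in> l2 S m"
    using schroedinger_ind_l2_iff ind_Fun_fin by blast
next
  assume phi: "\<forall>\<tau>\<in>S. phi k S m \<tau> \<in> l2 S m"
  have "\<omega> \<in> Fun_fin S \<and> schroedinger k S m \<delta> \<omega> \<in> l2 S m" if "\<omega> \<in> Fun_fin S" for \<omega>
    using that
  proof (induction rule: Fun_fin_induct)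
    case zero
    have "schroedinger k S m \<delta> (\<lambda>_. 0) = (\<lambda>_. 0)" by (simp add: fun_eq_iff schroedinger_def)
    then show ?case by simp
  next
    case (lincomb \<omega> \<eta> a b)
    let ?\<psi> = "\<lambda>\<tau>. a * \<omega> \<tau> + b * \<eta> \<tau>"
    have \<psi>: "?\<psi> \<in> Fun_fin S" using lincomb by (simp add: Fun_fin_lincomb)
    have "schroedinger k S m \<delta> ?\<psi> \<tau>
        = a * schroedinger k S m \<delta> \<omega> \<tau> + b * schroedinger k S m \<delta> \<eta> \<tau>" for \<tau>
    proof (cases "\<tau> \<in> S")
      case True
      let ?M = "schroedinger_matrix k \<tau>"
      have s: "(\<lambda>\<tau>'. ?M \<tau>' * \<omega> \<tau>') summable_on S" "(\<lambda>\<tau>'. ?M \<tau>' * \<eta> \<tau>') summable_on S"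
        using lincomb by (simp_all add: Fun_fin_prod_summable)
      have "(\<Sum>\<^sub>\<infinity>\<tau>'\<in>S. ?M \<tau>' * ?\<psi> \<tau>') = (\<Sum>\<^sub>\<infinity>\<tau>'\<in>S. a * (?M \<tau>' * \<omega> \<tau>') + b * (?M \<tau>' * \<eta> \<tau>'))"
        by (simp add: algebra_simps)
      also have "\<dots> = a * (\<Sum>\<^sub>\<infinity>\<tau>'\<in>S. ?M \<tau>' * \<omega> \<tau>') + b * (\<Sum>\<^sub>\<infinity>\<tau>'\<in>S. ?M \<tau>' * \<eta> \<tau>')"
        by (subst infsum_add) (simp_all only: infsum_cmult_right' summable_on_cmult_right s)
      finally show ?thesis
        using lincomb by (simp add: schroedinger_Fun_fin[OF True] \<psi> add_divide_distrib)
    qed (simp add: schroedinger_outside)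
    then have "schroedinger k S m \<delta> ?\<psi>
        = (\<lambda>\<tau>. a * schroedinger k S m \<delta> \<omega> \<tau> + b * schroedinger k S m \<delta> \<eta> \<tau>)" by blast
    then show ?case using \<psi> lincomb by (simp add: l2_lincomb)
  next
    case (ind \<tau>)
    then show ?case using phi ind_Fun_fin schroedinger_ind_l2_iff by blast
  qed
  then show "schroedinger k S m \<delta> ` Fun_fin S \<subseteq> l2 S m" by blast
qed

text \<open>Since b(\<tau>, \<tau>') is m(\<tau>') times \<open>phi\<close>, the sums defining
  \<open>schroedinger_space\<close> are absolute pairings with \<open>phi\<close>. The converse is
  the gliding construction of \<open>summable_square_if_pairings_summable\<close>.\<close>

lemma phi_l2_iff: "(\<forall>\<tau>\<in>S. phi k S m \<tau> \<in> l2 S m) \<longleftrightarrow> l2 S m \<subseteq> schroedinger_space k S m"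
proof -
  have b_eq: "coef_b k S m \<tau> \<tau>' = m \<tau>' * phi k S m \<tau> \<tau>'" if "\<tau>' \<in> S" for \<tau> \<tau>'
    using m_pos[OF that] by (simp add: phi_def)
  have phi_nonneg: "\<tau>' \<in> S \<Longrightarrow> 0 \<le> phi k S m \<tau> \<tau>'" for \<tau> \<tau>'
    by (simp add: phi_def coef_b_nonneg m_nonneg)
  show ?thesis
  proof
    assume phi: "\<forall>\<tau>\<in>S. phi k S m \<tau> \<in> l2 S m"
    show "l2 S m \<subseteq> schroedinger_space k S m"
    proof
      fix \<omega> assume \<omega>: "\<omega> \<in> l2 S m"
      have "(\<lambda>\<tau>'. coef_b k S m \<tau> \<tau>' * \<bar>\<omega> \<tau>'\<bar>) summable_on S" if "\<tau> \<in> S" for \<tau>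
        using l2_abs_prod_summable[of "phi k S m \<tau>" \<omega>] phi that \<omega>
        by (subst summable_on_cong[of S _ "\<lambda>\<tau>'. m \<tau>' * \<bar>phi k S m \<tau> \<tau>'\<bar> * \<bar>\<omega> \<tau>'\<bar>"])
           (auto simp: b_eq phi_nonneg)
      then show "\<omega> \<in> schroedinger_space k S m"
        using \<omega> by (simp add: schroedinger_space_def l2_Fun_on)
    qed
  next
    assume sub: "l2 S m \<subseteq> schroedinger_space k S m"
    show "\<forall>\<tau>\<in>S. phi k S m \<tau> \<in> l2 S m"
    proof
      fix \<tau> assume \<tau>: "\<tau> \<in> S"
      have "(\<lambda>\<tau>'. m \<tau>' * (phi k S m \<tau> \<tau>')\<^sup>2) summable_on S"
      proof (rule summable_square_if_pairings_summable)
        fix g :: "'v set \<Rightarrow> real"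
        assume g: "(\<lambda>\<tau>'. m \<tau>' * (g \<tau>')\<^sup>2) summable_on S"
        define \<omega> where "\<omega> \<tau>' = (if \<tau>' \<in> S then g \<tau>' else 0)" for \<tau>'
        have "(\<lambda>\<tau>'. m \<tau>' * (\<omega> \<tau>')\<^sup>2) summable_on S"
          using g by (rule summable_on_cong[THEN iffD1, rotated]) (simp add: \<omega>_def)
        then have "\<omega> \<in> l2 S m" by (simp add: l2_def Fun_on_def \<omega>_def)
        then have "(\<lambda>\<tau>'. coef_b k S m \<tau> \<tau>' * \<bar>\<omega> \<tau>'\<bar>) summable_on S"
          using sub \<tau> by (auto simp: schroedinger_space_def)
        then show "(\<lambda>\<tau>'. m \<tau>' * phi k S m \<tau> \<tau>' * \<bar>g \<tau>'\<bar>) summable_on S"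
          by (rule summable_on_cong[THEN iffD1, rotated]) (simp add: b_eq \<omega>_def)
      qed (auto simp: m_nonneg phi_nonneg)
      then show "phi k S m \<tau> \<in> l2 S m" using phi_Fun_on by (simp add: l2_def)
    qed
  qed
qed

text \<open>The function \<delta>\<phi> is not assumed square summable: the pairing reduces to a sum
  over the cofaces of \<tau>, and its convergence comes from the absolute summability
  hypothesis.\<close>

lemma Green_Up:
  assumes \<tau>: "\<tau> \<in> S" and \<phi>: "\<phi> \<in> Fun_on S"
    and s: "(\<lambda>\<tau>'. b_up S m \<tau> \<tau>' * \<bar>\<phi> \<tau>'\<bar>) summable_on S"
  shows "((\<lambda>\<tau>'. schroedinger_matrix Up \<tau> \<tau>' * \<phi> \<tau>') has_sum inner (\<delta> (ind \<tau>)) (\<delta> \<phi>)) S"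
proof -
  let ?M = "\<Sum>\<^sub>\<infinity>\<sigma> | face S \<tau> \<sigma>. m \<sigma>"
  define g where "g \<tau>' = - (b_up S m \<tau> \<tau>' * o_up S \<delta> \<tau> \<tau>') * \<phi> \<tau>'" for \<tau>'
  have "\<bar>g \<tau>'\<bar> = b_up S m \<tau> \<tau>' * \<bar>\<phi> \<tau>'\<bar>" if "\<tau>' \<in> S" for \<tau>'
    using abs_b_o[OF \<tau> that, of Up] by (simp add: g_def abs_mult)
  then have "(\<lambda>\<tau>'. norm (g \<tau>')) summable_on S"
    using s by (subst summable_on_cong[of S _ "\<lambda>\<tau>'. b_up S m \<tau> \<tau>' * \<bar>\<phi> \<tau>'\<bar>"]) simp_all
  then have gs: "g summable_on S" by (rule abs_summable_summable)
  have fibers: "((\<lambda>\<sigma>. \<Sum>\<tau>' | face S \<tau>' \<sigma> \<and> \<tau>' \<noteq> \<tau>. g \<tau>') has_sum infsum g S) {\<sigma>. face S \<tau> \<sigma>}"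
    by (rule has_sum_up_adj[OF gs]) (simp add: g_def b_up_eq)
  have "((\<lambda>\<sigma>. m \<sigma> * \<phi> \<tau>) has_sum ?M * \<phi> \<tau>) {\<sigma>. face S \<tau> \<sigma>}"
    by (intro has_sum_cmult_left has_sum_infsum cofaces_summable)
  from has_sum_add[OF this fibers]
  have "((\<lambda>\<sigma>. m \<sigma> * \<theta> \<tau> \<sigma> * \<delta> \<phi> \<sigma>) has_sum ?M * \<phi> \<tau> + infsum g S) {\<sigma>. face S \<tau> \<sigma>}"
  proof (rule has_sum_cong[THEN iffD1, rotated])
    fix \<sigma> assume "\<sigma> \<in> {\<sigma>. face S \<tau> \<sigma>}"
    then have \<sigma>: "face S \<tau> \<sigma>" by simp
    have split: "{\<tau>'. face S \<tau>' \<sigma>} = insert \<tau> {\<tau>'. face S \<tau>' \<sigma> \<and> \<tau>' \<noteq> \<tau>}" using \<sigma> by blast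
    have fin: "finite {\<tau>'. face S \<tau>' \<sigma> \<and> \<tau>' \<noteq> \<tau>}"
      using finite_faces[of \<sigma>] by (rule rev_finite_subset) auto
    have \<delta>\<phi>: "\<delta> \<phi> \<sigma> = \<phi> \<tau> * \<theta> \<tau> \<sigma> + (\<Sum>\<tau>' | face S \<tau>' \<sigma> \<and> \<tau>' \<noteq> \<tau>. \<phi> \<tau>' * \<theta> \<tau>' \<sigma>)"
      unfolding coboundary_eq[OF \<phi> face_in(2)[OF \<sigma>]] split using fin by (subst sum.insert) auto
    \<comment> \<open>The minus sign in \<open>g\<close> cancels the one built into
      \<open>o_up\<close>.\<close>
    have g_eq: "g \<tau>' = m \<sigma> * \<theta> \<tau> \<sigma> * (\<phi> \<tau>' * \<theta> \<tau>' \<sigma>)" if "face S \<tau>' \<sigma>" "\<tau>' \<noteq> \<tau>" for \<tau>'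
      using \<sigma> that by (simp add: g_def b_up_def o_up_def faces_union[OF \<sigma> that])
    have "(\<Sum>\<tau>' | face S \<tau>' \<sigma> \<and> \<tau>' \<noteq> \<tau>. g \<tau>')
        = m \<sigma> * \<theta> \<tau> \<sigma> * (\<Sum>\<tau>' | face S \<tau>' \<sigma> \<and> \<tau>' \<noteq> \<tau>. \<phi> \<tau>' * \<theta> \<tau>' \<sigma>)"
      unfolding sum_distrib_left by (intro sum.cong) (simp_all add: g_eq)
    then show "m \<sigma> * \<phi> \<tau> + (\<Sum>\<tau>' | face S \<tau>' \<sigma> \<and> \<tau>' \<noteq> \<tau>. g \<tau>') = m \<sigma> * \<theta> \<tau> \<sigma> * \<delta> \<phi> \<sigma>"
      using incidence_square[OF \<sigma>] by (simp add: \<delta>\<phi> algebra_simps)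
  qed
  then have ip: "inner (\<delta> (ind \<tau>)) (\<delta> \<phi>) = ?M * \<phi> \<tau> + infsum g S"
    by (simp add: inner_coboundary_ind[OF \<tau>] infsumI)
  have "((\<lambda>\<tau>'. (if \<tau>' = \<tau> then ?M * \<phi> \<tau> else 0) + g \<tau>') has_sum ?M * \<phi> \<tau> + infsum g S) S"
    using \<tau> gs by (intro has_sum_add has_sum_infsum has_sum_finite_neutralI[of "{\<tau>}"]) auto
  moreover have "(if \<tau>' = \<tau> then ?M * \<phi> \<tau> else 0) + g \<tau>' = schroedinger_matrix Up \<tau> \<tau>' * \<phi> \<tau>'" for \<tau>'
    using schroedinger_matrix_diag_Up[OF \<tau>] coef_b_self[of Up \<tau>]
    by (cases "\<tau>' = \<tau>") (simp_all add: g_def schroedinger_matrix_def)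
  ultimately show ?thesis by (simp add: ip)
qed

text \<open>Only finitely many values of \<partial>\<phi> enter, one for each face of \<tau>, and
  each is a convergent sum for \<phi> in \<open>l2\<close>.\<close>

lemma Green_Down:
  assumes \<tau>: "\<tau> \<in> S" and \<phi>: "\<phi> \<in> l2 S m"
  shows "((\<lambda>\<tau>'. schroedinger_matrix Down \<tau> \<tau>' * \<phi> \<tau>') has_sum inner (bd (ind \<tau>)) (bd \<phi>)) S"
proof -
  let ?R = "\<Sum>\<rho> | face S \<rho> \<tau>. (m \<tau>)\<^sup>2 / m \<rho>"
  define g where "g \<tau>' = - (b_down S m \<tau> \<tau>' * o_down S \<delta> \<tau> \<tau>') * \<phi> \<tau>'" for \<tau>'
  have g_eq: "g \<tau>' = m \<tau> / m \<rho> * \<theta> \<rho> \<tau> * (m \<tau>' * \<phi> \<tau>' * \<theta> \<rho> \<tau>')"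
    if "face S \<rho> \<tau>" "face S \<rho> \<tau>'" "\<tau>' \<noteq> \<tau>" for \<rho> \<tau>'
    using that by (simp add: g_def b_down_other_coface[OF that] o_down_def cofaces_inter[OF that])
  have \<theta>s: "(\<lambda>\<tau>'. m \<tau>' * \<phi> \<tau>' * \<theta> \<rho> \<tau>') summable_on {\<tau>'. face S \<rho> \<tau>' \<and> \<tau>' \<noteq> \<tau>}" for \<rho>
  proof (rule abs_summable_summable)
    have "(\<lambda>\<tau>'. norm (m \<tau>' * \<phi> \<tau>')) summable_on {\<tau>'. face S \<rho> \<tau>' \<and> \<tau>' \<noteq> \<tau>}"
      by (rule summable_on_iff_abs_summable_on_real[THEN iffD1, OF other_cofaces_summable(2)[OF \<phi>]])
    then show "(\<lambda>\<tau>'. norm (m \<tau>' * \<phi> \<tau>' * \<theta> \<rho> \<tau>')) summable_on {\<tau>'. face S \<rho> \<tau>' \<and> \<tau>' \<noteq> \<tau>}"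
      by (rule summable_on_cong[THEN iffD1, rotated]) (auto simp: abs_mult abs_incidence)
  qed
  have gs: "g summable_on {\<tau>'. face S \<rho> \<tau>' \<and> \<tau>' \<noteq> \<tau>}" if "face S \<rho> \<tau>" for \<rho>
    using summable_on_cmult_right[OF \<theta>s, of "m \<tau> / m \<rho> * \<theta> \<rho> \<tau>"]
    by (rule summable_on_cong[THEN iffD1, rotated]) (simp add: g_eq[OF that])
  have G: "(g has_sum (\<Sum>\<rho> | face S \<rho> \<tau>. \<Sum>\<^sub>\<infinity>\<tau>' | face S \<rho> \<tau>' \<and> \<tau>' \<noteq> \<tau>. g \<tau>')) S"
    by (rule has_sum_down_adj[OF gs]) (simp_all add: g_def b_down_eq)
  have "m \<tau> * \<theta> \<rho> \<tau> * bd \<phi> \<rho> = (m \<tau>)\<^sup>2 / m \<rho> * \<phi> \<tau> + (\<Sum>\<^sub>\<infinity>\<tau>' | face S \<rho> \<tau>' \<and> \<tau>' \<noteq> \<tau>. g \<tau>')"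
    if \<rho>: "face S \<rho> \<tau>" for \<rho>
  proof -
    \<comment> \<open>The term of \<tau> itself gives the diagonal entry through \<theta>^2 = 1; the
      remaining cofaces give the fibre over \<rho>.\<close>
    have split: "{\<tau>'. face S \<rho> \<tau>'} = insert \<tau> {\<tau>'. face S \<rho> \<tau>' \<and> \<tau>' \<noteq> \<tau>}" using \<rho> by blast
    have "bd \<phi> \<rho> = 1 / m \<rho> * (m \<tau> * \<phi> \<tau> * \<theta> \<rho> \<tau>
        + (\<Sum>\<^sub>\<infinity>\<tau>' | face S \<rho> \<tau>' \<and> \<tau>' \<noteq> \<tau>. m \<tau>' * \<phi> \<tau>' * \<theta> \<rho> \<tau>'))"
      unfolding boundary_def split by (subst infsum_insert[OF \<theta>s]) auto
    moreover have "(\<Sum>\<^sub>\<infinity>\<tau>' | face S \<rho> \<tau>' \<and> \<tau>' \<noteq> \<tau>. g \<tau>') = m \<tau> / m \<rho> * \<theta> \<rho> \<tau>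
        * (\<Sum>\<^sub>\<infinity>\<tau>' | face S \<rho> \<tau>' \<and> \<tau>' \<noteq> \<tau>. m \<tau>' * \<phi> \<tau>' * \<theta> \<rho> \<tau>')"
      unfolding infsum_cmult_right'[symmetric] by (intro infsum_cong) (simp add: g_eq[OF \<rho>])
    ultimately show ?thesis
      using incidence_square[OF \<rho>] by (simp add: power2_eq_square algebra_simps add_divide_distrib)
  qed
  then have ip: "inner (bd (ind \<tau>)) (bd \<phi>)
      = ?R * \<phi> \<tau> + (\<Sum>\<rho> | face S \<rho> \<tau>. \<Sum>\<^sub>\<infinity>\<tau>' | face S \<rho> \<tau>' \<and> \<tau>' \<noteq> \<tau>. g \<tau>')"
    by (simp add: inner_boundary_ind sum.distrib sum_distrib_right)
  have "((\<lambda>\<tau>'. (if \<tau>' = \<tau> then ?R * \<phi> \<tau> else 0) + g \<tau>') has_sum inner (bd (ind \<tau>)) (bd \<phi>)) S"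
    unfolding ip using \<tau> by (intro has_sum_add[OF _ G] has_sum_finite_neutralI[of "{\<tau>}"]) auto
  moreover have "(if \<tau>' = \<tau> then ?R * \<phi> \<tau> else 0) + g \<tau>' = schroedinger_matrix Down \<tau> \<tau>' * \<phi> \<tau>'" for \<tau>'
    using schroedinger_matrix_diag_Down[of \<tau>] coef_b_self[of Down \<tau>]
    by (cases "\<tau>' = \<tau>") (simp_all add: g_def schroedinger_matrix_def)
  ultimately show ?thesis by simp
qed

text \<open>For \<open>Hodge\<close> this is the polarized sum of the up and down energies, without
  the cross terms of the pairing of \<delta>\<omega> + \<partial>\<omega> with \<delta>\<phi> +
  \<partial>\<phi>.\<close>

definition energy_inner where
  "energy_inner k \<omega> \<phi> =
     (if k = Down then 0 else inner (\<delta> \<omega>) (\<delta> \<phi>)) + (if k = Up then 0 else inner (bd \<omega>) (bd \<phi>))"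

lemma Green:
  assumes \<tau>: "\<tau> \<in> S" and \<phi>: "\<phi> \<in> l2 S m" "\<phi> \<in> schroedinger_space k S m"
  shows "((\<lambda>\<tau>'. schroedinger_matrix k \<tau> \<tau>' * \<phi> \<tau>') has_sum energy_inner k (ind \<tau>) \<phi>) S"
proof -
  have b: "(\<lambda>\<tau>'. coef_b k S m \<tau> \<tau>' * \<bar>\<phi> \<tau>'\<bar>) summable_on S"
    using \<phi>(2) \<tau> by (simp add: schroedinger_space_def)
  show ?thesis
  proof (cases k)
    case Up
    then show ?thesis using Green_Up[OF \<tau> l2_Fun_on[OF \<phi>(1)]] b by (simp add: energy_inner_def)
  next
    case Down
    then show ?thesis using Green_Down[OF \<tau> \<phi>(1)] by (simp add: energy_inner_def)
  next
    case Hodge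
    have "(\<lambda>\<tau>'. \<bar>\<phi> \<tau>'\<bar>) \<in> l2 S m" using \<phi>(1) by (simp add: l2_def Fun_on_def)
    then have "(\<lambda>\<tau>'. coef_b k S m \<tau> \<tau>' * \<bar>\<phi> \<tau>'\<bar> + b_down S m \<tau> \<tau>' * \<bar>\<phi> \<tau>'\<bar>) summable_on S"
      by (intro summable_on_add b b_down_l2_summable)
    then have "(\<lambda>\<tau>'. b_up S m \<tau> \<tau>' * \<bar>\<phi> \<tau>'\<bar>) summable_on S"
    proof (rule summable_on_comparison_test)
      show "b_up S m \<tau> \<tau>' * \<bar>\<phi> \<tau>'\<bar> \<le> coef_b k S m \<tau> \<tau>' * \<bar>\<phi> \<tau>'\<bar> + b_down S m \<tau> \<tau>' * \<bar>\<phi> \<tau>'\<bar>" for \<tau>'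
        unfolding distrib_right[symmetric] Hodge by (intro mult_right_mono) auto
    qed (simp add: b_up_nonneg)
    note sums = has_sum_add[OF Green_Up[OF \<tau> l2_Fun_on[OF \<phi>(1)] this] Green_Down[OF \<tau> \<phi>(1)]]
    have "schroedinger_matrix Hodge \<tau> \<tau>' * \<phi> \<tau>'
        = schroedinger_matrix Up \<tau> \<tau>' * \<phi> \<tau>' + schroedinger_matrix Down \<tau> \<tau>' * \<phi> \<tau>'"
      if "\<tau>' \<in> S" for \<tau>'
      by (simp add: schroedinger_matrix_Hodge[OF \<tau> that] distrib_right)
    note cong = has_sum_cong[of S, OF this]
    have "energy_inner Hodge (ind \<tau>) \<phi> = inner (\<delta> (ind \<tau>)) (\<delta> \<phi>) + inner (bd (ind \<tau>)) (bd \<phi>)"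
      by (simp add: energy_inner_def)
    then show ?thesis unfolding Hodge using sums by (simp only: cong)
  qed
qed

section \<open>Forms of Laplacians and operator domains\<close>

lemma admissible_form:
  assumes "admissible_Laplacian k S m \<delta> L"
  obtains Q where "L = form_operator S m Q" "Fun_fin S \<subseteq> form_dom Q" "form_dom Q \<subseteq> l2 S m"
    "\<And>\<omega> \<phi>. \<omega> \<in> form_dom Q \<Longrightarrow> \<phi> \<in> form_dom Q \<Longrightarrow> form_bilinear Q \<omega> \<phi> = energy_inner k \<omega> \<phi>"
    "\<And>\<omega> \<eta> a b. \<omega> \<in> form_dom Q \<Longrightarrow> \<eta> \<in> form_dom Q \<Longrightarrow> (\<lambda>\<tau>. a * \<omega> \<tau> + b * \<eta> \<tau>) \<in> form_dom Q"
    "\<And>\<omega> \<eta> \<phi> a b. \<omega> \<in> form_dom Q \<Longrightarrow> \<eta> \<in> form_dom Q \<Longrightarrow> \<phi> \<in> form_dom Q \<Longrightarrow>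
      form_bilinear Q (\<lambda>\<tau>. a * \<omega> \<tau> + b * \<eta> \<tau>) \<phi> = a * form_bilinear Q \<omega> \<phi> + b * form_bilinear Q \<eta> \<phi>"
proof -
  from assms obtain Q where Q: "positive_form S m Q" "L = form_operator S m Q"
    "Dirichlet_form k S m \<delta> \<sqsubseteq>\<^sub>Q Q" "Q \<sqsubseteq>\<^sub>Q Neumann_form k S m \<delta>"
    and HQ: "k = Hodge \<Longrightarrow> Q \<sqsubseteq>\<^sub>Q form_add (Neumann_form Up S m \<delta>) (Neumann_form Down S m \<delta>)"
    unfolding admissible_Laplacian_def is_Laplacian_def closed_form_def by blast
  have lincomb: "(\<lambda>\<tau>. a * \<omega> \<tau> + b * \<eta> \<tau>) \<in> form_dom Q"
    if "\<omega> \<in> form_dom Q" "\<eta> \<in> form_dom Q" for \<omega> \<eta> a b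
    using Q(1) that unfolding positive_form_def by blast
  have bilinear: "form_bilinear Q (\<lambda>\<tau>. a * \<omega> \<tau> + b * \<eta> \<tau>) \<phi>
      = a * form_bilinear Q \<omega> \<phi> + b * form_bilinear Q \<eta> \<phi>"
    if "\<omega> \<in> form_dom Q" "\<eta> \<in> form_dom Q" "\<phi> \<in> form_dom Q" for \<omega> \<eta> \<phi> a b
    using Q(1) that unfolding positive_form_def by blast
  have "Fun_fin S \<subseteq> form_dom (Dirichlet_form k S m \<delta>)"
    unfolding Dirichlet_form_eq K.T_form_simps by (intro K.graph_closure_superset Fun_fin_max_dom)
  with Q(3) have fin: "Fun_fin S \<subseteq> form_dom Q" by (auto simp: form_le_def)
  have sub: "form_dom Q \<subseteq> l2 S m" using Q(1) by (simp add: positive_form_def)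
  have N: "\<omega> \<in> K.max_dom k \<and> form_val Q \<omega> = normsq (kind_map k S m \<delta> \<omega>)" if "\<omega> \<in> form_dom Q" for \<omega>
    using Q(4) that unfolding form_le_def Neumann_form_eq K.T_form_simps by blast
  have form: "form_bilinear Q \<omega> \<phi> = energy_inner k \<omega> \<phi>" if d: "\<omega> \<in> form_dom Q" "\<phi> \<in> form_dom Q" for \<omega> \<phi>
  proof -
    have pm: "(\<lambda>\<tau>. \<omega> \<tau> + \<phi> \<tau>) \<in> form_dom Q" "(\<lambda>\<tau>. \<omega> \<tau> - \<phi> \<tau>) \<in> form_dom Q"
      using lincomb[OF d, of 1 1] lincomb[OF d, of 1 "-1"] by simp_all
    show ?thesis
    proof (cases "k = Hodge")
      case False
      have "form_bilinear Q \<omega> \<phi> = form_bilinear (K.T_form k (form_dom Q)) \<omega> \<phi>"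
        unfolding form_bilinear_def K.T_form_simps using N[OF pm(1)] N[OF pm(2)] by simp
      also have "\<dots> = inner (kind_map k S m \<delta> \<omega>) (kind_map k S m \<delta> \<phi>)"
        using N d by (intro K.form_bilinear_T_form) blast+
      finally show ?thesis using False by (cases k) (simp_all add: energy_inner_def)
    next
      case True
      \<comment> \<open>The additional condition on Hodge Laplacians enters here: it splits the
        value of the form, and with it the polarization.\<close>
      have H: "\<omega> \<in> K.max_dom Up \<and> \<omega> \<in> K.max_dom Down \<and>
          form_val Q \<omega> = normsq (kind_map Up S m \<delta> \<omega>) + normsq (kind_map Down S m \<delta> \<omega>)"
        if "\<omega> \<in> form_dom Q" for \<omega>
        using HQ[OF True] that
        unfolding form_le_def form_add_def Neumann_form_eq K.T_form_simps qform.sel by blast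
      have "form_bilinear Q \<omega> \<phi> = form_bilinear (K.T_form Up UNIV) \<omega> \<phi> + form_bilinear (K.T_form Down UNIV) \<omega> \<phi>"
        unfolding form_bilinear_def K.T_form_simps using H[OF pm(1)] H[OF pm(2)]
        by (simp add: field_simps)
      also have "form_bilinear (K.T_form Up UNIV) \<omega> \<phi> = inner (\<delta> \<omega>) (\<delta> \<phi>)"
        using K.form_bilinear_T_form[of \<omega> Up \<phi>] H d by simp
      also have "form_bilinear (K.T_form Down UNIV) \<omega> \<phi> = inner (bd \<omega>) (bd \<phi>)"
        using K.form_bilinear_T_form[of \<omega> Down \<phi>] H d by simp
      finally show ?thesis by (simp add: True energy_inner_def)
    qed
  qed
  show thesis using that[OF Q(2) fin sub form lincomb bilinear] .
qed

text \<open>The description by \<open>THE\<close> concerns the value of the operator; membership in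
  the domain asks only that some representing function exists.\<close>

lemma dom_form_operator:
  "dom (form_operator S m Q) =
     {\<omega> \<in> form_dom Q. \<exists>\<eta>\<in>l2 S m. \<forall>\<phi>\<in>form_dom Q. form_bilinear Q \<omega> \<phi> = inner \<eta> \<phi>}"
  by (auto simp: form_operator_def Let_def dom_def split: if_splits)

text \<open>Green's formula yields the function representing the form at the indicator of \<tau> as
  row \<tau> of the matrix divided by m(\<sigma>). Comparing moduli is enough to relate it to
  \<open>phi\<close>.\<close>

lemma matrix_column_l2_iff:
  assumes \<tau>: "\<tau> \<in> S" and \<eta>: "\<eta> \<in> Fun_on S"
    and eq: "\<And>\<sigma>. \<sigma> \<in> S \<Longrightarrow> \<eta> \<sigma> = schroedinger_matrix k \<tau> \<sigma> / m \<sigma>"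
  shows "\<eta> \<in> l2 S m \<longleftrightarrow> phi k S m \<tau> \<in> l2 S m"
  using \<eta> phi_Fun_on
proof (rule l2_cong_off_point)
  fix \<sigma> assume "\<sigma> \<in> S" "\<sigma> \<noteq> \<tau>"
  then show "\<bar>\<eta> \<sigma>\<bar> = \<bar>phi k S m \<tau> \<sigma>\<bar>"
    using \<tau> by (simp add: eq abs_phi abs_schroedinger_matrix m_nonneg)
qed

lemma Fun_fin_subset_schroedinger_space: "Fun_fin S \<subseteq> schroedinger_space k S m"
  by (auto simp: schroedinger_space_def Fun_fin_def
      intro!: finite_nonzero_values_imp_summable_on elim!: rev_finite_subset)

lemma admissible_Fun_fin_dom_iff:
  assumes "admissible_Laplacian k S m \<delta> L"
  shows "Fun_fin S \<subseteq> dom L \<longleftrightarrow> (\<forall>\<tau>\<in>S. phi k S m \<tau> \<in> l2 S m)"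
proof -
  from assms obtain Q where L: "L = form_operator S m Q" and fin: "Fun_fin S \<subseteq> form_dom Q"
    and sub: "form_dom Q \<subseteq> l2 S m"
    and form: "\<And>\<omega> \<phi>. \<omega> \<in> form_dom Q \<Longrightarrow> \<phi> \<in> form_dom Q \<Longrightarrow> form_bilinear Q \<omega> \<phi> = energy_inner k \<omega> \<phi>"
    and lincomb_dom: "\<And>\<omega> \<eta> a b. \<omega> \<in> form_dom Q \<Longrightarrow> \<eta> \<in> form_dom Q \<Longrightarrow> (\<lambda>\<tau>. a * \<omega> \<tau> + b * \<eta> \<tau>) \<in> form_dom Q"
    and bilinear: "\<And>\<omega> \<eta> \<phi> a b. \<omega> \<in> form_dom Q \<Longrightarrow> \<eta> \<in> form_dom Q \<Longrightarrow> \<phi> \<in> form_dom Q \<Longrightarrow>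
      form_bilinear Q (\<lambda>\<tau>. a * \<omega> \<tau> + b * \<eta> \<tau>) \<phi> = a * form_bilinear Q \<omega> \<phi> + b * form_bilinear Q \<eta> \<phi>"
    by (rule admissible_form) blast
  show ?thesis
  proof
    assume dom: "Fun_fin S \<subseteq> dom L"
    show "\<forall>\<tau>\<in>S. phi k S m \<tau> \<in> l2 S m"
    proof
      fix \<tau> assume \<tau>: "\<tau> \<in> S"
      then obtain \<eta> where \<eta>: "\<eta> \<in> l2 S m" "\<And>\<phi>. \<phi> \<in> form_dom Q \<Longrightarrow> form_bilinear Q (ind \<tau>) \<phi> = inner \<eta> \<phi>"
        using dom ind_Fun_fin unfolding L dom_form_operator by blast
      have "\<eta> \<sigma> = schroedinger_matrix k \<tau> \<sigma> / m \<sigma>" if \<sigma>: "\<sigma> \<in> S" for \<sigma>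
      proof -
        have i: "ind \<tau> \<in> form_dom Q" "ind \<sigma> \<in> form_dom Q" "ind \<sigma> \<in> l2 S m" "ind \<sigma> \<in> schroedinger_space k S m"
          using ind_Fun_fin[OF \<tau>] ind_Fun_fin[OF \<sigma>] fin Fun_fin_subset_l2
            Fun_fin_subset_schroedinger_space by blast+
        have at_\<sigma>: "(\<Sum>\<^sub>\<infinity>\<tau>'\<in>S. f \<tau>' * ind \<sigma> \<tau>') = f \<sigma>" for f :: "'v set \<Rightarrow> real"
        proof -
          have "(\<Sum>\<^sub>\<infinity>\<tau>'\<in>S. f \<tau>' * ind \<sigma> \<tau>') = (\<Sum>\<^sub>\<infinity>\<tau>'\<in>{\<sigma>}. f \<tau>')"
            using \<sigma> by (intro infsum_cong_neutral) (auto simp: indicator_def)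
          then show ?thesis by simp
        qed
        \<comment> \<open>Testing against the indicator of \<sigma> reads off the value of \<eta> at
          \<sigma>.\<close>
        have "m \<sigma> * \<eta> \<sigma> = inner \<eta> (ind \<sigma>)" by (simp add: l2_inner_def at_\<sigma>)
        also have "\<dots> = energy_inner k (ind \<tau>) (ind \<sigma>)" using form[OF i(1,2)] \<eta>(2)[OF i(2)] by simp
        also have "\<dots> = schroedinger_matrix k \<tau> \<sigma>"
          using infsumI[OF Green[OF \<tau> i(3,4)]] by (simp add: at_\<sigma>)
        finally show ?thesis using m_pos[OF \<sigma>] by (simp add: field_simps)
      qed
      with \<eta>(1) show "phi k S m \<tau> \<in> l2 S m" using matrix_column_l2_iff[OF \<tau> l2_Fun_on] by blast
    qed
  next
    assume phi: "\<forall>\<tau>\<in>S. phi k S m \<tau> \<in> l2 S m"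
    then have space: "l2 S m \<subseteq> schroedinger_space k S m" by (simp add: phi_l2_iff)
    show "Fun_fin S \<subseteq> dom L"
    proof
      fix \<omega> assume "\<omega> \<in> Fun_fin S"
      then show "\<omega> \<in> dom L"
      \<comment> \<open>The domain of \<open>L\<close> is a linear subspace, so it is enough to
        represent the form at indicators.\<close>
      proof (induction rule: Fun_fin_induct)
        case zero
        have "form_bilinear Q (\<lambda>_. 0) \<phi> = inner (\<lambda>_. 0) \<phi>" if "\<phi> \<in> form_dom Q" for \<phi>
          using bilinear[of \<phi> \<phi> \<phi> 0 0] that by (simp add: l2_inner_def)
        then show ?case unfolding L dom_form_operator using fin Fun_fin_zero l2_zero by blast
      next
        case (lincomb \<omega> \<omega>' a b)
        then obtain \<eta> \<eta>' where d: "\<omega> \<in> form_dom Q" "\<omega>' \<in> form_dom Q"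
          and \<eta>: "\<eta> \<in> l2 S m" "\<And>\<phi>. \<phi> \<in> form_dom Q \<Longrightarrow> form_bilinear Q \<omega> \<phi> = inner \<eta> \<phi>"
          and \<eta>': "\<eta>' \<in> l2 S m" "\<And>\<phi>. \<phi> \<in> form_dom Q \<Longrightarrow> form_bilinear Q \<omega>' \<phi> = inner \<eta>' \<phi>"
          unfolding L dom_form_operator by blast
        have "form_bilinear Q (\<lambda>\<tau>. a * \<omega> \<tau> + b * \<omega>' \<tau>) \<phi> = inner (\<lambda>\<tau>. a * \<eta> \<tau> + b * \<eta>' \<tau>) \<phi>"
          if "\<phi> \<in> form_dom Q" for \<phi>
          using that sub \<eta> \<eta>' by (simp add: bilinear[OF d that] inner_lincomb_left subset_iff)
        then show ?case
          unfolding L dom_form_operator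
          using lincomb_dom[OF d, of a b] l2_lincomb[OF \<eta>(1) \<eta>'(1), of a b] by blast
      next
        case (ind \<tau>)
        define \<eta> where "\<eta> \<sigma> = (if \<sigma> \<in> S then schroedinger_matrix k \<tau> \<sigma> / m \<sigma> else 0)" for \<sigma>
        have "\<eta> \<in> l2 S m"
          using matrix_column_l2_iff[OF ind, of \<eta> k] phi ind by (simp add: \<eta>_def Fun_on_def)
        moreover have "form_bilinear Q (ind \<tau>) \<phi> = inner \<eta> \<phi>" if \<phi>: "\<phi> \<in> form_dom Q" for \<phi>
        proof -
          have "inner \<eta> \<phi> = (\<Sum>\<^sub>\<infinity>\<tau>'\<in>S. schroedinger_matrix k \<tau> \<tau>' * \<phi> \<tau>')"
            unfolding l2_inner_def by (rule infsum_cong) (simp add: \<eta>_def less_imp_neq[OF m_pos, symmetric])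
          also have "\<dots> = energy_inner k (ind \<tau>) \<phi>"
            using Green[OF ind] \<phi> sub space by (blast intro: infsumI)
          finally show ?thesis using form ind_Fun_fin[OF ind] fin \<phi> by (simp add: subset_iff)
        qed
        ultimately show ?case
          unfolding L dom_form_operator using ind_Fun_fin[OF ind] fin by blast
      qed
    qed
  qed
qed

text \<open>Duality in reverse: the norm of \<open>phi\<close> is not computed, but deduced from the
  fact that every \<open>l2\<close> function pairs absolutely with it.\<close>

lemma phi_Down_l2:
  assumes \<tau>: "\<tau> \<in> S"
  shows "phi Down S m \<tau> \<in> l2 S m"
proof -
  have "l2 S m \<subseteq> schroedinger_space Down S m"
  proof
    fix \<omega> assume \<omega>: "\<omega> \<in> l2 S m"
    then have "(\<lambda>\<tau>'. \<bar>\<omega> \<tau>'\<bar>) \<in> l2 S m" by (simp add: l2_def Fun_on_def)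
    then show "\<omega> \<in> schroedinger_space Down S m"
      using \<omega> b_down_l2_summable by (simp add: schroedinger_space_def l2_Fun_on)
  qed
  then show ?thesis using \<tau> phi_l2_iff by blast
qed

lemma phi_l2_if_locally_finite:
  assumes lf: "locally_finite_complex S" and \<tau>: "\<tau> \<in> S"
  shows "phi k S m \<tau> \<in> l2 S m"
proof -
  have "finite (up_adj \<tau>)"
  proof (cases "\<tau> = {}")
    \<comment> \<open>Local finiteness says nothing about the empty simplex, but that simplex has no
      up-neighbours: its union with \<tau>' is \<tau>', which is not its own face.\<close>
    case True
    then have "up_adj \<tau> = {}" by (auto simp: up_adj_def face_irrefl)
    then show ?thesis by simp
  next
    case False
    then have "finite {\<sigma>. face S \<tau> \<sigma>}" using lf \<tau> by (simp add: locally_finite_complex_def)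
    moreover have "finite {\<tau>'. face S \<tau>' \<sigma> \<and> \<tau>' \<noteq> \<tau>}" for \<sigma>
      using finite_faces[of \<sigma>] by (rule rev_finite_subset) auto
    ultimately show ?thesis unfolding up_adj_eq by blast
  qed
  then have "finite {\<tau>'. phi Up S m \<tau> \<tau>' \<noteq> 0}"
    by (rule rev_finite_subset) (auto simp: phi_def b_up_eq split: if_splits)
  then have "phi Up S m \<tau> \<in> Fun_fin S" using phi_Fun_on by (simp add: Fun_fin_def)
  then have up: "phi Up S m \<tau> \<in> l2 S m" using Fun_fin_subset_l2 by blast
  show ?thesis
  proof (cases k)
    case Hodge
    have "(\<lambda>\<tau>'. \<bar>phi Down S m \<tau> \<tau>' - phi Up S m \<tau> \<tau>'\<bar>) \<in> l2 S m"
      using l2_diff[OF phi_Down_l2[OF \<tau>] up] by (simp add: l2_def Fun_on_def)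
    moreover have "phi Hodge S m \<tau> \<tau>' = \<bar>phi Down S m \<tau> \<tau>' - phi Up S m \<tau> \<tau>'\<bar>" for \<tau>'
    proof (cases "\<tau>' \<in> S")
      case True
      then show ?thesis using m_nonneg by (simp add: phi_def flip: diff_divide_distrib)
    qed (simp add: Fun_on_outside[OF phi_Fun_on])
    ultimately show ?thesis unfolding Hodge by presburger
  qed (use up phi_Down_l2[OF \<tau>] in simp_all)
qed

end

theorem proposition3p18:
  fixes V :: "'v set" and Sh S :: "'v set set" and m :: "'v set \<Rightarrow> real"
    and \<delta> :: "('v set \<Rightarrow> real) \<Rightarrow> ('v set \<Rightarrow> real)" and k :: kind
  assumes "abstract_simplicial_complex V Sh"
    and "is_weight Sh m"
    and "S = simplices Sh m"
    and "locally_summable S m"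
    and "coboundary_operator S \<delta>"
  shows "((\<exists>L. admissible_Laplacian k S m \<delta> L \<and> Fun_fin S \<subseteq> dom L)
            \<longleftrightarrow> (\<forall>L. admissible_Laplacian k S m \<delta> L \<longrightarrow> Fun_fin S \<subseteq> dom L))
       \<and> ((\<forall>L. admissible_Laplacian k S m \<delta> L \<longrightarrow> Fun_fin S \<subseteq> dom L)
            \<longleftrightarrow> schroedinger k S m \<delta> ` Fun_fin S \<subseteq> l2 S m)
       \<and> (schroedinger k S m \<delta> ` Fun_fin S \<subseteq> l2 S m
            \<longleftrightarrow> (\<forall>\<tau>\<in>S. phi k S m \<tau> \<in> l2 S m))
       \<and> ((\<forall>\<tau>\<in>S. phi k S m \<tau> \<in> l2 S m)
            \<longleftrightarrow> l2 S m \<subseteq> schroedinger_space k S m)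
       \<and> (locally_finite_complex S \<longrightarrow>
            (\<exists>L. admissible_Laplacian k S m \<delta> L \<and> Fun_fin S \<subseteq> dom L)
          \<and> (\<forall>L. admissible_Laplacian k S m \<delta> L \<longrightarrow> Fun_fin S \<subseteq> dom L)
          \<and> schroedinger k S m \<delta> ` Fun_fin S \<subseteq> l2 S m
          \<and> (\<forall>\<tau>\<in>S. phi k S m \<tau> \<in> l2 S m)
          \<and> l2 S m \<subseteq> schroedinger_space k S m)"
proof -
  have S: "S \<subseteq> Sh" "\<tau> \<in> Sh \<Longrightarrow> \<tau> \<noteq> {} \<Longrightarrow> \<tau> \<in> S" for \<tau>
    using assms(3) by (auto simp: simplices_def)
  interpret weighted_complex S m \<delta>
  proof
    show "0 < m \<tau>" if "\<tau> \<in> S" for \<tau> using that S(1) assms(2) by (auto simp: is_weight_def)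
    show "finite \<tau>" if "\<tau> \<in> S" for \<tau>
      using that S(1) assms(1) by (auto simp: abstract_simplicial_complex_def)
    show "\<tau> \<in> S" if "\<sigma> \<in> S" "\<tau> \<subseteq> \<sigma>" "\<tau> \<noteq> {}" for \<tau> \<sigma>
      using that S assms(1) unfolding abstract_simplicial_complex_def by blast
  qed (use assms(4,5) in auto)
  obtain L where "admissible_Laplacian k S m \<delta> L" using admissible_Laplacian_exists by blast
  moreover have "Fun_fin S \<subseteq> dom L \<longleftrightarrow> (\<forall>\<tau>\<in>S. phi k S m \<tau> \<in> l2 S m)"
    if "admissible_Laplacian k S m \<delta> L" for L
    using that by (rule admissible_Fun_fin_dom_iff)
  \<comment> \<open>For each admissible \<open>L\<close> the domain inclusion is equivalent to a
    condition not mentioning \<open>L\<close>, so its validity for one \<open>L\<close> is its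
    validity for all.\<close>
  ultimately show ?thesis
    using schroedinger_image_iff[of k] phi_l2_iff[of k] phi_l2_if_locally_finite[of _ k] by meson
qed

end
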